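(* Let $\alpha=(\alpha_1,\ldots,\alpha_\ell)$ be a composition of $n$, let $W=\mathfrak S_n$, let $q$ be a prime power and $G=GL_n(\mathbb F_q)$. Then $$\left[\begin{matrix} n\\\alpha\end{matrix}\right]_{t}=\frac{\mathrm{Hilb}(\mathbb Z[\mathbf x]^{W_\alpha},t)}{\mathrm{Hilb}(\mathbb Z[\mathbf x]^{W},t)},\qquad \left[\begin{matrix} n\\\alpha\end{matrix}\right]_{q,t}=\frac{\mathrm{Hilb}(\mathbb F_q[\mathbf x]^{P_\alpha},t)}{\mathrm{Hilb}(\mathbb F_q[\mathbf x]^{G},t)}.$$ Furthermore, $\mathbb Z[\mathbf x]^{W_\alpha}$ and $\mathbb F_q[\mathbf x]^{P_\alpha}$ are free as modules over $\mathbb Z[\mathbf x]^W$ and $\mathbb F_q[\mathbf x]^{G}$, respectively, and hence $$\left[\begin{matrix} n\\\alpha\end{matrix}\right]_{t}=\mathrm{Hilb}\big(\mathbb Z[\mathbf x]^{W_\alpha}/(\mathbb Z[\mathbf x]^W_+),t\big),\qquad \left[\begin{matrix} n\\\alpha\end{matrix}\right]_{q,t}=\mathrm{Hilb}\big(\mathbb F_q[\mathbf x]^{P_\alpha}/(\mathbb F_q[\mathbf x]^G_+),t\big).$$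
   Context: Let $\sigma_s=\alpha_1+\cdots+\alpha_s$, $\sigma_0=0$. Multinomials: $$\left[\begin{matrix} n\\\alpha\end{matrix}\right]_{q,t}:=\frac{\prod_{i=1}^n(1-t^{q^n-q^{n-i}})}{\prod_{s=1}^\ell\prod_{i=1}^{\alpha_s}(1-t^{q^{\sigma_s}-q^{\sigma_s-i}})},\qquad \left[\begin{matrix} n\\\alpha\end{matrix}\right]_{t}:=\frac{\prod_{i=1}^n(1-t^i)}{\prod_{s=1}^\ell\prod_{i=1}^{\alpha_s}(1-t^i)}.$$ $\mathbb Z[\mathbf x]=\mathbb Z[x_1,\ldots,x_n]$ carries the $W$-action by permuting variables; $W_\alpha\subset W$ is the Young subgroup permuting separately the first $\alpha_1$ integers, the next $\alpha_2$ integers, etc. $\mathbb F_q[\mathbf x]=\mathbb F_q[x_1,\ldots,x_n]$ carries the $G$-action by linear substitutions of variables, i.e. the action induced by $G$ acting on the $\mathbb F_q$-span $\mathbb F_q^n$ of $x_1,\ldots,x_n$; $P_\alpha\subset G$ is the parabolic subgroup stabilizing a flag $0=V_0\subset V_1\subset\cdots\subset V_\ell=\mathbb F_q^n$ of subspaces of this span with $\dim V_i=\sigma_i$ (e.g. $V_i=\mathrm{span}(x_1,\ldots,x_{\sigma_i})$). For a graded ring of invariants $R^G$, $R^G_+$ denotes the invariants without constant term and, for $H\subset G$, $(R^G_+)$ the ideal they generate in $R^H$. All rings are graded by polynomial degree, and $\mathrm{Hilb}(M,t)=\sum_d \mathrm{rank}(M_d)\,t^d$, with rank over $\mathbb Z$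 or dimension over $\mathbb F_q$. *)

theory Defs
  imports
    "HOL-Library.Poly_Mapping"
    "HOL-Library.Cardinality"
    "HOL-Combinatorics.Permutations"
    "HOL-Computational_Algebra.Formal_Power_Series"
    "HOL-Algebra.QuotRing"
    "Jordan_Normal_Form.VS_Connect"
begin

section \<open>Compositions and multinomials\<close>

definition is_composition :: "nat list \<Rightarrow> nat \<Rightarrow> bool" where
  "is_composition \<alpha> n \<longleftrightarrow> (\<forall>a\<in>set \<alpha>. 0 < a) \<and> sum_list \<alpha> = n"

definition part_sum :: "nat list \<Rightarrow> nat \<Rightarrow> nat" where
  "part_sum \<alpha> s = sum_list (take s \<alpha>)"

text \<open>The multinomials are rational functions of \<open>t\<close>. Their denominators have constant term 1
  (for \<open>q \<ge> 2\<close>), so they are read as formal power series over the rationals, where Hilbert series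
  live as well. List entries are 0-based: the part \<open>\<alpha>\<^sub>s\<close> is \<open>\<alpha> ! (s - 1)\<close>.\<close>

definition t_multinomial :: "nat \<Rightarrow> nat list \<Rightarrow> rat fps" where
  "t_multinomial n \<alpha> =
     (\<Prod>i=1..n. 1 - fps_X ^ i) / (\<Prod>s=1..length \<alpha>. \<Prod>i=1..\<alpha> ! (s - 1). 1 - fps_X ^ i)"

definition qt_multinomial :: "nat \<Rightarrow> nat \<Rightarrow> nat list \<Rightarrow> rat fps" where
  "qt_multinomial q n \<alpha> =
     (\<Prod>i=1..n. 1 - fps_X ^ (q ^ n - q ^ (n - i))) /
     (\<Prod>s=1..length \<alpha>. \<Prod>i=1..\<alpha> ! (s - 1).
        1 - fps_X ^ (q ^ part_sum \<alpha> s - q ^ (part_sum \<alpha> s - i)))"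


section \<open>Polynomials in \<open>n\<close> variables\<close>

text \<open>An element of \<open>'a mvpoly\<close> is a polynomial in the variables \<open>x\<^sub>i\<close>, \<open>i :: nat\<close>. The ring in
  \<open>n\<close> variables uses the indices \<open>0, \<dots>, n - 1\<close> in place of \<open>1, \<dots>, n\<close>.\<close>

type_synonym 'a mvpoly = "(nat \<Rightarrow>\<^sub>0 nat) \<Rightarrow>\<^sub>0 'a"

definition mv_const :: "'a::comm_ring_1 \<Rightarrow> 'a mvpoly" where
  "mv_const c = Poly_Mapping.single 0 c"

definition mv_var :: "nat \<Rightarrow> 'a::comm_ring_1 mvpoly" where
  "mv_var i = Poly_Mapping.single (Poly_Mapping.single i 1) 1"

definition mv_subst :: "(nat \<Rightarrow> 'a mvpoly) \<Rightarrow> 'a::comm_ring_1 mvpoly \<Rightarrow> 'a mvpoly" where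
  "mv_subst f p = (\<Sum>m\<in>Poly_Mapping.keys p. mv_const (Poly_Mapping.lookup p m) *
                     (\<Prod>i\<in>Poly_Mapping.keys m. f i ^ Poly_Mapping.lookup m i))"

definition mv_homogeneous :: "nat \<Rightarrow> 'a::comm_ring_1 mvpoly \<Rightarrow> bool" where
  "mv_homogeneous d p \<longleftrightarrow>
     (\<forall>m\<in>Poly_Mapping.keys p. (\<Sum>i\<in>Poly_Mapping.keys m. Poly_Mapping.lookup m i) = d)"

definition mv_ring :: "nat \<Rightarrow> 'a::comm_ring_1 mvpoly ring" where
  "mv_ring n = \<lparr> carrier = {p. \<forall>m\<in>Poly_Mapping.keys p. Poly_Mapping.keys m \<subseteq> {..<n}},
                 mult = (*), one = 1, zero = 0, add = (+) \<rparr>"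


section \<open>Groups and their rings of invariants\<close>

definition invariant_ring ::
    "nat \<Rightarrow> ('a mvpoly \<Rightarrow> 'a mvpoly) set \<Rightarrow> 'a::comm_ring_1 mvpoly ring" where
  "invariant_ring n \<Phi> =
     (mv_ring n)\<lparr> carrier := {p \<in> carrier (mv_ring n). \<forall>\<phi>\<in>\<Phi>. \<phi> p = p} \<rparr>"

definition perm_action :: "(nat \<Rightarrow> nat) \<Rightarrow> 'a::comm_ring_1 mvpoly \<Rightarrow> 'a mvpoly" where
  "perm_action w = mv_subst (\<lambda>i. mv_var (w i))"

definition symmetric_group :: "nat \<Rightarrow> (nat \<Rightarrow> nat) set" where
  "symmetric_group n = {w. w permutes {..<n}}"

definition young_subgroup :: "nat \<Rightarrow> nat list \<Rightarrow> (nat \<Rightarrow> nat) set" where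
  "young_subgroup n \<alpha> = {w \<in> symmetric_group n.
     \<forall>s<length \<alpha>. w ` {part_sum \<alpha> s..<part_sum \<alpha> (Suc s)} = {part_sum \<alpha> s..<part_sum \<alpha> (Suc s)}}"

text \<open>A column vector \<open>v\<close> of length \<open>n\<close> stands for the linear form \<open>\<Sum>i<n. v\<^sub>i x\<^sub>i\<close>, and a matrix
  \<open>A\<close> sends the form of \<open>v\<close> to the form of \<open>A *\<^sub>v v\<close>; in particular it sends \<open>x\<^sub>j\<close> to the form given by
  its \<open>j\<close>-th column. \<open>linear_action\<close> extends this to polynomials.\<close>

definition linear_action :: "nat \<Rightarrow> 'k mat \<Rightarrow> 'k::comm_ring_1 mvpoly \<Rightarrow> 'k mvpoly" where
  "linear_action n A = mv_subst (\<lambda>j. \<Sum>i<n. mv_const (A $$ (i, j)) * mv_var i)"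

definition GL :: "nat \<Rightarrow> 'k::field mat set" where
  "GL n = {A \<in> carrier_mat n n. invertible_mat A}"

definition is_flag :: "nat \<Rightarrow> nat list \<Rightarrow> (nat \<Rightarrow> 'k::field vec set) \<Rightarrow> bool" where
  "is_flag n \<alpha> V \<longleftrightarrow>
     V 0 = {0\<^sub>v n} \<and> V (length \<alpha>) = carrier_vec n \<and>
     (\<forall>i<length \<alpha>. V i \<subset> V (Suc i)) \<and>
     (\<forall>i\<le>length \<alpha>. VectorSpace.subspace class_ring (V i) (module_vec TYPE('k) n) \<and>
        vectorspace.dim class_ring ((module_vec TYPE('k) n)\<lparr>carrier := V i\<rparr>) = part_sum \<alpha> i)"

definition parabolic_subgroup ::
    "nat \<Rightarrow> nat list \<Rightarrow> (nat \<Rightarrow> 'k::field vec set) \<Rightarrow> 'k mat set" where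
  "parabolic_subgroup n \<alpha> V = {A \<in> GL n. \<forall>i\<le>length \<alpha>. (\<lambda>v. A *\<^sub>v v) ` V i = V i}"


section \<open>Modules, rank and Hilbert series\<close>

text \<open>The ring \<open>S\<close> as a module over the domain of the ring homomorphism \<open>f\<close>.\<close>

definition module_via :: "('r \<Rightarrow> 'm) \<Rightarrow> 'm ring \<Rightarrow> ('r, 'm) module" where
  "module_via f S = \<lparr> carrier = carrier S, mult = mult S, one = one S, zero = zero S, add = add S,
                      smult = (\<lambda>c x. f c \<otimes>\<^bsub>S\<^esub> x) \<rparr>"

definition free_module :: "('r, 'x) ring_scheme \<Rightarrow> ('r, 'm, 'y) module_scheme \<Rightarrow> bool" where
  "free_module R M \<longleftrightarrow> Module.module R M \<and>
     (\<exists>B\<subseteq>carrier M. \<not> LinearCombinations.module.lin_dep R M B \<and>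
        LinearCombinations.module.span R M B = carrier M)"

text \<open>For modules of infinite rank the supremum below carries no meaning. It is only applied to
  homogeneous components, which are finitely generated over the base ring. Over a field the rank is
  the dimension; over the integers torsion does not contribute to it.\<close>

definition module_rank :: "('r, 'x) ring_scheme \<Rightarrow> ('r, 'm, 'y) module_scheme \<Rightarrow> nat" where
  "module_rank R M = Sup {card B | B. finite B \<and> B \<subseteq> carrier M \<and>
                                      \<not> LinearCombinations.module.lin_dep R M B}"

text \<open>\<open>M\<close> is graded over the ring of all elements of type \<open>'r\<close>, with homogeneous components \<open>C d\<close>.\<close>

definition Hilb :: "('r::comm_ring_1, 'm) module \<Rightarrow> (nat \<Rightarrow> 'm set) \<Rightarrow> rat fps" where
  "Hilb M C = Abs_fps (\<lambda>d. of_nat (module_rank class_ring (M\<lparr>carrier := C d\<rparr>)))"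

definition homogeneous_part :: "'a::comm_ring_1 mvpoly ring \<Rightarrow> nat \<Rightarrow> 'a mvpoly set" where
  "homogeneous_part R d = {p \<in> carrier R. mv_homogeneous d p}"

definition Hilb_ring :: "'a::comm_ring_1 mvpoly ring \<Rightarrow> rat fps" where
  "Hilb_ring R = Hilb (module_via mv_const R) (homogeneous_part R)"

definition positive_part :: "'a::comm_ring_1 mvpoly ring \<Rightarrow> 'a mvpoly set" where
  "positive_part S = {p \<in> carrier S. Poly_Mapping.lookup p 0 = 0}"

text \<open>The Hilbert series of \<open>R/(S\<^sub>+)\<close>, where the ideal is taken in \<open>R\<close>. The degree \<open>d\<close> component of
  the quotient is the image of that of \<open>R\<close>.\<close>

definition Hilb_quotient :: "'a::comm_ring_1 mvpoly ring \<Rightarrow> 'a mvpoly ring \<Rightarrow> rat fps" where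
  "Hilb_quotient R S =
     (let I = genideal R (positive_part S); \<pi> = (\<lambda>p. I +>\<^bsub>R\<^esub> p)
      in Hilb (module_via (\<lambda>c. \<pi> (mv_const c)) (R Quot I)) (\<lambda>d. \<pi> ` homogeneous_part R d))"

abbreviation Z_inv :: "nat \<Rightarrow> (nat \<Rightarrow> nat) set \<Rightarrow> int mvpoly ring" where
  "Z_inv n H \<equiv> invariant_ring n (perm_action ` H)"

abbreviation F_inv :: "nat \<Rightarrow> 'k::field mat set \<Rightarrow> 'k mvpoly ring" where
  "F_inv n H \<equiv> invariant_ring n (linear_action n ` H)"

end

theory Submission
  imports Defs
begin

text \<open>
  Write \<open>k\<close> for the ring of constants (the integers or the finite field), \<open>R\<close> for the polynomial
  ring in \<open>n\<close> variables, and \<open>A \<subseteq> S\<close> for the invariants of the large group and of the subgroup. The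
  idea is to compare both rings with \<open>R\<close> itself.

  \<^emph>\<open>\<open>R\<close> is free over each ring of invariants, on monomials\<close> (\<open>monomial_basis_over_invariants\<close>). Choose linear
  forms \<open>y\<^sub>0, \<dots>, y\<^sub>n\<^sub>-\<^sub>1\<close> adapted to the group: the variables for a Young subgroup, a basis of the
  linear forms adapted to the flag for a parabolic subgroup. The form \<open>y\<^sub>j\<close> lies in a stable finite set
  \<open>\<Omega>\<^sub>j\<close>, the variables of its block or the forms in its step of the flag, and \<open>\<Omega>\<^sub>j\<close> contains the set
  \<open>\<Delta>\<^sub>j\<close> of those of its elements that already lie in the ring generated by the earlier \<open>y\<^sub>i\<close>, namely the earlier
  variables of the block or the span of the earlier forms. So \<open>y\<^sub>j\<close> is a root of a monic polynomial of degree
  \<open>d\<^sub>j = |\<Omega>\<^sub>j| - |\<Delta>\<^sub>j|\<close> over the invariants and the earlier \<open>y\<^sub>i\<close>, and the monomials \<open>y\<^sup>a\<close> with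
  \<open>a\<^sub>j < d\<^sub>j\<close> span. They are independent because applying the group to a relation \<open>\<Sum> f\<^sub>a y\<^sup>a = 0\<close> with
  invariant \<open>f\<^sub>a\<close> shows that a polynomial of degree less than \<open>d\<^sub>j\<close> in the \<open>j\<close>-th variable vanishes on a tree
  that branches at least \<open>d\<^sub>j\<close> times at level \<open>j\<close>. The generating function of these monomials is
  \<open>\<Prod> (1 - t^d\<^sub>j) / (1 - t)\<^sup>n\<close>, and \<open>d\<^sub>j\<close> is \<open>\<sigma>\<^sub>s - j\<close> or \<open>q^\<sigma>\<^sub>s - q^j\<close>, with \<open>s\<close> the block of \<open>j\<close>.

  \<^emph>\<open>Then \<open>S\<close> is free over \<open>A\<close>\<close> (locale \<open>free_tower\<close>). Let \<open>I\<close> and \<open>J\<close> be the ideals generated in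
  \<open>S\<close> and in \<open>R\<close> by the elements of \<open>A\<close> without constant term. Since \<open>R\<close> is free over \<open>A\<close>, the quotient
  \<open>R/J\<close> is a free \<open>k\<close>-module of finite rank. Since \<open>1\<close> belongs to a basis of \<open>R\<close> over \<open>S\<close>, the
  quotient \<open>S/I\<close> embeds into \<open>R/J\<close>, so it is free as well, \<open>k\<close> being a principal ideal domain. Lifts
  \<open>C\<close> of a homogeneous basis of \<open>S/I\<close> span \<open>S\<close> over \<open>A\<close> by the graded Nakayama argument. The
  products of \<open>C\<close> with the basis of \<open>R\<close> over \<open>S\<close> then span \<open>R\<close> over \<open>A\<close>, and they are as many as
  the basis of \<open>R\<close> over \<open>A\<close>, because both families reduce to \<open>k\<close>-bases of \<open>R/J\<close>. Over a domain this
  forces independence.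

  \<^emph>\<open>The Hilbert series follow\<close> (\<open>multinomial_quotient\<close>): for a free extension they multiply with the
  generating function of a homogeneous basis, so the generating function of \<open>C\<close>, which is the Hilbert series of
  \<open>S/I\<close>, is at once the quotient of the Hilbert series of \<open>S\<close> and \<open>A\<close> and the quotient of the two products
  \<open>\<Prod> (1 - t^d\<^sub>j)\<close>, which is the multinomial.
\<close>

section \<open>Bases over a subring of a domain\<close>

definition is_subring :: "'r::comm_ring_1 set \<Rightarrow> bool" where
  "is_subring A \<longleftrightarrow> 0 \<in> A \<and> 1 \<in> A \<and> (\<forall>x\<in>A. \<forall>y\<in>A. x + y \<in> A \<and> x * y \<in> A) \<and> (\<forall>x\<in>A. - x \<in> A)"

definition is_submodule :: "'r::comm_ring_1 set \<Rightarrow> 'r set \<Rightarrow> bool" where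
  "is_submodule A M \<longleftrightarrow> 0 \<in> M \<and> (\<forall>x\<in>M. \<forall>y\<in>M. x + y \<in> M) \<and> (\<forall>a\<in>A. \<forall>x\<in>M. a * x \<in> M)"

text \<open>All modules below are subsets of one domain, and scalars act by its multiplication. Independence,
span and bases are taken for indexed families, with coefficients in a subset \<open>A\<close> and modulo a
subset \<open>K\<close>, so that submodules (\<open>K = {0}\<close>) and quotients by an ideal are treated alike.\<close>

definition indep_mod :: "'r::comm_ring_1 set \<Rightarrow> 'r set \<Rightarrow> 'i set \<Rightarrow> ('i \<Rightarrow> 'r) \<Rightarrow> bool" where
  "indep_mod A K I e \<longleftrightarrow> (\<forall>f\<in>I \<rightarrow> A. (\<Sum>i\<in>I. f i * e i) \<in> K \<longrightarrow> (\<forall>i\<in>I. f i = 0))"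

definition span_mod :: "'r::comm_ring_1 set \<Rightarrow> 'r set \<Rightarrow> 'i set \<Rightarrow> ('i \<Rightarrow> 'r) \<Rightarrow> 'r set" where
  "span_mod A K I e = {m. \<exists>f\<in>I \<rightarrow> A. m - (\<Sum>i\<in>I. f i * e i) \<in> K}"

definition basis_mod :: "'r::comm_ring_1 set \<Rightarrow> 'r set \<Rightarrow> 'i set \<Rightarrow> ('i \<Rightarrow> 'r) \<Rightarrow> 'r set \<Rightarrow> bool" where
  "basis_mod A K I e M \<longleftrightarrow> finite I \<and> e \<in> I \<rightarrow> M \<and> indep_mod A K I e \<and> M \<subseteq> span_mod A K I e"

lemma subringD:
  assumes "is_subring A"
  shows "0 \<in> A" "1 \<in> A" "x \<in> A \<Longrightarrow> y \<in> A \<Longrightarrow> x + y \<in> A" "x \<in> A \<Longrightarrow> y \<in> A \<Longrightarrow> x * y \<in> A"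
    "x \<in> A \<Longrightarrow> - x \<in> A" "x \<in> A \<Longrightarrow> y \<in> A \<Longrightarrow> x - y \<in> A"
  using assms unfolding is_subring_def by (auto simp: diff_conv_add_uminus simp del: add_uminus_conv_diff)

lemma subring_sum: "is_subring A \<Longrightarrow> (\<And>i. i \<in> I \<Longrightarrow> f i \<in> A) \<Longrightarrow> sum f I \<in> A"
  by (induction I rule: infinite_finite_induct) (auto simp: subringD)

lemma subring_prod: "is_subring A \<Longrightarrow> (\<And>i. i \<in> I \<Longrightarrow> f i \<in> A) \<Longrightarrow> prod f I \<in> A"
  by (induction I rule: infinite_finite_induct) (auto simp: subringD)

lemma subring_power: "is_subring A \<Longrightarrow> x \<in> A \<Longrightarrow> x ^ k \<in> A"
  by (induction k) (auto simp: subringD)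

lemma submoduleD:
  assumes "is_submodule A M"
  shows "0 \<in> M" "x \<in> M \<Longrightarrow> y \<in> M \<Longrightarrow> x + y \<in> M" "a \<in> A \<Longrightarrow> x \<in> M \<Longrightarrow> a * x \<in> M"
  using assms unfolding is_submodule_def by auto

lemma submodule_diff:
  assumes "is_subring A" "is_submodule A M" "x \<in> M" "y \<in> M" shows "x - y \<in> M"
proof -
  have "x + (-1) * y \<in> M" using assms by (intro submoduleD[OF assms(2)]) (auto simp: subringD)
  then show ?thesis by simp
qed

lemma submodule_sum: "is_submodule A M \<Longrightarrow> (\<And>i. i \<in> I \<Longrightarrow> f i \<in> M) \<Longrightarrow> sum f I \<in> M"
  by (induction I rule: infinite_finite_induct) (auto simp: submoduleD)

lemma submodule_zero: "is_submodule A {0}"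
  by (auto simp: is_submodule_def)

lemma subring_submodule: "is_subring S \<Longrightarrow> A \<subseteq> S \<Longrightarrow> is_submodule A S"
  by (auto simp: is_submodule_def subringD)

text \<open>One Gauss step clears a pivot column; cross-multiplication in place of division keeps the
solution in the subring.\<close>

lemma underdetermined_system_solvable:
  fixes a :: "'i \<Rightarrow> 'j \<Rightarrow> 'r::idom"
  assumes A: "is_subring A" and "finite I" "finite J" "card I < card J"
    and "\<And>i j. i \<in> I \<Longrightarrow> j \<in> J \<Longrightarrow> a i j \<in> A"
  shows "\<exists>c\<in>J \<rightarrow> A. (\<exists>j\<in>J. c j \<noteq> 0) \<and> (\<forall>i\<in>I. (\<Sum>j\<in>J. c j * a i j) = 0)"
  using assms(2-)
proof (induction I arbitrary: J a rule: finite_induct)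
  case empty
  then obtain j where "j \<in> J" by (metis card_gt_0_iff card.empty ex_in_conv)
  then show ?case using subringD[OF A] by (intro bexI[of _ "\<lambda>_. 1"]) auto
next
  case (insert r I)
  show ?case
  proof (cases "\<forall>j\<in>J. a r j = 0")
    case True
    obtain c where "c \<in> J \<rightarrow> A" "\<exists>j\<in>J. c j \<noteq> 0" "\<forall>i\<in>I. (\<Sum>j\<in>J. c j * a i j) = 0"
      using insert.IH[of J a] insert.prems insert.hyps by auto
    then show ?thesis using True by (intro bexI[of _ c]) auto
  next
    case False
    then obtain p where p: "p \<in> J" "a r p \<noteq> 0" by auto
    define J' where "J' = J - {p}"
    have J: "J = insert p J'" "p \<notin> J'" "finite J'" using p insert.prems by (auto simp: J'_def)
    \<comment> \<open>Row \<open>r\<close> of \<open>b\<close> and its column \<open>p\<close> vanish.\<close>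
    define b where "b i j = a r p * a i j - a i p * a r j" for i j
    have "card I < card J'" using insert.prems insert.hyps J by auto
    moreover have "b i j \<in> A" if "i \<in> I" "j \<in> J'" for i j
      unfolding b_def using that insert.prems J by (intro subringD[OF A]) auto
    ultimately obtain c where c: "c \<in> J' \<rightarrow> A" "\<exists>j\<in>J'. c j \<noteq> 0"
        "\<forall>i\<in>I. (\<Sum>j\<in>J'. c j * b i j) = 0"
      using insert.IH[of J' b] J by auto
    \<comment> \<open>The value at \<open>p\<close> is the one that solves equation \<open>r\<close>, after scaling by the pivot.\<close>
    define d where "d j = (if j = p then - (\<Sum>j\<in>J'. c j * a r j) else a r p * c j)" for j
    have sum_d: "(\<Sum>j\<in>J. d j * a i j) = (\<Sum>j\<in>J'. c j * b i j)" for i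
    proof -
      have "(\<Sum>j\<in>J. d j * a i j) = d p * a i p + (\<Sum>j\<in>J'. d j * a i j)"
        using J by simp
      also have "(\<Sum>j\<in>J'. d j * a i j) = (\<Sum>j\<in>J'. a r p * c j * a i j)"
        using J by (intro sum.cong) (auto simp: d_def)
      also have "d p * a i p = - (\<Sum>j\<in>J'. c j * a r j * a i p)"
        by (simp add: d_def sum_distrib_right)
      finally show ?thesis
        by (simp add: b_def sum_subtractf[symmetric] algebra_simps)
    qed
    have "(\<Sum>j\<in>J. d j * a i j) = 0" if "i \<in> insert r I" for i
    proof (cases "i = r")
      case True
      have "b r j = 0" for j by (simp add: b_def)
      then show ?thesis unfolding sum_d True by simp
    qed (use c(3) that sum_d in auto)
    moreover have "d \<in> J \<rightarrow> A"
      using J c(1) insert.prems(3) unfolding d_def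
      by (auto intro!: subringD[OF A] subring_sum[OF A])
    moreover have "\<exists>j\<in>J. d j \<noteq> 0"
      using c(2) J p unfolding d_def by force
    ultimately show ?thesis by blast
  qed
qed

text \<open>Expressing more independent elements through fewer spanning ones would give an underdetermined
system, whose nontrivial solution is a relation. This makes ranks well defined.\<close>

lemma indep_card_le_span_card:
  fixes e :: "'i \<Rightarrow> 'r::idom"
  assumes A: "is_subring A" and K: "is_submodule A K" and "finite I" "finite J"
    and v: "v \<in> J \<rightarrow> span_mod A K I e" and ind: "indep_mod A K J v"
  shows "card J \<le> card I"
proof (rule ccontr)
  assume "\<not> card J \<le> card I"
  then have less: "card I < card J" by simp
  have "\<forall>j\<in>J. \<exists>f\<in>I \<rightarrow> A. v j - (\<Sum>i\<in>I. f i * e i) \<in> K"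
    using v unfolding span_mod_def by blast
  then obtain f where f: "\<And>j. j \<in> J \<Longrightarrow> f j \<in> I \<rightarrow> A"
      "\<And>j. j \<in> J \<Longrightarrow> v j - (\<Sum>i\<in>I. f j i * e i) \<in> K" by metis
  obtain c where c: "c \<in> J \<rightarrow> A" "\<exists>j\<in>J. c j \<noteq> 0" "\<forall>i\<in>I. (\<Sum>j\<in>J. c j * f j i) = 0"
    using underdetermined_system_solvable[OF A assms(3,4) less, of "\<lambda>i j. f j i"] f(1) by blast
  have "(\<Sum>j\<in>J. c j * (\<Sum>i\<in>I. f j i * e i)) = (\<Sum>i\<in>I. (\<Sum>j\<in>J. c j * f j i) * e i)"
    by (simp add: sum_distrib_left sum_distrib_right mult.assoc) (rule sum.swap)
  also have "\<dots> = 0" using c(3) by simp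
  finally have "(\<Sum>j\<in>J. c j * v j) = (\<Sum>j\<in>J. c j * (v j - (\<Sum>i\<in>I. f j i * e i)))"
    by (simp add: right_diff_distrib sum_subtractf)
  also have "\<dots> \<in> K" using c(1) f(2) by (intro submodule_sum[OF K] submoduleD[OF K]) auto
  finally show False using ind c(1,2) unfolding indep_mod_def by blast
qed

lemma basis_card_unique:
  fixes e :: "'i \<Rightarrow> 'r::idom"
  assumes "is_subring A" "is_submodule A K" "basis_mod A K I e M" "basis_mod A K J v M"
  shows "card I = card J"
  using indep_card_le_span_card[of A K I J v e] indep_card_le_span_card[of A K J I e v] assms
  unfolding basis_mod_def by (meson Pi_mono order_antisym subset_iff Pi_iff)

text \<open>A relation \<open>\<Sum> f i * u i = 0\<close> with \<open>f p \<noteq> 0\<close> would put all \<open>f p * e j\<close> into the span of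
  the \<open>u i\<close> with \<open>i \<noteq> p\<close>, which is one element too small to contain that many independent elements.\<close>

lemma spanning_of_basis_size_indep:
  fixes e :: "'j \<Rightarrow> 'r::idom"
  assumes A: "is_subring A" and J: "finite J" "indep_mod A {0} J e"
    and I: "finite I" and e: "e \<in> J \<rightarrow> span_mod A {0} I u" and card: "card I \<le> card J"
  shows "indep_mod A {0} I u"
  unfolding indep_mod_def
proof (intro ballI impI)
  fix f p assume f: "f \<in> I \<rightarrow> A" "(\<Sum>i\<in>I. f i * u i) \<in> {0}" and p: "p \<in> I"
  show "f p = 0"
  proof (rule ccontr)
    assume fp: "f p \<noteq> 0"
    define I' where "I' = I - {p}"
    have I': "I = insert p I'" "p \<notin> I'" "finite I'" using p I by (auto simp: I'_def)
    have "f p * e j \<in> span_mod A {0} I' u" if j: "j \<in> J" for j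
    proof -
      obtain t where t: "t \<in> I \<rightarrow> A" "e j = (\<Sum>i\<in>I. t i * u i)"
        using e j unfolding span_mod_def by auto
      have 1: "e j = t p * u p + (\<Sum>i\<in>I'. t i * u i)"
        using t(2) I' by simp
      have 2: "f p * u p = - (\<Sum>i\<in>I'. f i * u i)"
        using f(2) I' by (simp add: add_eq_0_iff)
      have "f p * e j = t p * (f p * u p) + f p * (\<Sum>i\<in>I'. t i * u i)"
        unfolding 1 by (simp add: algebra_simps)
      also have "\<dots> = (\<Sum>i\<in>I'. (f p * t i - t p * f i) * u i)"
        unfolding 2 by (simp add: sum_distrib_left sum_subtractf algebra_simps)
      finally show ?thesis unfolding span_mod_def
        using t f I' by (intro CollectI bexI[of _ "\<lambda>i. f p * t i - t p * f i"])
          (auto intro!: subringD[OF A])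
    qed
    moreover have "indep_mod A {0} J (\<lambda>j. f p * e j)"
      unfolding indep_mod_def
    proof (intro ballI impI)
      fix g j assume g: "g \<in> J \<rightarrow> A" "(\<Sum>j\<in>J. g j * (f p * e j)) \<in> {0}" "j \<in> J"
      then have "f p * (\<Sum>j\<in>J. g j * e j) = 0" by (simp add: sum_distrib_left algebra_simps)
      then have "(\<Sum>j\<in>J. g j * e j) \<in> {0}" using fp by simp
      then show "g j = 0" using J(2) g unfolding indep_mod_def by blast
    qed
    ultimately have "card J \<le> card I'"
      using indep_card_le_span_card[OF A submodule_zero \<open>finite I'\<close> J(1), of "\<lambda>j. f p * e j" u] by auto
    then show False using card I' by auto
  qed
qed

text \<open>The ideals of \<open>k\<close> are its submodules inside \<open>k\<close>, so this says that \<open>k\<close>, as a ring of its own, is a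
principal ideal ring.\<close>

definition principal_subring :: "'r::comm_ring_1 set \<Rightarrow> bool" where
  "principal_subring k \<longleftrightarrow> is_subring k \<and>
     (\<forall>M\<subseteq>k. is_submodule k M \<longrightarrow> (\<exists>g\<in>M. M = {x * g |x. x \<in> k}))"

text \<open>Peeling off one coordinate splits off a preimage of a generator of the ideal of its values. This is
the usual argument that submodules of free modules of finite rank over a principal ideal domain are free;
the module is given through coordinates \<open>\<phi> i\<close> and is taken modulo their common kernel.\<close>

lemma principal_basis_of_coordinates:
  fixes \<phi> :: "'i \<Rightarrow> 'r::idom \<Rightarrow> 'r"
  assumes k: "principal_subring k" and "finite I" and "is_submodule k M"
    and "\<And>i m. i \<in> I \<Longrightarrow> m \<in> M \<Longrightarrow> \<phi> i m \<in> k"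
    and "\<And>i m m'. i \<in> I \<Longrightarrow> m \<in> M \<Longrightarrow> m' \<in> M \<Longrightarrow> \<phi> i (m + m') = \<phi> i m + \<phi> i m'"
    and "\<And>i c m. i \<in> I \<Longrightarrow> c \<in> k \<Longrightarrow> m \<in> M \<Longrightarrow> \<phi> i (c * m) = c * \<phi> i m"
  shows "\<exists>B\<subseteq>M. basis_mod k {m \<in> M. \<forall>i\<in>I. \<phi> i m = 0} B (\<lambda>b. b) M"
  using assms(2-)
proof (induction I arbitrary: M rule: finite_induct)
  case empty
  then have "basis_mod k {m \<in> M. \<forall>i\<in>{}. \<phi> i m = 0} {} (\<lambda>b. b) M"
    by (auto simp: basis_mod_def indep_mod_def span_mod_def)
  then show ?case by (intro exI[of _ "{}"]) simp
next
  case (insert r I)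
  have sk: "is_subring k" using k by (simp add: principal_subring_def)
  note kD = subringD[OF sk]
  note MD = submoduleD[OF insert.prems(1)]
  let ?K = "{m \<in> M. \<forall>i\<in>insert r I. \<phi> i m = 0}"
  have diff: "\<phi> i (m - m') = \<phi> i m - \<phi> i m'" if "i \<in> insert r I" "m \<in> M" "m' \<in> M" for i m m'
    using insert.prems(3)[of i "m - m'" m'] that submodule_diff[OF sk insert.prems(1)]
    by (simp add: algebra_simps)
  have \<phi>0: "\<phi> i 0 = 0" if "i \<in> insert r I" for i
    using insert.prems(4)[of i 0 0] that kD MD by auto
  define N where "N = {m \<in> M. \<phi> r m = 0}"
  have N: "is_submodule k N"
    unfolding N_def is_submodule_def using MD insert.prems \<phi>0 by auto
  obtain B where B: "B \<subseteq> N" "basis_mod k {m \<in> N. \<forall>i\<in>I. \<phi> i m = 0} B (\<lambda>b. b) N"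
    using insert.IH[OF N] insert.prems by (auto simp: N_def)
  have K_eq: "{m \<in> N. \<forall>i\<in>I. \<phi> i m = 0} = ?K" by (auto simp: N_def)
  note B = B[unfolded K_eq]
  have Bk: "finite B" "indep_mod k ?K B (\<lambda>b. b)" "N \<subseteq> span_mod k ?K B (\<lambda>b. b)"
    using B(2) by (auto simp: basis_mod_def)
  have vals: "\<phi> r ` M \<subseteq> k" using insert.prems(2) by auto
  have "is_submodule k (\<phi> r ` M)"
    unfolding is_submodule_def
  proof (intro conjI ballI)
    show "0 \<in> \<phi> r ` M" using \<phi>0[of r] MD(1) by (intro image_eqI[of _ _ 0]) auto
  next
    fix x y assume "x \<in> \<phi> r ` M" "y \<in> \<phi> r ` M"
    then obtain m m' where m: "m \<in> M" "m' \<in> M" "x = \<phi> r m" "y = \<phi> r m'" by auto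
    then have "x + y = \<phi> r (m + m')" using insert.prems(3) by simp
    then show "x + y \<in> \<phi> r ` M" using MD(2) m by simp
  next
    fix a x assume a: "a \<in> k" and "x \<in> \<phi> r ` M"
    then obtain m where m: "m \<in> M" "x = \<phi> r m" by auto
    then have "a * x = \<phi> r (a * m)" using insert.prems(4) a by simp
    then show "a * x \<in> \<phi> r ` M" using MD(3) a m by simp
  qed
  then obtain g where g: "g \<in> \<phi> r ` M" "\<phi> r ` M = {x * g |x. x \<in> k}"
    using k vals unfolding principal_subring_def by meson
  show ?case
  proof (cases "g = 0")
    case True
    then have "N = M" using g(2) by (auto simp: N_def image_def)
    then show ?thesis using B by auto
  next
    case g0: False
    obtain b where b: "b \<in> M" "\<phi> r b = g" using g(1) by blast
    have bB: "b \<notin> B" using B(1) b g0 by (auto simp: N_def)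
    have sumB: "(\<Sum>c\<in>B. f c * c) \<in> N" if "f \<in> B \<rightarrow> k" for f
      using that B(1) by (intro submodule_sum[OF N] submoduleD[OF N]) auto
    have "indep_mod k ?K (insert b B) (\<lambda>b. b)"
      unfolding indep_mod_def
    proof (intro ballI impI)
      fix f c assume f: "f \<in> insert b B \<rightarrow> k" "(\<Sum>i\<in>insert b B. f i * i) \<in> ?K" "c \<in> insert b B"
      have s: "(\<Sum>i\<in>insert b B. f i * i) = f b * b + (\<Sum>i\<in>B. f i * i)"
        using bB Bk(1) by simp
      have fb: "f b \<in> k" and fB: "f \<in> B \<rightarrow> k" using f(1) by auto
      have "0 = \<phi> r (f b * b + (\<Sum>i\<in>B. f i * i))" using f(2) unfolding s by simp
      also have "\<dots> = f b * g"
        using insert.prems(3)[of r "f b * b" "\<Sum>i\<in>B. f i * i"] sumB[OF fB] b fb MD(3)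
          insert.prems(4)[of r "f b" b] by (auto simp: N_def)
      finally have "f b = 0" using g0 by simp
      then have "(\<Sum>i\<in>B. f i * i) \<in> ?K" using f(2) s by simp
      then have "\<forall>i\<in>B. f i = 0" using Bk(2) fB unfolding indep_mod_def by blast
      then show "f c = 0" using f(3) \<open>f b = 0\<close> by auto
    qed
    moreover have "M \<subseteq> span_mod k ?K (insert b B) (\<lambda>b. b)"
    proof
      fix m assume m: "m \<in> M"
      then obtain x where x: "x \<in> k" "\<phi> r m = x * g" using g(2) by auto
      have "m - x * b \<in> N"
        unfolding N_def using m b x MD(3)[of x b] diff[of r m "x * b"] insert.prems(4)[of r x b]
          submodule_diff[OF sk insert.prems(1)] by auto
      then obtain f where f: "f \<in> B \<rightarrow> k" "m - x * b - (\<Sum>i\<in>B. f i * i) \<in> ?K"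
        using Bk(3) unfolding span_mod_def by blast
      define h where "h = f(b := x)"
      have "(\<Sum>i\<in>insert b B. h i * i) = h b * b + (\<Sum>i\<in>B. h i * i)"
        using bB Bk(1) by simp
      also have "(\<Sum>i\<in>B. h i * i) = (\<Sum>i\<in>B. f i * i)"
        using bB by (intro sum.cong) (auto simp: h_def)
      finally have "m - (\<Sum>i\<in>insert b B. h i * i) = m - x * b - (\<Sum>i\<in>B. f i * i)"
        by (simp add: h_def)
      moreover have "h \<in> insert b B \<rightarrow> k" using f(1) x by (auto simp: h_def)
      ultimately show "m \<in> span_mod k ?K (insert b B) (\<lambda>b. b)"
        using f(2) unfolding span_mod_def by (metis (mono_tags, lifting) mem_Collect_eq)
    qed
    ultimately have "basis_mod k ?K (insert b B) (\<lambda>b. b) M"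
      using Bk(1) B(1) b by (auto simp: basis_mod_def N_def)
    moreover have "insert b B \<subseteq> M" using B(1) b by (auto simp: N_def)
    ultimately show ?thesis by blast
  qed
qed

section \<open>Polynomials: substitution and homogeneous components\<close>

lemma mv_const_0 [simp]: "mv_const 0 = 0" by (simp add: mv_const_def)
lemma mv_const_1 [simp]: "mv_const 1 = 1" by (simp add: mv_const_def)
lemma mv_const_add: "mv_const (a + b) = mv_const a + mv_const b"
  by (simp add: mv_const_def single_add)
lemma mv_const_mult: "mv_const (a * b) = mv_const a * mv_const b"
  by (simp add: mv_const_def mult_single)
lemma mv_const_uminus: "mv_const (- a) = - mv_const a"
  by (simp add: mv_const_def single_uminus)
lemma mv_const_sum: "mv_const (sum f I) = (\<Sum>i\<in>I. mv_const (f i))"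
  by (induction I rule: infinite_finite_induct) (auto simp: mv_const_add)
lemma mv_const_eq_iff [simp]: "mv_const a = mv_const b \<longleftrightarrow> a = b"
  by (metis mv_const_def lookup_single_eq)
lemma mv_const_eq_0_iff [simp]: "mv_const a = 0 \<longleftrightarrow> a = 0"
  by (metis mv_const_0 mv_const_eq_iff)

lemma consts_subring: "is_subring (range mv_const)"
  unfolding is_subring_def
  by (auto simp: mv_const_add[symmetric] mv_const_mult[symmetric] mv_const_uminus[symmetric]
      intro: image_eqI[of _ _ 0] image_eqI[of _ _ 1])

lemma sum_singles_eq:
  assumes "finite T" "Poly_Mapping.keys p \<subseteq> T"
  shows "(\<Sum>m\<in>T. Poly_Mapping.single m (Poly_Mapping.lookup p m)) = p"
proof (rule poly_mapping_eqI)
  fix x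
  have "Poly_Mapping.lookup (\<Sum>m\<in>T. Poly_Mapping.single m (Poly_Mapping.lookup p m)) x
      = (\<Sum>m\<in>T. if m = x then Poly_Mapping.lookup p x else 0)"
    unfolding lookup_sum by (intro sum.cong) (auto simp: lookup_single when_def)
  also have "\<dots> = Poly_Mapping.lookup p x"
    using assms by (auto simp: sum.delta in_keys_iff)
  finally show "Poly_Mapping.lookup (\<Sum>m\<in>T. Poly_Mapping.single m (Poly_Mapping.lookup p m)) x
    = Poly_Mapping.lookup p x" .
qed

lemma lookup_mv_const_mult:
  "Poly_Mapping.lookup (mv_const c * p) m = c * Poly_Mapping.lookup p m"
proof -
  let ?K = "Poly_Mapping.keys p"
  have "mv_const c * p = mv_const c * (\<Sum>m\<in>?K. Poly_Mapping.single m (Poly_Mapping.lookup p m))"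
    by (simp add: sum_singles_eq)
  also have "\<dots> = (\<Sum>m\<in>?K. Poly_Mapping.single m (c * Poly_Mapping.lookup p m))"
    by (simp add: sum_distrib_left mv_const_def mult_single)
  finally have "Poly_Mapping.lookup (mv_const c * p) m
      = (\<Sum>m'\<in>?K. if m' = m then c * Poly_Mapping.lookup p m else 0)"
    by (auto simp: lookup_sum lookup_single when_def intro: sum.cong)
  then show ?thesis by (auto simp: sum.delta in_keys_iff)
qed

definition monom_value :: "(nat \<Rightarrow> 'b::comm_monoid_mult) \<Rightarrow> (nat \<Rightarrow>\<^sub>0 nat) \<Rightarrow> 'b" where
  "monom_value f m = (\<Prod>i\<in>Poly_Mapping.keys m. f i ^ Poly_Mapping.lookup m i)"

lemma monom_value_superset:
  assumes "finite T" "Poly_Mapping.keys m \<subseteq> T"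
  shows "monom_value f m = (\<Prod>i\<in>T. f i ^ Poly_Mapping.lookup m i)"
  unfolding monom_value_def using assms
  by (intro prod.mono_neutral_left) (auto simp: in_keys_iff)

lemma monom_value_0 [simp]: "monom_value f 0 = 1"
  by (simp add: monom_value_def)

lemma monom_value_single [simp]: "monom_value f (Poly_Mapping.single i k) = f i ^ k"
  by (subst monom_value_superset[of "{i}"]) auto

lemma monom_value_add: "monom_value f (m + m') = monom_value f m * monom_value f m'"
proof -
  let ?T = "Poly_Mapping.keys m \<union> Poly_Mapping.keys m'"
  show ?thesis
    by (subst (1 2 3) monom_value_superset[of ?T])
      (auto simp: lookup_add power_add prod.distrib dest: keys_add[THEN subsetD])
qed

lemma mv_subst_eq_sum:
  assumes "finite T" "Poly_Mapping.keys p \<subseteq> T"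
  shows "mv_subst f p = (\<Sum>m\<in>T. mv_const (Poly_Mapping.lookup p m) * monom_value f m)"
  unfolding mv_subst_def monom_value_def using assms
  by (intro sum.mono_neutral_left) (auto simp: in_keys_iff)

lemma mv_subst_add: "mv_subst f (p + q) = mv_subst f p + mv_subst f q"
proof -
  let ?T = "Poly_Mapping.keys p \<union> Poly_Mapping.keys q"
  show ?thesis
    by (subst (1 2 3) mv_subst_eq_sum[of ?T])
      (auto simp: lookup_add mv_const_add ring_distribs sum.distrib dest: keys_add[THEN subsetD])
qed

lemma mv_subst_0 [simp]: "mv_subst f 0 = 0"
  by (simp add: mv_subst_def)

lemma mv_subst_sum: "mv_subst f (sum g I) = (\<Sum>i\<in>I. mv_subst f (g i))"
  by (induction I rule: infinite_finite_induct) (auto simp: mv_subst_add)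

lemma mv_subst_single: "mv_subst f (Poly_Mapping.single m c) = mv_const c * monom_value f m"
  by (subst mv_subst_eq_sum[of "{m}"]) auto

lemma mv_subst_const [simp]: "mv_subst f (mv_const c) = mv_const c"
  by (simp add: mv_const_def mv_subst_single[unfolded mv_const_def])

lemma mv_subst_var [simp]: "mv_subst f (mv_var i) = f i"
  by (simp add: mv_var_def mv_subst_single)

lemma mv_subst_mult: "mv_subst f (p * q) = mv_subst f p * mv_subst f q"
proof -
  let ?s = "\<lambda>p m. Poly_Mapping.single m (Poly_Mapping.lookup p m)"
  let ?K = Poly_Mapping.keys
  have "p * q = (\<Sum>m\<in>?K p. ?s p m) * (\<Sum>m\<in>?K q. ?s q m)"
    by (simp add: sum_singles_eq)
  also have "\<dots> = (\<Sum>m\<in>?K p. \<Sum>m'\<in>?K q. ?s p m * ?s q m')" by (rule sum_product)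
  finally have "mv_subst f (p * q) = (\<Sum>m\<in>?K p. \<Sum>m'\<in>?K q. mv_subst f (?s p m) * mv_subst f (?s q m'))"
    by (simp add: mv_subst_sum mv_subst_single mult_single monom_value_add mv_const_mult mult_ac)
  also have "\<dots> = (\<Sum>m\<in>?K p. mv_subst f (?s p m)) * (\<Sum>m'\<in>?K q. mv_subst f (?s q m'))"
    by (rule sum_product[symmetric])
  also have "\<dots> = mv_subst f p * mv_subst f q"
    unfolding mv_subst_sum[symmetric]
    by (simp add: sum_singles_eq)
  finally show ?thesis .
qed

lemma monom_value_var: "monom_value mv_var m = Poly_Mapping.single m (1::'a::comm_ring_1)"
proof -
  have power: "mv_var i ^ k = Poly_Mapping.single (Poly_Mapping.single i k) (1::'a)" for i k
    by (induction k) (auto simp: mv_var_def mult_single single_add[symmetric])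
  have "(\<Prod>i\<in>T. mv_var i ^ g i) = Poly_Mapping.single (\<Sum>i\<in>T. Poly_Mapping.single i (g i)) (1::'a)"
    if "finite T" for T g
    using that by (induction T rule: finite_induct) (auto simp: power mult_single)
  then show ?thesis
    unfolding monom_value_def by (simp add: sum_singles_eq)
qed

lemma mv_subst_mv_var: "mv_subst mv_var p = p"
  using sum_singles_eq[of "Poly_Mapping.keys p" p]
  by (simp add: mv_subst_eq_sum[of "Poly_Mapping.keys p"] monom_value_var mv_const_def mult_single)

subsection \<open>The grading\<close>

definition mdeg :: "(nat \<Rightarrow>\<^sub>0 nat) \<Rightarrow> nat" where
  "mdeg m = (\<Sum>i\<in>Poly_Mapping.keys m. Poly_Mapping.lookup m i)"

lemma mdeg_superset:
  assumes "finite T" "Poly_Mapping.keys m \<subseteq> T"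
  shows "mdeg m = (\<Sum>i\<in>T. Poly_Mapping.lookup m i)"
  unfolding mdeg_def using assms by (intro sum.mono_neutral_left) (auto simp: in_keys_iff)

lemma mdeg_add: "mdeg (m + m') = mdeg m + mdeg m'"
proof -
  let ?T = "Poly_Mapping.keys m \<union> Poly_Mapping.keys m'"
  show ?thesis
    by (subst (1 2 3) mdeg_superset[of ?T])
      (auto simp: lookup_add sum.distrib dest: keys_add[THEN subsetD])
qed

lemma mdeg_eq_0_iff: "mdeg m = 0 \<longleftrightarrow> m = 0"
  by (auto simp: mdeg_def in_keys_iff intro!: poly_mapping_eqI)

lemma mv_homogeneous_iff: "mv_homogeneous d p \<longleftrightarrow> (\<forall>m. Poly_Mapping.lookup p m \<noteq> 0 \<longrightarrow> mdeg m = d)"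
  by (auto simp: mv_homogeneous_def mdeg_def in_keys_iff)

lemma mv_homogeneous_0 [simp]: "mv_homogeneous d 0"
  by (simp add: mv_homogeneous_iff)

lemma mv_homogeneous_const [simp]: "mv_homogeneous 0 (mv_const c)"
  by (auto simp: mv_homogeneous_iff mv_const_def lookup_single when_def mdeg_def split: if_splits)

lemma mv_homogeneous_1 [simp]: "mv_homogeneous 0 1"
  using mv_homogeneous_const[of 1] by simp

lemma mv_homogeneous_var [simp]: "mv_homogeneous (Suc 0) (mv_var i)"
  by (auto simp: mv_homogeneous_iff mv_var_def lookup_single when_def mdeg_def split: if_splits)

lemma mv_homogeneous_add:
  "mv_homogeneous d p \<Longrightarrow> mv_homogeneous d q \<Longrightarrow> mv_homogeneous d (p + q)"
  unfolding mv_homogeneous_iff lookup_add by (metis add_0)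

lemma mv_homogeneous_sum:
  "(\<And>i. i \<in> I \<Longrightarrow> mv_homogeneous d (f i)) \<Longrightarrow> mv_homogeneous d (sum f I)"
  by (induction I rule: infinite_finite_induct) (auto intro: mv_homogeneous_add)

lemma mv_homogeneous_mult:
  assumes "mv_homogeneous d p" "mv_homogeneous e q"
  shows "mv_homogeneous (d + e) (p * q)"
proof -
  have "mdeg m = d + e" if "m \<in> Poly_Mapping.keys (p * q)" for m
    using keys_mult[of p q] that assms unfolding mv_homogeneous_iff
    by (force simp: mdeg_add in_keys_iff)
  then show ?thesis unfolding mv_homogeneous_iff by (auto simp: in_keys_iff)
qed

lemma mv_homogeneous_const_mult: "mv_homogeneous d p \<Longrightarrow> mv_homogeneous d (mv_const c * p)"
  using mv_homogeneous_mult[OF mv_homogeneous_const] by fastforce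

lemma mv_homogeneous_power: "mv_homogeneous d p \<Longrightarrow> mv_homogeneous (k * d) (p ^ k)"
  by (induction k) (auto intro: mv_homogeneous_mult)

lemma mv_homogeneous_prod:
  "(\<And>i. i \<in> I \<Longrightarrow> mv_homogeneous (d i) (f i)) \<Longrightarrow> mv_homogeneous (sum d I) (prod f I)"
  by (induction I rule: infinite_finite_induct) (auto intro: mv_homogeneous_mult)

definition hcomp :: "nat \<Rightarrow> 'a::comm_ring_1 mvpoly \<Rightarrow> 'a mvpoly" where
  "hcomp d p = (\<Sum>m | m \<in> Poly_Mapping.keys p \<and> mdeg m = d.
     Poly_Mapping.single m (Poly_Mapping.lookup p m))"

lemma lookup_hcomp:
  "Poly_Mapping.lookup (hcomp d p) m = (if mdeg m = d then Poly_Mapping.lookup p m else 0)"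
proof -
  have "Poly_Mapping.lookup (hcomp d p) m = (\<Sum>m' | m' \<in> Poly_Mapping.keys p \<and> mdeg m' = d.
      if m' = m then Poly_Mapping.lookup p m else 0)"
    unfolding hcomp_def lookup_sum by (intro sum.cong) (auto simp: lookup_single when_def)
  then show ?thesis by (auto simp: sum.delta in_keys_iff)
qed

lemma keys_hcomp: "Poly_Mapping.keys (hcomp d p) \<subseteq> Poly_Mapping.keys p"
  by (auto simp: in_keys_iff lookup_hcomp split: if_splits)

lemma hcomp_homogeneous [simp]: "mv_homogeneous d (hcomp d p)"
  by (simp add: mv_homogeneous_iff lookup_hcomp)

lemma hcomp_of_homogeneous: "mv_homogeneous d p \<Longrightarrow> hcomp e p = (if e = d then p else 0)"
  by (auto simp: mv_homogeneous_iff lookup_hcomp intro!: poly_mapping_eqI)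

lemma hcomp_0 [simp]: "hcomp d 0 = 0"
  by (rule poly_mapping_eqI) (simp add: lookup_hcomp)

lemma hcomp_add: "hcomp d (p + q) = hcomp d p + hcomp d q"
  by (rule poly_mapping_eqI) (simp add: lookup_hcomp lookup_add)

lemma hcomp_diff: "hcomp d (p - q) = hcomp d p - hcomp d q"
  by (rule poly_mapping_eqI) (simp add: lookup_hcomp lookup_minus)

lemma hcomp_sum: "hcomp d (sum f I) = (\<Sum>i\<in>I. hcomp d (f i))"
  by (induction I rule: infinite_finite_induct) (auto simp: hcomp_add)

lemma sum_hcomp_eq: "\<exists>D. (\<Sum>d\<le>D. hcomp d p) = p"
proof -
  define D where "D = Max (insert 0 (mdeg ` Poly_Mapping.keys p))"
  have D: "mdeg m \<le> D" if "Poly_Mapping.lookup p m \<noteq> 0" for m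
    unfolding D_def using that by (intro Max_ge) (auto simp: in_keys_iff)
  have "(\<Sum>d\<le>D. hcomp d p) = p"
  proof (rule poly_mapping_eqI)
    fix m
    have "Poly_Mapping.lookup (\<Sum>d\<le>D. hcomp d p) m
        = (\<Sum>d\<le>D. if d = mdeg m then Poly_Mapping.lookup p m else 0)"
      unfolding lookup_sum by (intro sum.cong) (auto simp: lookup_hcomp)
    then show "Poly_Mapping.lookup (\<Sum>d\<le>D. hcomp d p) m = Poly_Mapping.lookup p m"
      using D[of m] by auto
  qed
  then show ?thesis by blast
qed

lemma hcomp_mult_homogeneous:
  assumes q: "mv_homogeneous e q"
  shows "hcomp d (p * q) = (if e \<le> d then hcomp (d - e) p * q else 0)"
proof -
  obtain D where D: "(\<Sum>i\<le>D. hcomp i p) = p" using sum_hcomp_eq by blast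
  have "hcomp d (p * q) = (\<Sum>i\<le>D. hcomp d (hcomp i p * q))"
    by (subst D[symmetric]) (simp add: sum_distrib_right hcomp_sum)
  also have "\<dots> = (\<Sum>i\<le>D. if d = i + e then hcomp i p * q else 0)"
    by (intro sum.cong refl hcomp_of_homogeneous mv_homogeneous_mult q hcomp_homogeneous)
  also have "\<dots> = (\<Sum>i\<le>D. (if d = i + e then hcomp i p else 0)) * q"
    by (simp add: sum_distrib_right if_distrib[of "\<lambda>x. x * q"] cong: if_cong)
  also have "(\<Sum>i\<le>D. (if d = i + e then hcomp i p else 0)) =
      (\<Sum>i\<le>D. if e \<le> d then hcomp (d - e) (hcomp i p) else 0)"
    by (intro sum.cong) (auto simp: hcomp_of_homogeneous[OF hcomp_homogeneous])
  also have "\<dots> = (if e \<le> d then hcomp (d - e) (\<Sum>i\<le>D. hcomp i p) else 0)"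
    by (simp add: hcomp_sum)
  also have "\<dots> = (if e \<le> d then hcomp (d - e) p else 0)" using D by simp
  finally show ?thesis by auto
qed

text \<open>The constant term is multiplicative: only constant terms of the factors contribute to it. Hence
\<open>hcomp 0\<close> is a ring homomorphism onto the constants.\<close>

lemma hcomp_zero_mult: "hcomp 0 (p * q) = hcomp 0 p * hcomp 0 q"
proof -
  obtain D where D: "(\<Sum>i\<le>D. hcomp i q) = q" using sum_hcomp_eq by blast
  have "hcomp 0 (p * q) = (\<Sum>i\<le>D. hcomp 0 (p * hcomp i q))"
    by (subst D[symmetric]) (simp add: sum_distrib_left hcomp_sum)
  also have "\<dots> = (\<Sum>i\<le>D. if i = 0 then hcomp 0 p * hcomp 0 q else 0)"
    by (intro sum.cong) (auto simp: hcomp_mult_homogeneous[OF hcomp_homogeneous])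
  finally show ?thesis by simp
qed

lemma hcomp_zero: "hcomp 0 p = mv_const (Poly_Mapping.lookup p 0)"
  by (rule poly_mapping_eqI)
    (auto simp: lookup_hcomp mv_const_def lookup_single mdeg_eq_0_iff when_def)

lemma hcomp_const_mult: "hcomp d (mv_const c * p) = mv_const c * hcomp d p"
  using hcomp_mult_homogeneous[OF mv_homogeneous_const, of d p c] by (simp add: mult.commute)

definition graded_hom :: "('a::comm_ring_1 mvpoly \<Rightarrow> 'a mvpoly) \<Rightarrow> bool" where
  "graded_hom \<phi> \<longleftrightarrow> (\<forall>p q. \<phi> (p + q) = \<phi> p + \<phi> q \<and> \<phi> (p * q) = \<phi> p * \<phi> q) \<and>
     (\<forall>c. \<phi> (mv_const c) = mv_const c) \<and> (\<forall>d p. mv_homogeneous d p \<longrightarrow> mv_homogeneous d (\<phi> p))"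

lemma graded_homD:
  assumes "graded_hom \<phi>"
  shows "\<phi> (p + q) = \<phi> p + \<phi> q" "\<phi> (p * q) = \<phi> p * \<phi> q" "\<phi> (mv_const c) = mv_const c"
    "mv_homogeneous d p \<Longrightarrow> mv_homogeneous d (\<phi> p)" "\<phi> 0 = 0" "\<phi> 1 = 1" "\<phi> (- p) = - \<phi> p"
    "\<phi> (sum f I) = (\<Sum>i\<in>I. \<phi> (f i))" "\<phi> (prod f I) = (\<Prod>i\<in>I. \<phi> (f i))" "\<phi> (p ^ k) = \<phi> p ^ k"
proof -
  show *: "\<phi> (p + q) = \<phi> p + \<phi> q" "\<phi> (p * q) = \<phi> p * \<phi> q" "\<phi> (mv_const c) = mv_const c"
    "mv_homogeneous d p \<Longrightarrow> mv_homogeneous d (\<phi> p)" for p q c d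
    using assms unfolding graded_hom_def by blast+
  show 0: "\<phi> 0 = 0" "\<phi> 1 = 1" using *(3)[of 0] *(3)[of 1] by auto
  show "\<phi> (- p) = - \<phi> p" using *(2)[of "mv_const (-1)" p] *(3)[of "- 1"]
    by (simp add: mv_const_uminus)
  show "\<phi> (sum f I) = (\<Sum>i\<in>I. \<phi> (f i))"
    by (induction I rule: infinite_finite_induct) (auto simp: * 0)
  show "\<phi> (prod f I) = (\<Prod>i\<in>I. \<phi> (f i))"
    by (induction I rule: infinite_finite_induct) (auto simp: * 0)
  show "\<phi> (p ^ k) = \<phi> p ^ k" by (induction k) (auto simp: * 0)
qed

lemma mv_subst_graded_hom:
  assumes "\<And>i. mv_homogeneous 1 (f i)"
  shows "graded_hom (mv_subst f)"
proof -
  have mono: "mv_homogeneous (mdeg m) (monom_value f m)" for m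
    unfolding mdeg_def monom_value_def
    by (intro mv_homogeneous_prod) (use mv_homogeneous_power[OF assms] in auto)
  have "mv_homogeneous d (mv_subst f p)" if "mv_homogeneous d p" for d p
    using that mono unfolding mv_subst_def monom_value_def[symmetric]
    by (intro mv_homogeneous_sum mv_homogeneous_const_mult)
      (auto simp: mv_homogeneous_iff[of d p] in_keys_iff)
  then show ?thesis by (auto simp: graded_hom_def mv_subst_add mv_subst_mult)
qed

text \<open>The images of the homogeneous components of \<open>p\<close> are homogeneous of the same degrees and add up to
the image of \<open>p\<close>. In particular invariance passes to homogeneous components.\<close>

lemma graded_hom_hcomp:
  assumes "graded_hom \<phi>" shows "\<phi> (hcomp d p) = hcomp d (\<phi> p)"
proof -
  obtain D where D: "(\<Sum>i\<le>D. hcomp i p) = p" using sum_hcomp_eq by blast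
  have h: "hcomp d (\<phi> (hcomp i p)) = (if d = i then \<phi> (hcomp i p) else 0)" for i d
    by (rule hcomp_of_homogeneous) (intro graded_homD[OF assms] hcomp_homogeneous)
  have "hcomp d (\<phi> p) = (\<Sum>i\<le>D. hcomp d (\<phi> (hcomp i p)))"
    by (subst D[symmetric]) (simp add: graded_homD[OF assms] hcomp_sum)
  also have "\<dots> = (\<Sum>i\<le>D. if d = i then \<phi> (hcomp i p) else 0)" by (simp only: h)
  also have "\<dots> = (\<Sum>i\<le>D. \<phi> (hcomp d (hcomp i p)))"
    by (intro sum.cong) (auto simp: hcomp_of_homogeneous[OF hcomp_homogeneous] graded_homD[OF assms])
  also have "\<dots> = \<phi> (hcomp d (\<Sum>i\<le>D. hcomp i p))"
    by (simp add: hcomp_sum graded_homD[OF assms])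
  finally show ?thesis using D by simp
qed

subsection \<open>Graded subrings\<close>

definition polys :: "nat \<Rightarrow> 'a::comm_ring_1 mvpoly set" where
  "polys n = carrier (mv_ring n)"

lemma polys_iff: "p \<in> polys n \<longleftrightarrow> (\<forall>m. Poly_Mapping.lookup p m \<noteq> 0 \<longrightarrow> Poly_Mapping.keys m \<subseteq> {..<n})"
  by (auto simp: polys_def mv_ring_def in_keys_iff)

definition graded_subring :: "'a::comm_ring_1 mvpoly set \<Rightarrow> bool" where
  "graded_subring A \<longleftrightarrow> is_subring A \<and> range mv_const \<subseteq> A \<and> (\<forall>p\<in>A. \<forall>d. hcomp d p \<in> A)"

lemma graded_subringD:
  assumes "graded_subring A"
  shows "is_subring A" "mv_const c \<in> A" "p \<in> A \<Longrightarrow> hcomp d p \<in> A"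
  using assms by (auto simp: graded_subring_def)

lemma polys_graded_subring: "graded_subring (polys n)"
proof -
  have iff: "p \<in> polys n \<longleftrightarrow> (\<forall>m\<in>Poly_Mapping.keys p. Poly_Mapping.keys m \<subseteq> {..<n})"
    for p :: "'a mvpoly"
    by (simp add: polys_def mv_ring_def)
  have mult: "p * q \<in> polys n" if p: "p \<in> polys n" and q: "q \<in> polys n" for p q :: "'a mvpoly"
    unfolding iff
  proof
    fix m assume "m \<in> Poly_Mapping.keys (p * q)"
    then obtain a b where "a \<in> Poly_Mapping.keys p" "b \<in> Poly_Mapping.keys q" "m = a + b"
      using keys_mult[of p q] by auto
    then show "Poly_Mapping.keys m \<subseteq> {..<n}" using p q keys_add[of a b] unfolding iff
      by (metis Un_least order_trans)
  qed
  have add: "p + q \<in> polys n" if "p \<in> polys n" "q \<in> polys n" for p q :: "'a mvpoly"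
    using that keys_add[of p q] unfolding iff by auto
  have const: "mv_const c \<in> polys n" for c :: 'a
    unfolding iff by (simp add: mv_const_def)
  have uminus: "- p \<in> polys n" if "p \<in> polys n" for p :: "'a mvpoly"
    using mult[OF const[of "-1"] that] by (simp add: mv_const_uminus)
  have hcomp: "hcomp d p \<in> polys n" if "p \<in> polys n" for p :: "'a mvpoly" and d
    using that keys_hcomp[of d p] unfolding iff by auto
  show ?thesis
    unfolding graded_subring_def is_subring_def
    using mult add uminus hcomp const const[of 0] const[of 1] by auto
qed

lemma mv_var_in_polys: "i < n \<Longrightarrow> mv_var i \<in> polys n"
  by (auto simp: polys_iff mv_var_def lookup_single when_def split: if_splits)

lemma polys_generated:
  assumes A: "is_subring A" and "range mv_const \<subseteq> A" "\<And>i. i < n \<Longrightarrow> mv_var i \<in> A"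
  shows "polys n \<subseteq> A"
proof
  fix p :: "'a mvpoly" assume p: "p \<in> polys n"
  have "i < n" if "m \<in> Poly_Mapping.keys p" "i \<in> Poly_Mapping.keys m" for m i
    using p that by (auto simp: polys_iff in_keys_iff[of m p])
  then have "mv_subst mv_var p \<in> A"
    unfolding mv_subst_def using assms(2,3)
    by (intro subring_sum[OF A] subringD(4)[OF A] subring_prod[OF A] subring_power[OF A]) blast+
  then show "p \<in> A" by (simp add: mv_subst_mv_var)
qed

definition invariants :: "nat \<Rightarrow> ('a::comm_ring_1 mvpoly \<Rightarrow> 'a mvpoly) set \<Rightarrow> 'a mvpoly set" where
  "invariants n \<Phi> = {p \<in> polys n. \<forall>\<phi>\<in>\<Phi>. \<phi> p = p}"

lemma invariants_graded_subring:
  assumes "\<And>\<phi>. \<phi> \<in> \<Phi> \<Longrightarrow> graded_hom \<phi>"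
  shows "graded_subring (invariants n \<Phi>)"
proof -
  note P = polys_graded_subring[of n, where ?'a = 'a] 
  note D = graded_subringD(2,3)[OF P] subringD[OF graded_subringD(1)[OF P]]
  have H: "\<phi> (p + q) = p + q" "\<phi> (p * q) = p * q" "\<phi> (- p) = - p"
    if "\<phi> \<in> \<Phi>" "\<phi> p = p" "\<phi> q = q" for \<phi> p q
    using that(2,3) graded_homD[OF assms[OF that(1)]] by simp_all
  have H': "\<phi> (mv_const c) = mv_const c" if "\<phi> \<in> \<Phi>" for \<phi> c
    using graded_homD[OF assms[OF that]] by simp
  have "is_subring (invariants n \<Phi>)"
    unfolding is_subring_def invariants_def using D H H'[of _ 0] H'[of _ 1] by auto
  moreover have "range mv_const \<subseteq> invariants n \<Phi>"
    unfolding invariants_def using D H' by auto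
  moreover have "hcomp d p \<in> invariants n \<Phi>" if "p \<in> invariants n \<Phi>" for d p
  proof -
    have "\<phi> (hcomp d p) = hcomp d p" if "\<phi> \<in> \<Phi>" for \<phi>
    proof -
      have "\<phi> p = p" using \<open>p \<in> invariants n \<Phi>\<close> that unfolding invariants_def by blast
      then show ?thesis using graded_hom_hcomp[OF assms[OF that], of d p] by simp
    qed
    then show ?thesis using that D(2)[of p d] unfolding invariants_def by auto
  qed
  ultimately show ?thesis unfolding graded_subring_def by blast
qed

subsection \<open>Homogeneous modules of finite rank\<close>

lemma principal_constsI:
  assumes "\<And>I::'a::comm_ring_1 set. 0 \<in> I \<Longrightarrow> (\<And>x y. x \<in> I \<Longrightarrow> y \<in> I \<Longrightarrow> x + y \<in> I) \<Longrightarrow>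
    (\<And>c x. x \<in> I \<Longrightarrow> c * x \<in> I) \<Longrightarrow> \<exists>g\<in>I. \<forall>x\<in>I. \<exists>c. x = c * g"
  shows "principal_subring (range (mv_const :: 'a \<Rightarrow> 'a mvpoly))"
  unfolding principal_subring_def
proof (intro conjI allI impI consts_subring)
  fix M :: "'a mvpoly set" assume M: "M \<subseteq> range mv_const" "is_submodule (range mv_const) M"
  define I where "I = {c::'a. mv_const c \<in> M}"
  have "\<exists>g\<in>I. \<forall>x\<in>I. \<exists>c. x = c * g"
    using submoduleD[OF M(2)]
    by (intro assms) (auto simp: I_def mv_const_add mv_const_mult)
  then obtain g where g: "mv_const g \<in> M" "\<And>x. mv_const x \<in> M \<Longrightarrow> \<exists>c. x = c * g"
    by (auto simp: I_def)
  have "M = {x * mv_const g |x. x \<in> range mv_const}"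
  proof (intro equalityI subsetI)
    fix x assume "x \<in> M"
    then obtain c where "x = mv_const (c * g)" using M(1) g(2) by blast
    then show "x \<in> {x * mv_const g |x. x \<in> range mv_const}" by (auto simp: mv_const_mult)
  qed (use submoduleD(3)[OF M(2) _ g(1)] in blast)
  then show "\<exists>g\<in>M. M = {x * g |x. x \<in> range mv_const}" using g(1) by blast
qed

lemma principal_consts_field: "principal_subring (range (mv_const :: 'a::field \<Rightarrow> 'a mvpoly))"
proof (rule principal_constsI)
  fix I :: "'a set"
  assume I: "0 \<in> I"
  show "\<exists>g\<in>I. \<forall>x\<in>I. \<exists>c. x = c * g"
  proof (cases "I = {0}")
    case False
    then obtain g where "g \<in> I" "g \<noteq> 0" using I by blast
    then show ?thesis by (intro bexI[of _ g] ballI exI[of _ "_ / g"]) auto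
  qed (auto intro: exI[of _ 0])
qed

text \<open>Division with remainder by the least positive element of an ideal leaves remainder zero.\<close>

lemma principal_consts_int: "principal_subring (range (mv_const :: int \<Rightarrow> int mvpoly))"
proof (rule principal_constsI)
  fix I :: "int set"
  assume I: "0 \<in> I" "\<And>x y. x \<in> I \<Longrightarrow> y \<in> I \<Longrightarrow> x + y \<in> I" "\<And>c x. x \<in> I \<Longrightarrow> c * x \<in> I"
  show "\<exists>g\<in>I. \<forall>x\<in>I. \<exists>c. x = c * g"
  proof (cases "I = {0}")
    case False
    then obtain y where y: "y \<in> I" "y \<noteq> 0" using I by blast
    have "\<bar>y\<bar> \<in> I"
      using I(3)[OF y(1), of 1] I(3)[OF y(1), of "-1"] by (cases "0 \<le> y") auto
    then have "\<exists>k::nat. 0 < k \<and> int k \<in> I"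
      using y(2) by (intro exI[of _ "nat \<bar>y\<bar>"]) auto
    then obtain k0 :: nat where k0: "0 < k0 \<and> int k0 \<in> I" by blast
    define k where "k = (LEAST k. 0 < k \<and> int k \<in> I)"
    have k: "0 < k" "int k \<in> I"
      using LeastI[of "\<lambda>k. 0 < k \<and> int k \<in> I", OF k0] by (auto simp: k_def)
    have k_le: "k \<le> j" if "0 < j" "int j \<in> I" for j
      unfolding k_def using that by (intro Least_le) simp
    have "\<exists>c. x = c * int k" if "x \<in> I" for x
    proof -
      have "x + (- (x div int k)) * int k \<in> I" using I that k by blast
      then have "x mod int k \<in> I" by (simp add: minus_div_mult_eq_mod)
      moreover have "0 \<le> x mod int k" "x mod int k < int k" using k by auto
      ultimately have "x mod int k = 0"
        using k_le[of "nat (x mod int k)"] by (cases "x mod int k = 0") auto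
      then have "x = (x div int k) * int k" using div_mult_mod_eq[of x "int k"] by simp
      then show ?thesis by blast
    qed
    then show ?thesis using k(2) by blast
  qed auto
qed

lemma finite_monomials: "finite {m. Poly_Mapping.keys m \<subseteq> {..<n} \<and> mdeg m = d}" (is "finite ?M")
proof (rule finite_imageD)
  let ?r = "\<lambda>m. restrict (Poly_Mapping.lookup m) {..<n}"
  have "Poly_Mapping.lookup m i \<le> mdeg m" for m i
    by (cases "i \<in> Poly_Mapping.keys m") (auto simp: mdeg_def in_keys_iff intro: member_le_sum)
  then have "?r ` ?M \<subseteq> {..<n} \<rightarrow>\<^sub>E {..d}" by (auto simp: PiE_def Pi_def extensional_def)
  then show "finite (?r ` ?M)" by (rule finite_subset) (auto intro: finite_PiE)
  show "inj_on ?r ?M"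
  proof (rule inj_onI, rule poly_mapping_eqI)
    fix m m' i assume m: "m \<in> ?M" "m' \<in> ?M" "?r m = ?r m'"
    show "Poly_Mapping.lookup m i = Poly_Mapping.lookup m' i"
    proof (cases "i < n")
      case True
      then show ?thesis using fun_cong[OF m(3), of i] by simp
    next
      case False
      then have "i \<notin> Poly_Mapping.keys m" "i \<notin> Poly_Mapping.keys m'" using m by auto
      then show ?thesis by (simp add: in_keys_iff)
    qed
  qed
qed

text \<open>The coefficients of the finitely many monomials of degree \<open>d\<close> in \<open>n\<close> variables are coordinates with
trivial common kernel.\<close>

lemma homogeneous_basis_exists:
  fixes M :: "'a::idom mvpoly set"
  assumes k: "principal_subring (range (mv_const :: 'a \<Rightarrow> 'a mvpoly))"
    and M: "is_submodule (range mv_const) M" "M \<subseteq> polys n" "\<And>p. p \<in> M \<Longrightarrow> mv_homogeneous d p"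
  shows "\<exists>B\<subseteq>M. basis_mod (range mv_const) {0} B (\<lambda>b. b) M"
proof -
  let ?I = "{m. Poly_Mapping.keys m \<subseteq> {..<n} \<and> mdeg m = d}"
  let ?\<phi> = "\<lambda>m p. mv_const (Poly_Mapping.lookup p m) :: 'a mvpoly"
  have "{p \<in> M. \<forall>m\<in>?I. ?\<phi> m p = 0} = {0}"
  proof -
    have "p = 0" if p: "p \<in> M" "\<forall>m\<in>?I. ?\<phi> m p = 0" for p
    proof (rule poly_mapping_eqI)
      fix m
      have "m \<in> ?I" if "Poly_Mapping.lookup p m \<noteq> 0"
        using that p(1) M(2) M(3)[OF p(1)] unfolding mv_homogeneous_iff by (auto simp: polys_iff subset_iff)
      then show "Poly_Mapping.lookup p m = Poly_Mapping.lookup 0 m" using p(2) by fastforce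
    qed
    then show ?thesis using submoduleD(1)[OF M(1)] by auto
  qed
  moreover have "\<exists>B\<subseteq>M. basis_mod (range mv_const) {p \<in> M. \<forall>m\<in>?I. ?\<phi> m p = 0} B (\<lambda>b. b) M"
    by (rule principal_basis_of_coordinates[OF k finite_monomials M(1)])
      (auto simp: lookup_add mv_const_add lookup_mv_const_mult mv_const_mult)
  ultimately show ?thesis by simp
qed

section \<open>Free extensions of graded rings\<close>

lemma indep_modD:
  "indep_mod A K I e \<Longrightarrow> f \<in> I \<rightarrow> A \<Longrightarrow> (\<Sum>i\<in>I. f i * e i) \<in> K \<Longrightarrow> i \<in> I \<Longrightarrow> f i = 0"
  unfolding indep_mod_def by blast

definition hpart :: "'a::comm_ring_1 mvpoly set \<Rightarrow> nat \<Rightarrow> 'a mvpoly set" where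
  "hpart A d = {p \<in> A. mv_homogeneous d p}"

text \<open>The rank of a homogeneous component, read off from any of its bases; its agreement with
\<open>module_rank\<close> comes with \<open>Hilb_ring_invariant_ring\<close>.\<close>

definition hdim :: "'a::comm_ring_1 mvpoly set \<Rightarrow> nat \<Rightarrow> nat" where
  "hdim A d = (THE r. \<exists>B. basis_mod (range mv_const) {0} B (\<lambda>b. b) (hpart A d) \<and> card B = r)"

definition hseries :: "'a::comm_ring_1 mvpoly set \<Rightarrow> rat fps" where
  "hseries A = Abs_fps (\<lambda>d. of_nat (hdim A d))"

definition hbasis :: "'a::comm_ring_1 mvpoly set \<Rightarrow> 'i set \<Rightarrow> ('i \<Rightarrow> 'a mvpoly) \<Rightarrow> ('i \<Rightarrow> nat) \<Rightarrow> 'a mvpoly set \<Rightarrow> bool"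
  where "hbasis A I e \<delta> M \<longleftrightarrow> basis_mod A {0} I e M \<and> (\<forall>i\<in>I. mv_homogeneous (\<delta> i) (e i))"

lemma hpart_submodule:
  assumes "graded_subring A" shows "is_submodule (range mv_const) (hpart A d)"
  unfolding is_submodule_def
proof (intro conjI ballI)
  note AD = subringD[OF graded_subringD(1)[OF assms]]
  show "0 \<in> hpart A d" by (simp add: hpart_def AD)
  show "x + y \<in> hpart A d" if "x \<in> hpart A d" "y \<in> hpart A d" for x y
    using that by (simp add: hpart_def AD mv_homogeneous_add)
  show "a * x \<in> hpart A d" if "a \<in> range mv_const" "x \<in> hpart A d" for a x
  proof -
    obtain c where "a = mv_const c" using \<open>a \<in> range mv_const\<close> by blast
    then show ?thesis using that(2) graded_subringD(2)[OF assms]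
      by (simp add: hpart_def AD mv_homogeneous_const_mult)
  qed
qed

lemma hdim_eq:
  fixes A :: "'a::idom mvpoly set"
  assumes k: "principal_subring (range (mv_const :: 'a \<Rightarrow> 'a mvpoly))"
    and A: "graded_subring A" "A \<subseteq> polys n" and I: "basis_mod (range mv_const) {0} I e (hpart A d)"
  shows "hdim A d = card I"
proof -
  note uniq = basis_card_unique[OF consts_subring submodule_zero]
  obtain B :: "'a mvpoly set" where B: "basis_mod (range mv_const) {0} B (\<lambda>b. b) (hpart A d)"
    using homogeneous_basis_exists[OF k hpart_submodule[OF A(1)], where n = n and d = d] A(2)
    unfolding hpart_def by blast
  have "hdim A d = card B"
    unfolding hdim_def
  proof (rule the_equality)
    show "\<exists>B'. basis_mod (range mv_const) {0} B' (\<lambda>b. b) (hpart A d) \<and> card B' = card B"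
      using B by blast
  next
    fix r assume "\<exists>B. basis_mod (range mv_const) {0} B (\<lambda>b. b) (hpart A d) \<and> card B = r"
    then obtain B' where B': "basis_mod (range mv_const) {0} B' (\<lambda>b. b) (hpart A d)" "card B' = r"
      by blast
    show "r = card B" using uniq[OF B B'(1)] B'(2) by simp
  qed
  then show ?thesis using uniq[OF B I] by simp
qed

lemma hpart_basis_exists:
  fixes A :: "'a::idom mvpoly set"
  assumes k: "principal_subring (range (mv_const :: 'a \<Rightarrow> 'a mvpoly))"
    and A: "graded_subring A" "A \<subseteq> polys n"
  shows "\<exists>B\<subseteq>hpart A d. basis_mod (range mv_const) {0} B (\<lambda>b. b) (hpart A d) \<and> card B = hdim A d"
proof -
  obtain B where "B \<subseteq> hpart A d" "basis_mod (range mv_const) {0} B (\<lambda>b. b) (hpart A d)"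
    using homogeneous_basis_exists[OF k hpart_submodule[OF A(1)], where n = n and d = d] A(2)
    unfolding hpart_def by blast
  then show ?thesis using hdim_eq[OF k A, of B "\<lambda>b. b" d] by auto
qed

lemma hpart_subset: "hpart A d \<subseteq> A"
  by (auto simp: hpart_def)

lemma sum_Sigma_restrict:
  assumes "finite I" "\<And>i. i \<in> I \<Longrightarrow> finite (B i)"
  shows "(\<Sum>x\<in>Sigma {i \<in> I. P i} B. f x) = (\<Sum>i\<in>I. if P i then \<Sum>b\<in>B i. f (i, b) else 0)"
proof -
  have "(\<Sum>x\<in>Sigma {i \<in> I. P i} B. f x) = (\<Sum>i\<in>{i \<in> I. P i}. \<Sum>b\<in>B i. f (i, b))"
    using assms by (subst sum.Sigma) auto
  also have "\<dots> = (\<Sum>i\<in>I. if P i then \<Sum>b\<in>B i. f (i, b) else 0)"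
    using assms(1) by (rule sum.inter_filter)
  finally show ?thesis .
qed

text \<open>In degree \<open>d\<close>, the products of \<open>e i\<close> with a basis of the degree \<open>d - \<delta> i\<close> part of \<open>A\<close> form a basis
of \<open>M\<close> over the constants.\<close>

lemma hdim_free_extension:
  fixes A M :: "'a::idom mvpoly set"
  assumes k: "principal_subring (range (mv_const :: 'a \<Rightarrow> 'a mvpoly))"
    and A: "graded_subring A" and AM: "A \<subseteq> M" and M: "graded_subring M" "M \<subseteq> polys n"
    and bas: "hbasis A I e \<delta> M"
  shows "hdim M d = (\<Sum>i\<in>I. if \<delta> i \<le> d then hdim A (d - \<delta> i) else 0)"
proof -
  let ?k = "range (mv_const :: 'a \<Rightarrow> 'a mvpoly)"
  have An: "A \<subseteq> polys n" using AM M by auto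
  note AD = subringD[OF graded_subringD(1)[OF A]]
  note MD = subringD[OF graded_subringD(1)[OF M(1)]]
  have I: "finite I" "e \<in> I \<rightarrow> M" "indep_mod A {0} I e" "M \<subseteq> span_mod A {0} I e"
    and hom: "\<And>i. i \<in> I \<Longrightarrow> mv_homogeneous (\<delta> i) (e i)"
    using bas by (auto simp: hbasis_def basis_mod_def)
  obtain B where B: "\<And>d. B d \<subseteq> hpart A d" "\<And>d. basis_mod ?k {0} (B d) (\<lambda>b. b) (hpart A d)"
      "\<And>d. card (B d) = hdim A d"
  proof -
    have "\<forall>d. \<exists>B. B \<subseteq> hpart A d \<and> basis_mod ?k {0} B (\<lambda>b. b) (hpart A d) \<and> card B = hdim A d"
      using hpart_basis_exists[OF k A An] by blast
    then show ?thesis using that by (auto dest!: choice)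
  qed
  have fB: "finite (B d)" and iB: "indep_mod ?k {0} (B d) (\<lambda>b. b)"
    and sB: "hpart A d \<subseteq> span_mod ?k {0} (B d) (\<lambda>b. b)" for d
    using B(2)[of d] by (auto simp: basis_mod_def)
  have BA: "B j \<subseteq> A" for j using B(1)[of j] hpart_subset[of A j] by auto
  let ?J = "Sigma {i \<in> I. \<delta> i \<le> d} (\<lambda>i. B (d - \<delta> i))"
  let ?u = "\<lambda>x. snd x * e (fst x)"
  have sum_J: "(\<Sum>x\<in>?J. f x * ?u x)
      = (\<Sum>i\<in>I. (if \<delta> i \<le> d then \<Sum>b\<in>B (d - \<delta> i). f (i, b) * b else 0) * e i)" for f
    by (subst sum_Sigma_restrict[OF I(1) fB])
      (auto intro!: sum.cong simp: sum_distrib_right mult.assoc)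
  have "basis_mod ?k {0} ?J ?u (hpart M d)"
    unfolding basis_mod_def
  proof (intro conjI)
    show "finite ?J" using I(1) fB by auto
    show "?u \<in> ?J \<rightarrow> hpart M d"
    proof
      fix x assume x: "x \<in> ?J"
      then have "snd x \<in> hpart A (d - \<delta> (fst x))" "\<delta> (fst x) \<le> d" "fst x \<in> I"
        using subsetD[OF B(1)] by auto
      moreover have "snd x \<in> M" "e (fst x) \<in> M"
        using calculation AM I(2) by (auto simp: hpart_def)
      ultimately show "?u x \<in> hpart M d"
        using mv_homogeneous_mult[of "d - \<delta> (fst x)" "snd x" "\<delta> (fst x)" "e (fst x)"]
          hom[of "fst x"] MD(4)
        by (simp add: hpart_def)
    qed
    show "indep_mod ?k {0} ?J ?u"
      unfolding indep_mod_def
    proof (intro ballI impI)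
      fix f x assume f: "f \<in> ?J \<rightarrow> ?k" "(\<Sum>x\<in>?J. f x * ?u x) \<in> {0}" and x: "x \<in> ?J"
      let ?g = "\<lambda>i. if \<delta> i \<le> d then \<Sum>b\<in>B (d - \<delta> i). f (i, b) * b else 0"
      have "?g i \<in> A" if "i \<in> I" for i
      proof (cases "\<delta> i \<le> d")
        case True
        have "f (i, b) \<in> A" if "b \<in> B (d - \<delta> i)" for b
        proof -
          have "f (i, b) \<in> ?k" using f(1) that True \<open>i \<in> I\<close> by auto
          then show ?thesis using A by (auto simp: graded_subring_def)
        qed
        then have "(\<Sum>b\<in>B (d - \<delta> i). f (i, b) * b) \<in> A"
          using BA by (intro subring_sum[OF graded_subringD(1)[OF A]] AD(4)) auto
        then show ?thesis using True by simp
      qed (simp add: AD)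
      moreover have "(\<Sum>i\<in>I. ?g i * e i) \<in> {0}" using f(2) unfolding sum_J .
      ultimately have g0: "\<forall>i\<in>I. ?g i = 0"
        using I(3)[unfolded indep_mod_def, THEN bspec, of ?g] by blast
      obtain i b where ib: "x = (i, b)" "i \<in> I" "\<delta> i \<le> d" "b \<in> B (d - \<delta> i)" using x by auto
      have "(\<Sum>b\<in>B (d - \<delta> i). f (i, b) * b) \<in> {0}" using g0 ib by auto
      moreover have "(\<lambda>b. f (i, b)) \<in> B (d - \<delta> i) \<rightarrow> ?k" using f(1) ib by auto
      ultimately have "\<forall>b\<in>B (d - \<delta> i). f (i, b) = 0"
        using iB[of "d - \<delta> i", unfolded indep_mod_def, THEN bspec, of "\<lambda>b. f (i, b)"] by blast
      then show "f x = 0" using ib by simp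
    qed
    show "hpart M d \<subseteq> span_mod ?k {0} ?J ?u"
    proof
      fix p assume p: "p \<in> hpart M d"
      then obtain a where a: "a \<in> I \<rightarrow> A" "p = (\<Sum>i\<in>I. a i * e i)"
        using I(4) unfolding span_mod_def hpart_def by auto
      \<comment> \<open>Only the components of degree \<open>d - \<delta> i\<close> of the coordinates contribute.\<close>
      have "hcomp d p = p" using p hcomp_of_homogeneous[of d p d] by (simp add: hpart_def)
      then have "p = (\<Sum>i\<in>I. hcomp d (a i * e i))"
        using a(2) by (simp add: hcomp_sum[symmetric])
      also have "\<dots> = (\<Sum>i\<in>I. (if \<delta> i \<le> d then hcomp (d - \<delta> i) (a i) else 0) * e i)"
        by (intro sum.cong refl) (simp add: hcomp_mult_homogeneous[OF hom])
      finally have p_eq: "p = (\<Sum>i\<in>I. (if \<delta> i \<le> d then hcomp (d - \<delta> i) (a i) else 0) * e i)" .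
      have "\<forall>i\<in>I. \<exists>f. f \<in> B (d - \<delta> i) \<rightarrow> ?k \<and> hcomp (d - \<delta> i) (a i) = (\<Sum>b\<in>B (d - \<delta> i). f b * b)"
      proof
        fix i assume "i \<in> I"
        then have "a i \<in> A" using a(1) by auto
        then have "hcomp (d - \<delta> i) (a i) \<in> hpart A (d - \<delta> i)"
          using graded_subringD(3)[OF A] by (simp add: hpart_def)
        then show "\<exists>f. f \<in> B (d - \<delta> i) \<rightarrow> ?k \<and> hcomp (d - \<delta> i) (a i) = (\<Sum>b\<in>B (d - \<delta> i). f b * b)"
          using sB[of "d - \<delta> i"] unfolding span_mod_def by auto
      qed
      then obtain f where f': "\<forall>i\<in>I. f i \<in> B (d - \<delta> i) \<rightarrow> ?k \<and>
          hcomp (d - \<delta> i) (a i) = (\<Sum>b\<in>B (d - \<delta> i). f i b * b)"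
        by (rule bchoice[THEN exE])
      then have f: "f i \<in> B (d - \<delta> i) \<rightarrow> ?k"
          "hcomp (d - \<delta> i) (a i) = (\<Sum>b\<in>B (d - \<delta> i). f i b * b)" if "i \<in> I" for i
        using that by blast+
      have "p = (\<Sum>x\<in>?J. f (fst x) (snd x) * ?u x)"
        unfolding sum_J by (subst p_eq) (auto intro!: sum.cong simp: f(2))
      then show "p \<in> span_mod ?k {0} ?J ?u"
        unfolding span_mod_def using Pi_mem[OF f(1)]
        by (intro CollectI bexI[of _ "\<lambda>x. f (fst x) (snd x)"]) auto
    qed
  qed
  then have "hdim M d = card ?J" by (rule hdim_eq[OF k M])
  also have "\<dots> = (\<Sum>i\<in>{i \<in> I. \<delta> i \<le> d}. card (B (d - \<delta> i)))"
    using I(1) fB by simp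
  also have "\<dots> = (\<Sum>i\<in>I. if \<delta> i \<le> d then hdim A (d - \<delta> i) else 0)"
    unfolding B(3) using I(1) by (rule sum.inter_filter)
  finally show ?thesis .
qed

corollary hseries_free_extension:
  fixes A M :: "'a::idom mvpoly set"
  assumes "principal_subring (range (mv_const :: 'a \<Rightarrow> 'a mvpoly))"
    and "graded_subring A" and "A \<subseteq> M" and "graded_subring M" "M \<subseteq> polys n"
    and "hbasis A I e \<delta> M"
  shows "hseries M = hseries A * (\<Sum>i\<in>I. fps_X ^ \<delta> i)"
proof (rule fps_ext)
  fix d
  have "fps_nth (hseries A * (\<Sum>i\<in>I. fps_X ^ \<delta> i)) d = (\<Sum>i\<in>I. fps_nth (hseries A * fps_X ^ \<delta> i) d)"
    by (simp add: sum_distrib_left fps_sum_nth)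
  also have "\<dots> = (\<Sum>i\<in>I. of_nat (if \<delta> i \<le> d then hdim A (d - \<delta> i) else 0))"
    by (intro sum.cong) (auto simp: fps_X_power_mult_right_nth hseries_def)
  also have "\<dots> = fps_nth (hseries M) d"
    unfolding hseries_def using hdim_free_extension[OF assms, of d] by simp
  finally show "fps_nth (hseries M) d = fps_nth (hseries A * (\<Sum>i\<in>I. fps_X ^ \<delta> i)) d" by simp
qed

subsection \<open>The ideal generated by the elements without constant term\<close>

definition aug :: "'a::comm_ring_1 mvpoly set \<Rightarrow> 'a mvpoly set" where
  "aug A = {a \<in> A. hcomp 0 a = 0}"

text \<open>Working with the smallest \<open>S\<close>-submodule that contains \<open>aug A\<close> avoids the carriers of a ring
structure; \<open>genideal_eq_aug_ideal\<close> identifies it with the generated ideal.\<close>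

definition aug_ideal :: "'a::comm_ring_1 mvpoly set \<Rightarrow> 'a mvpoly set \<Rightarrow> 'a mvpoly set" where
  "aug_ideal A S = \<Inter>{I. is_submodule S I \<and> aug A \<subseteq> I}"

lemma aug_submodule:
  assumes "graded_subring A" shows "is_submodule A (aug A)"
  unfolding is_submodule_def aug_def
  using subringD[OF graded_subringD(1)[OF assms]] by (simp add: hcomp_add hcomp_zero_mult)

lemma aug_hcomp:
  assumes "graded_subring A" "a \<in> aug A" shows "hcomp d a \<in> aug A"
  using assms hcomp_of_homogeneous[OF hcomp_homogeneous, of 0 d a]
  by (simp add: aug_def graded_subringD(3))

lemma aug_ideal_submodule: "is_submodule S (aug_ideal A S)"
  unfolding aug_ideal_def is_submodule_def by blast

lemma aug_subset_aug_ideal: "aug A \<subseteq> aug_ideal A S"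
  by (auto simp: aug_ideal_def)

lemma aug_ideal_subset: "is_submodule S I \<Longrightarrow> aug A \<subseteq> I \<Longrightarrow> aug_ideal A S \<subseteq> I"
  by (auto simp: aug_ideal_def)

lemma diff_hcomp_0_in_aug:
  assumes "graded_subring A" "a \<in> A" shows "a - hcomp 0 a \<in> aug A"
proof -
  have "a - hcomp 0 a \<in> A"
    using assms by (intro subringD(6)[OF graded_subringD(1)] graded_subringD(3))
  then show ?thesis
    by (simp add: aug_def hcomp_diff hcomp_of_homogeneous[OF hcomp_homogeneous])
qed

lemma indep_coeffs_unique:
  assumes A: "is_subring A" and "indep_mod A {0} I e" "f \<in> I \<rightarrow> A" "g \<in> I \<rightarrow> A"
    "(\<Sum>i\<in>I. f i * e i) = (\<Sum>i\<in>I. g i * e i)" "i \<in> I"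
  shows "f i = g i"
proof -
  have "(\<Sum>i\<in>I. (f i - g i) * e i) = (\<Sum>i\<in>I. f i * e i) - (\<Sum>i\<in>I. g i * e i)"
    by (simp only: left_diff_distrib sum_subtractf)
  then have "(\<Sum>i\<in>I. (f i - g i) * e i) \<in> {0}" using assms(5) by simp
  moreover have "(\<lambda>i. f i - g i) \<in> I \<rightarrow> A"
    using Pi_mem[OF assms(3)] Pi_mem[OF assms(4)] by (intro Pi_I subringD(6)[OF A])
  ultimately have "f i - g i = 0"
    using indep_modD[OF assms(2), of "\<lambda>i. f i - g i" i] assms(6) by simp
  then show ?thesis by simp
qed

text \<open>If \<open>m = \<Sum> t i * e i\<close> and \<open>a\<close> has no constant term, then neither have the coordinates \<open>a * t i\<close> of
\<open>a * m\<close>. So the ideal is recognised by the constant terms of the \<open>A\<close>-coordinates.\<close>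

lemma aug_ideal_eq_aug_coeffs:
  assumes A: "graded_subring A" and M: "is_subring M" and AM: "A \<subseteq> M"
    and bas: "basis_mod A {0} I e M"
  shows "aug_ideal A M = {p. \<exists>a\<in>I \<rightarrow> aug A. p = (\<Sum>i\<in>I. a i * e i)}"
proof -
  define J where "J = {p. \<exists>a\<in>I \<rightarrow> aug A. p = (\<Sum>i\<in>I. a i * e i)}"
  have JI: "p \<in> J" if "a \<in> I \<rightarrow> aug A" "p = (\<Sum>i\<in>I. a i * e i)" for a p
    unfolding J_def using that by (intro CollectI bexI[of _ a])
  have JE: "\<exists>a. a \<in> I \<rightarrow> aug A \<and> p = (\<Sum>i\<in>I. a i * e i)" if "p \<in> J" for p
    using that unfolding J_def by (rule CollectE) (erule bexE, rule exI, rule conjI)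
  note aD = submoduleD[OF aug_submodule[OF A]]
  have I: "finite I" "e \<in> I \<rightarrow> M" "M \<subseteq> span_mod A {0} I e"
    using bas by (simp_all add: basis_mod_def)
  have mult: "a * m \<in> J" if a: "a \<in> aug A" and m: "m \<in> M" for a m
  proof -
    have "m \<in> span_mod A {0} I e" using I(3) m ..
    then obtain t where t: "t \<in> I \<rightarrow> A" "m = (\<Sum>i\<in>I. t i * e i)"
      unfolding span_mod_def by auto
    show ?thesis
    proof (rule JI[of "\<lambda>i. t i * a"])
      show "(\<lambda>i. t i * a) \<in> I \<rightarrow> aug A" using Pi_mem[OF t(1)] a by (intro Pi_I aD(3))
      show "a * m = (\<Sum>i\<in>I. t i * a * e i)"
        by (simp add: t(2) sum_distrib_left algebra_simps)
    qed
  qed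
  have add: "p + q \<in> J" if "p \<in> J" "q \<in> J" for p q
  proof -
    obtain a where a: "a \<in> I \<rightarrow> aug A" "p = (\<Sum>i\<in>I. a i * e i)"
      using JE[OF \<open>p \<in> J\<close>] by (elim exE conjE)
    obtain b where b: "b \<in> I \<rightarrow> aug A" "q = (\<Sum>i\<in>I. b i * e i)"
      using JE[OF \<open>q \<in> J\<close>] by (elim exE conjE)
    show ?thesis
    proof (rule JI[of "\<lambda>i. a i + b i"])
      show "(\<lambda>i. a i + b i) \<in> I \<rightarrow> aug A"
        using Pi_mem[OF a(1)] Pi_mem[OF b(1)] by (intro Pi_I aD(2))
      show "p + q = (\<Sum>i\<in>I. (a i + b i) * e i)"
        by (simp add: a(2) b(2) distrib_right sum.distrib)
    qed
  qed
  have zero: "0 \<in> J" using aD(1) by (intro JI[of "\<lambda>_. 0"]) simp_all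
  have sum: "(\<Sum>i\<in>T. g i) \<in> J" if "\<And>i. i \<in> T \<Longrightarrow> g i \<in> J" for T :: "'b set" and g
    using that by (induction T rule: infinite_finite_induct) (simp_all add: zero add)
  have "is_submodule M J"
    unfolding is_submodule_def
  proof (intro conjI ballI zero add)
    fix m p assume m: "m \<in> M" and "p \<in> J"
    obtain a where a: "a \<in> I \<rightarrow> aug A" "p = (\<Sum>i\<in>I. a i * e i)"
      using JE[OF \<open>p \<in> J\<close>] by (elim exE conjE)
    have "m * p = (\<Sum>i\<in>I. a i * (m * e i))" by (simp add: a(2) sum_distrib_left algebra_simps)
    also have "\<dots> \<in> J"
      using Pi_mem[OF a(1)] Pi_mem[OF I(2)] m by (intro sum mult subringD(4)[OF M])
    finally show "m * p \<in> J" .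
  qed
  moreover have "aug A \<subseteq> J"
    using mult[OF _ subringD(2)[OF M]] by (intro subsetI) simp
  ultimately have "aug_ideal A M \<subseteq> J" by (rule aug_ideal_subset)
  moreover have "J \<subseteq> aug_ideal A M"
  proof
    fix p assume "p \<in> J"
    obtain a where a: "a \<in> I \<rightarrow> aug A" "p = (\<Sum>i\<in>I. a i * e i)"
      using JE[OF \<open>p \<in> J\<close>] by (elim exE conjE)
    have "e i * a i \<in> aug_ideal A M" if "i \<in> I" for i
    proof (rule submoduleD(3)[OF aug_ideal_submodule])
      show "a i \<in> aug_ideal A M" using Pi_mem[OF a(1) that] aug_subset_aug_ideal by (rule subsetD[rotated])
      show "e i \<in> M" using Pi_mem[OF I(2) that] .
    qed
    then have "(\<Sum>i\<in>I. e i * a i) \<in> aug_ideal A M"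
      by (rule submodule_sum[OF aug_ideal_submodule])
    then show "p \<in> aug_ideal A M" unfolding a(2) by (simp add: mult.commute)
  qed
  ultimately show ?thesis unfolding J_def by (rule antisym)
qed

section \<open>Descending freeness to an intermediate ring\<close>

lemma span_modI: "f \<in> I \<rightarrow> A \<Longrightarrow> m - (\<Sum>i\<in>I. f i * e i) \<in> K \<Longrightarrow> m \<in> span_mod A K I e"
  unfolding span_mod_def by blast

lemma span_modE:
  assumes "m \<in> span_mod A K I e"
  obtains f where "f \<in> I \<rightarrow> A" "m - (\<Sum>i\<in>I. f i * e i) \<in> K"
  using assms unfolding span_mod_def by blast

lemma span_zeroE:
  assumes "m \<in> span_mod A {0} I e"
  obtains f where "f \<in> I \<rightarrow> A" "m = (\<Sum>i\<in>I. f i * e i)"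
  using assms by (rule span_modE) simp

lemma span_zero_submodule:
  assumes A: "is_subring A" shows "is_submodule A (span_mod A {0} I e)"
  unfolding is_submodule_def
proof (intro conjI ballI)
  show "0 \<in> span_mod A {0} I e"
    by (rule span_modI[of "\<lambda>_. 0"]) (simp_all add: subringD[OF A])
next
  fix x y assume "x \<in> span_mod A {0} I e" "y \<in> span_mod A {0} I e"
  then obtain f g where fg: "f \<in> I \<rightarrow> A" "x = (\<Sum>i\<in>I. f i * e i)" "g \<in> I \<rightarrow> A" "y = (\<Sum>i\<in>I. g i * e i)"
    by (elim span_zeroE)
  show "x + y \<in> span_mod A {0} I e"
  proof (rule span_modI[of "\<lambda>i. f i + g i"])
    show "(\<lambda>i. f i + g i) \<in> I \<rightarrow> A"
      using Pi_mem[OF fg(1)] Pi_mem[OF fg(3)] by (intro Pi_I subringD(3)[OF A])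
  qed (simp add: fg(2,4) sum.distrib distrib_right)
next
  fix a x assume a: "a \<in> A" and "x \<in> span_mod A {0} I e"
  then obtain f where f: "f \<in> I \<rightarrow> A" "x = (\<Sum>i\<in>I. f i * e i)"
    by (elim span_zeroE)
  show "a * x \<in> span_mod A {0} I e"
  proof (rule span_modI[of "\<lambda>i. a * f i"])
    show "(\<lambda>i. a * f i) \<in> I \<rightarrow> A"
      using Pi_mem[OF f(1)] a by (intro Pi_I subringD(4)[OF A])
  qed (simp add: f(2) sum_distrib_left mult.assoc)
qed

lemma span_base:
  assumes "is_subring A" "is_submodule A K" "finite I" "i \<in> I"
  shows "e i \<in> span_mod A K I e"
proof (rule span_modI[of "\<lambda>j. if j = i then 1 else 0"])
  show "(\<lambda>j. if j = i then 1 else 0) \<in> I \<rightarrow> A" using subringD[OF assms(1)] by simp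
  have "(\<Sum>j\<in>I. (if j = i then 1 else 0) * e j) = (\<Sum>j\<in>I. if j = i then e j else 0)"
    by (intro sum.cong) auto
  then show "e i - (\<Sum>j\<in>I. (if j = i then 1 else 0) * e j) \<in> K"
    using assms(3,4) submoduleD(1)[OF assms(2)] by (simp add: sum.delta)
qed

lemma submodule_subset: "is_submodule S M \<Longrightarrow> A \<subseteq> S \<Longrightarrow> is_submodule A M"
  unfolding is_submodule_def by blast

text \<open>\<open>A \<subseteq> S \<subseteq> R\<close> are graded rings and \<open>R\<close> is free over both of the smaller ones, with finite homogeneous
bases \<open>e\<close> over \<open>A\<close> and \<open>b\<close> over \<open>S\<close>. That \<open>1\<close> occurs among the \<open>b f\<close> makes \<open>S\<close> a direct summand of
\<open>R\<close> as an \<open>S\<close>-module. The aim is a homogeneous basis of \<open>S\<close> over \<open>A\<close>.\<close>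

locale free_tower =
  fixes n :: nat and A S :: "'a::idom mvpoly set"
    and E :: "'e set" and e :: "'e \<Rightarrow> 'a mvpoly" and \<delta> :: "'e \<Rightarrow> nat"
    and F :: "'f set" and b :: "'f \<Rightarrow> 'a mvpoly" and \<delta>' :: "'f \<Rightarrow> nat" and o1 :: 'f
  assumes k: "principal_subring (range (mv_const :: 'a \<Rightarrow> 'a mvpoly))"
    and A: "graded_subring A" and S: "graded_subring S" and AS: "A \<subseteq> S" and SR: "S \<subseteq> polys n"
    and E: "hbasis A E e \<delta> (polys n)" and F: "hbasis S F b \<delta>' (polys n)"
    and o1: "o1 \<in> F" "b o1 = 1"
begin

abbreviation kk :: "'a mvpoly set" where "kk \<equiv> range mv_const"
abbreviation R :: "'a mvpoly set" where "R \<equiv> polys n"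
abbreviation I :: "'a mvpoly set" where "I \<equiv> aug_ideal A S"
abbreviation J :: "'a mvpoly set" where "J \<equiv> aug_ideal A R"

lemmas R = polys_graded_subring[of n, where ?'a = 'a]
lemmas AD = subringD[OF graded_subringD(1)[OF A]]
lemmas SD = subringD[OF graded_subringD(1)[OF S]]
lemmas RD = subringD[OF graded_subringD(1)[OF R]]
lemmas ID = submoduleD[OF aug_ideal_submodule[of S A]]
lemmas JD = submoduleD[OF aug_ideal_submodule[of R A]]

lemma AR: "A \<subseteq> R" using AS SR by auto
lemma kA: "kk \<subseteq> A" and kS: "kk \<subseteq> S" using A S by (simp_all add: graded_subring_def)

lemma E_basis: "basis_mod A {0} E e R" "finite E" "e \<in> E \<rightarrow> R" "indep_mod A {0} E e" "R \<subseteq> span_mod A {0} E e"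
  and e_hom: "i \<in> E \<Longrightarrow> mv_homogeneous (\<delta> i) (e i)"
  using E by (simp_all add: hbasis_def basis_mod_def)

lemma F_basis: "finite F" "b \<in> F \<rightarrow> R" "indep_mod S {0} F b" "R \<subseteq> span_mod S {0} F b"
  using F by (simp_all add: hbasis_def basis_mod_def)

lemmas A_coordsE = span_zeroE[OF subsetD[OF E_basis(5)]]
lemmas S_coordsE = span_zeroE[OF subsetD[OF F_basis(4)]]

lemma J_eq: "J = {p. \<exists>a\<in>E \<rightarrow> aug A. p = (\<Sum>i\<in>E. a i * e i)}"
  by (rule aug_ideal_eq_aug_coeffs[OF A graded_subringD(1)[OF R] AR E_basis(1)])

text \<open>Write \<open>e i = \<Sum> s i f * b f\<close> with \<open>s i f \<in> S\<close>; then the \<open>S\<close>-coordinates of \<open>\<Sum> a i * e i\<close> are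
  \<open>\<Sum> a i * s i f\<close>.\<close>

lemma S_coords_of_J:
  assumes t: "t \<in> F \<rightarrow> S" and tJ: "(\<Sum>f\<in>F. t f * b f) \<in> J" and f: "f \<in> F"
  shows "\<exists>a\<in>E \<rightarrow> aug A. \<exists>s\<in>E \<rightarrow> S. t f = (\<Sum>i\<in>E. a i * s i)"
proof -
  obtain a where a: "a \<in> E \<rightarrow> aug A" "(\<Sum>f\<in>F. t f * b f) = (\<Sum>i\<in>E. a i * e i)"
    using tJ unfolding J_eq by blast
  have "\<forall>i\<in>E. \<exists>s. s \<in> F \<rightarrow> S \<and> e i = (\<Sum>f\<in>F. s f * b f)"
  proof
    fix i assume "i \<in> E"
    then have "e i \<in> R" using E_basis(3) by (rule Pi_mem[rotated])
    then show "\<exists>s. s \<in> F \<rightarrow> S \<and> e i = (\<Sum>f\<in>F. s f * b f)" by (elim S_coordsE) blast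
  qed
  then obtain s where "\<forall>i\<in>E. s i \<in> F \<rightarrow> S \<and> e i = (\<Sum>f\<in>F. s i f * b f)"
    by (rule bchoice[THEN exE])
  then have s: "s i \<in> F \<rightarrow> S" "e i = (\<Sum>f\<in>F. s i f * b f)" if "i \<in> E" for i
    using that by blast+
  have aA: "a i \<in> S" if "i \<in> E" for i
    using Pi_mem[OF a(1) that] AS unfolding aug_def by auto
  have "(\<Sum>i\<in>E. a i * e i) = (\<Sum>i\<in>E. \<Sum>f\<in>F. a i * s i f * b f)"
    by (intro sum.cong refl) (simp add: s(2) sum_distrib_left mult.assoc)
  also have "\<dots> = (\<Sum>f\<in>F. (\<Sum>i\<in>E. a i * s i f) * b f)"
    by (subst sum.swap) (simp add: sum_distrib_right)
  finally have eq: "(\<Sum>f\<in>F. t f * b f) = (\<Sum>f\<in>F. (\<Sum>i\<in>E. a i * s i f) * b f)"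
    using a(2) by (rule trans[rotated])
  have "(\<lambda>f. \<Sum>i\<in>E. a i * s i f) \<in> F \<rightarrow> S"
    using aA Pi_mem[OF s(1)] by (intro Pi_I subring_sum[OF graded_subringD(1)[OF S]] SD(4))
  then have "t f = (\<Sum>i\<in>E. a i * s i f)"
    using indep_coeffs_unique[OF graded_subringD(1)[OF S] F_basis(3) t _ eq f] by simp
  moreover have "(\<lambda>i. s i f) \<in> E \<rightarrow> S" using Pi_mem[OF s(1)] f by (intro Pi_I)
  ultimately show ?thesis using a(1) by (intro bexI[of _ a] bexI[of _ "\<lambda>i. s i f"])
qed

lemma I_subset_J: "I \<subseteq> J"
proof (rule aug_ideal_subset)
  show "is_submodule S J" unfolding is_submodule_def
    using JD SR by (simp add: subset_iff)
qed (rule aug_subset_aug_ideal)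

lemma I_subset_S: "I \<subseteq> S"
  by (rule aug_ideal_subset) (use SD AS in \<open>auto simp: is_submodule_def aug_def\<close>)

lemma aug_mult_I: "a \<in> aug A \<Longrightarrow> s \<in> S \<Longrightarrow> a * s \<in> I"
  using ID(3)[of s a] aug_subset_aug_ideal[of A S] by (auto simp: mult.commute)

lemma aug_mult_J: "a \<in> aug A \<Longrightarrow> s \<in> R \<Longrightarrow> a * s \<in> J"
  using JD(3)[of s a] aug_subset_aug_ideal[of A R] by (auto simp: mult.commute)

text \<open>An element \<open>p\<close> of \<open>S\<close> has \<open>S\<close>-coordinate \<open>p\<close> at \<open>o1\<close> and zero elsewhere.\<close>

lemma S_inter_J_coords:
  assumes "p \<in> S" "p \<in> J"
  shows "\<exists>a\<in>E \<rightarrow> aug A. \<exists>s\<in>E \<rightarrow> S. p = (\<Sum>i\<in>E. a i * s i)"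
proof -
  let ?t = "\<lambda>f. if f = o1 then p else 0"
  have "(\<Sum>f\<in>F. ?t f * b f) = (\<Sum>f\<in>F. if f = o1 then p * b f else 0)"
    by (intro sum.cong) auto
  then have "(\<Sum>f\<in>F. ?t f * b f) = p" using o1 F_basis(1) by (simp add: sum.delta)
  then show ?thesis
    using S_coords_of_J[of ?t o1] assms o1(1) SD(1) by simp
qed

text \<open>By this lemma \<open>S / I\<close> embeds into \<open>R / J\<close>.\<close>

lemma I_eq: "I = S \<inter> J"
proof
  show "S \<inter> J \<subseteq> I"
  proof
    fix p assume "p \<in> S \<inter> J"
    then obtain a s where as: "a \<in> E \<rightarrow> aug A" "s \<in> E \<rightarrow> S" "p = (\<Sum>i\<in>E. a i * s i)"
      using S_inter_J_coords by blast
    show "p \<in> I" unfolding as(3)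
      using Pi_mem[OF as(1)] Pi_mem[OF as(2)]
      by (intro submodule_sum[OF aug_ideal_submodule] aug_mult_I)
  qed
qed (use I_subset_J I_subset_S in blast)

lemma I_hcomp:
  assumes "p \<in> I" shows "hcomp d p \<in> I"
proof -
  obtain a s where as: "a \<in> E \<rightarrow> aug A" "s \<in> E \<rightarrow> S" "p = (\<Sum>i\<in>E. a i * s i)"
    using S_inter_J_coords assms unfolding I_eq by blast
  have "hcomp d (a * s) \<in> I" if a: "a \<in> aug A" and s: "s \<in> S" for a s
  proof -
    obtain D where D: "(\<Sum>j\<le>D. hcomp j s) = s" using sum_hcomp_eq by blast
    have "hcomp d (a * s) = (\<Sum>j\<le>D. hcomp d (a * hcomp j s))"
      by (subst D[symmetric]) (simp add: sum_distrib_left hcomp_sum)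
    also have "\<dots> = (\<Sum>j\<le>D. if j \<le> d then hcomp (d - j) a * hcomp j s else 0)"
      by (simp add: hcomp_mult_homogeneous[OF hcomp_homogeneous])
    also have "\<dots> \<in> I"
    proof (rule submodule_sum[OF aug_ideal_submodule])
      fix j
      show "(if j \<le> d then hcomp (d - j) a * hcomp j s else 0) \<in> I"
        using aug_mult_I[OF aug_hcomp[OF A a] graded_subringD(3)[OF S s]] ID(1) by simp
    qed
    finally show ?thesis .
  qed
  then show ?thesis unfolding as(3) hcomp_sum
    using Pi_mem[OF as(1)] Pi_mem[OF as(2)] by (intro submodule_sum[OF aug_ideal_submodule]) simp
qed

text \<open>By \<open>J_eq\<close>, taking the constant terms of the \<open>A\<close>-coordinates identifies \<open>R / J\<close> with the
functions from \<open>E\<close> to the constants.\<close>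

lemma E_basis_mod_J: "basis_mod kk J E e R"
  unfolding basis_mod_def
proof (intro conjI E_basis)
  show "indep_mod kk J E e"
    unfolding indep_mod_def
  proof (intro ballI impI)
    fix f i assume f: "f \<in> E \<rightarrow> kk" and fJ: "(\<Sum>i\<in>E. f i * e i) \<in> J" and i: "i \<in> E"
    obtain a where a: "a \<in> E \<rightarrow> aug A" "(\<Sum>i\<in>E. f i * e i) = (\<Sum>i\<in>E. a i * e i)"
      using fJ unfolding J_eq by blast
    have fA: "f \<in> E \<rightarrow> A" using f kA by blast
    have aA: "a \<in> E \<rightarrow> A" using a(1) by (auto simp: aug_def)
    have "f i = a i"
      by (rule indep_coeffs_unique[OF graded_subringD(1)[OF A] E_basis(4) fA aA a(2) i])
    moreover have "hcomp 0 (a i) = 0" using Pi_mem[OF a(1) i] by (simp add: aug_def)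
    moreover obtain c where "f i = mv_const c" using Pi_mem[OF f i] by blast
    ultimately show "f i = 0"
      using hcomp_of_homogeneous[OF mv_homogeneous_const, of 0 c] by simp
  qed
  show "R \<subseteq> span_mod kk J E e"
  proof
    fix p assume p: "p \<in> R"
    obtain a where a: "a \<in> E \<rightarrow> A" "p = (\<Sum>i\<in>E. a i * e i)" using p by (elim A_coordsE)
    show "p \<in> span_mod kk J E e"
    proof (rule span_modI[of "\<lambda>i. hcomp 0 (a i)"])
      show "(\<lambda>i. hcomp 0 (a i)) \<in> E \<rightarrow> kk" by (simp add: hcomp_zero)
      have "p - (\<Sum>i\<in>E. hcomp 0 (a i) * e i) = (\<Sum>i\<in>E. (a i - hcomp 0 (a i)) * e i)"
        by (simp add: a(2) sum_subtractf left_diff_distrib)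
      also have "\<dots> \<in> J"
        using Pi_mem[OF a(1)] Pi_mem[OF E_basis(3)]
        by (intro submodule_sum[OF aug_ideal_submodule] aug_mult_J diff_hcomp_0_in_aug[OF A])
      finally show "p - (\<Sum>i\<in>E. hcomp 0 (a i) * e i) \<in> J" .
    qed
  qed
qed

text \<open>The \<open>A\<close>-coordinates of \<open>p\<close> in the basis \<open>e\<close>, meaningful for \<open>p \<in> R\<close>.\<close>

definition coord :: "'a mvpoly \<Rightarrow> 'e \<Rightarrow> 'a mvpoly" where
  "coord p = (SOME t. t \<in> E \<rightarrow> A \<and> p = (\<Sum>i\<in>E. t i * e i))"

lemma coord:
  assumes "p \<in> R" shows "coord p \<in> E \<rightarrow> A" "(\<Sum>i\<in>E. coord p i * e i) = p"
proof -
  have "\<exists>t. t \<in> E \<rightarrow> A \<and> p = (\<Sum>i\<in>E. t i * e i)" using assms by (elim A_coordsE) blast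
  then have *: "coord p \<in> E \<rightarrow> A \<and> p = (\<Sum>i\<in>E. coord p i * e i)"
    unfolding coord_def by (rule someI_ex)
  show "coord p \<in> E \<rightarrow> A" using * by (rule conjunct1)
  show "(\<Sum>i\<in>E. coord p i * e i) = p" using * by (elim conjE) (rule sym)
qed

lemma coord_unique:
  assumes "t \<in> E \<rightarrow> A" "p \<in> R" "(\<Sum>i\<in>E. t i * e i) = p" "i \<in> E" shows "coord p i = t i"
  by (rule indep_coeffs_unique[OF graded_subringD(1)[OF A] E_basis(4) coord(1)[OF assms(2)] assms(1) _ assms(4)])
    (simp only: coord(2)[OF assms(2)] assms(3))

lemma coord_add:
  assumes "p \<in> R" "q \<in> R" "i \<in> E" shows "coord (p + q) i = coord p i + coord q i"
proof (rule coord_unique)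
  show "(\<lambda>i. coord p i + coord q i) \<in> E \<rightarrow> A"
    using Pi_mem[OF coord(1)[OF assms(1)]] Pi_mem[OF coord(1)[OF assms(2)]] by (intro Pi_I AD(3))
  show "(\<Sum>i\<in>E. (coord p i + coord q i) * e i) = p + q"
    by (simp add: distrib_right sum.distrib coord(2) assms)
qed (use assms RD in simp_all)

lemma coord_mult:
  assumes "a \<in> A" "p \<in> R" "i \<in> E" shows "coord (a * p) i = a * coord p i"
proof (rule coord_unique)
  show "(\<lambda>i. a * coord p i) \<in> E \<rightarrow> A"
    using Pi_mem[OF coord(1)[OF assms(2)]] assms(1) by (intro Pi_I AD(4))
  have "(\<Sum>i\<in>E. (a * coord p i) * e i) = a * (\<Sum>i\<in>E. coord p i * e i)"
    by (simp add: sum_distrib_left mult.assoc)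
  then show "(\<Sum>i\<in>E. (a * coord p i) * e i) = a * p" by (simp only: coord(2)[OF assms(2)])
qed (use assms RD AR in auto)

lemma coord_const_term_zero_iff:
  assumes "p \<in> R" shows "(\<forall>i\<in>E. hcomp 0 (coord p i) = 0) \<longleftrightarrow> p \<in> J"
proof
  assume "\<forall>i\<in>E. hcomp 0 (coord p i) = 0"
  then have "coord p \<in> E \<rightarrow> aug A" using coord(1)[OF assms] by (auto simp: aug_def)
  moreover have "p = (\<Sum>i\<in>E. coord p i * e i)" by (rule coord(2)[OF assms, symmetric])
  ultimately show "p \<in> J" unfolding J_eq by blast
next
  assume "p \<in> J"
  then obtain a where a: "a \<in> E \<rightarrow> aug A" "p = (\<Sum>i\<in>E. a i * e i)"
    unfolding J_eq by blast
  have "a \<in> E \<rightarrow> A" using a(1) by (auto simp: aug_def)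
  then have "coord p i = a i" if "i \<in> E" for i
    by (rule coord_unique[OF _ assms a(2)[symmetric] that])
  then show "\<forall>i\<in>E. hcomp 0 (coord p i) = 0"
    using Pi_mem[OF a(1)] by (simp add: aug_def)
qed

lemma hpart_S: "is_submodule kk (hpart S d)" "hpart S d \<subseteq> S" "hpart S d \<subseteq> R"
  using hpart_submodule[OF S] SR by (auto simp: hpart_def)

text \<open>\<open>S / I\<close> embeds into \<open>R / J\<close>, which is free of finite rank over the constants; the constant
terms of the \<open>A\<close>-coordinates serve as coordinates.\<close>

lemma quotient_basis_exists: "\<exists>B\<subseteq>hpart S d. basis_mod kk I B (\<lambda>b. b) (hpart S d)"
proof -
  let ?\<phi> = "\<lambda>i p. hcomp 0 (coord p i)" and ?M = "hpart S d"
  have const: "hcomp 0 p \<in> kk" for p :: "'a mvpoly" by (simp add: hcomp_zero)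
  have MR: "m \<in> R" if "m \<in> ?M" for m using that hpart_S(3) by blast
  have scal: "?\<phi> i (c * m) = c * ?\<phi> i m" if i: "i \<in> E" and c: "c \<in> kk" and m: "m \<in> ?M" for i c m
  proof -
    obtain c' where c': "c = mv_const c'" using c by blast
    have "c \<in> A" using c kA by blast
    then show ?thesis using i MR[OF m] by (simp add: coord_mult c' hcomp_const_mult)
  qed
  have ker: "{m \<in> ?M. \<forall>i\<in>E. ?\<phi> i m = 0} = ?M \<inter> I"
    using coord_const_term_zero_iff MR hpart_S(2) unfolding I_eq by blast
  have "\<exists>B\<subseteq>?M. basis_mod kk {m \<in> ?M. \<forall>i\<in>E. ?\<phi> i m = 0} B (\<lambda>b. b) ?M"
    by (rule principal_basis_of_coordinates[OF k E_basis(2) hpart_S(1)])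
      (simp_all add: const coord_add MR hcomp_add scal)
  then obtain B where B: "B \<subseteq> ?M" "basis_mod kk (?M \<inter> I) B (\<lambda>b. b) ?M" unfolding ker by blast
  have "indep_mod kk I B (\<lambda>b. b)"
    unfolding indep_mod_def
  proof (intro ballI impI)
    fix f c assume f: "f \<in> B \<rightarrow> kk" "(\<Sum>c\<in>B. f c * c) \<in> I" "c \<in> B"
    have "(\<Sum>c\<in>B. f c * c) \<in> ?M"
      using Pi_mem[OF f(1)] B(1) by (intro submodule_sum[OF hpart_S(1)] submoduleD(3)[OF hpart_S(1)]) auto
    then show "f c = 0"
      using B(2) f indep_modD[of kk "?M \<inter> I" B "\<lambda>b. b" f c] unfolding basis_mod_def by simp
  qed
  moreover have "?M \<subseteq> span_mod kk I B (\<lambda>b. b)"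
    using B(2) unfolding basis_mod_def span_mod_def by blast
  ultimately have "basis_mod kk I B (\<lambda>b. b) ?M"
    using B unfolding basis_mod_def by simp
  then show ?thesis using B(1) by blast
qed

text \<open>Lifts to \<open>S\<close> of a basis of the degree \<open>d\<close> part of \<open>S / I\<close>.\<close>

definition Q :: "nat \<Rightarrow> 'a mvpoly set" where
  "Q d = (SOME B. B \<subseteq> hpart S d \<and> basis_mod kk I B (\<lambda>b. b) (hpart S d))"

lemma Q: "Q d \<subseteq> hpart S d" "basis_mod kk I (Q d) (\<lambda>b. b) (hpart S d)"
  using someI_ex[OF quotient_basis_exists[of d, unfolded Bex_def]] quotient_basis_exists[of d]
  unfolding Q_def by (metis (mono_tags, lifting) someI_ex)+

lemma Q_basis: "finite (Q d)" "indep_mod kk I (Q d) (\<lambda>b. b)" "hpart S d \<subseteq> span_mod kk I (Q d) (\<lambda>b. b)"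
  using Q(2)[of d] by (simp_all add: basis_mod_def)

lemma Q_not_I: assumes "c \<in> Q d" shows "c \<notin> I"
proof
  assume "c \<in> I"
  let ?f = "\<lambda>x. if x = c then 1 else 0"
  have "(\<Sum>x\<in>Q d. ?f x * x) = (\<Sum>x\<in>Q d. if x = c then x else 0)" by (intro sum.cong) auto
  also have "\<dots> = c" using assms Q_basis(1) by (simp add: sum.delta)
  finally have 1: "(\<Sum>x\<in>Q d. ?f x * x) \<in> I" using \<open>c \<in> I\<close> by simp
  have 2: "?f \<in> Q d \<rightarrow> kk" using subringD(1,2)[OF consts_subring[where ?'a = 'a]] by (simp add: Pi_def)
  show False using indep_modD[OF Q_basis(2) 2 1 assms] by simp
qed

definition D :: nat where "D = Max (insert 0 (\<delta> ` E))"

text \<open>In degrees above all \<open>\<delta> i\<close> every coordinate has positive degree, so the degree \<open>d\<close> part of \<open>S\<close> lies in \<open>I\<close>.\<close>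

lemma Q_empty: assumes "D < d" shows "Q d = {}"
proof (rule ccontr)
  assume "Q d \<noteq> {}"
  then obtain c where c: "c \<in> Q d" by blast
  then have cS: "c \<in> S" "mv_homogeneous d c" using Q(1)[of d] by (auto simp: hpart_def)
  have cR: "c \<in> R" using cS SR by blast
  have lt: "\<delta> i < d" if "i \<in> E" for i
    using that E_basis(2) assms unfolding D_def by (simp add: Max_less_iff)
  have "c = hcomp d (\<Sum>i\<in>E. coord c i * e i)"
    using cS(2) by (simp add: coord(2)[OF cR] hcomp_of_homogeneous[OF cS(2)])
  also have "\<dots> = (\<Sum>i\<in>E. hcomp (d - \<delta> i) (coord c i) * e i)"
    unfolding hcomp_sum using lt by (intro sum.cong refl) (simp add: hcomp_mult_homogeneous[OF e_hom] less_imp_le)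
  also have "\<dots> \<in> J"
  proof (intro submodule_sum[OF aug_ideal_submodule] aug_mult_J)
    fix i assume i: "i \<in> E"
    show "hcomp (d - \<delta> i) (coord c i) \<in> aug A"
      using graded_subringD(3)[OF A Pi_mem[OF coord(1)[OF cR] i], of "d - \<delta> i"] lt[OF i]
      by (simp add: aug_def hcomp_of_homogeneous[OF hcomp_homogeneous])
    show "e i \<in> R" using E_basis(3) i by (rule Pi_mem)
  qed
  finally have "c \<in> I" using cS(1) unfolding I_eq by blast
  then show False using Q_not_I[OF c] by blast
qed

text \<open>Elements are paired with their degrees, so that \<open>snd\<close> is the family and \<open>fst\<close> its degree function.\<close>

abbreviation C :: "(nat \<times> 'a mvpoly) set" where "C \<equiv> Sigma {..D} Q"

lemma C_finite: "finite C" using Q_basis(1) by blast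
lemma C_S: "snd \<in> C \<rightarrow> S"
proof
  fix x assume "x \<in> C"
  then have "snd x \<in> Q (fst x)" by auto
  then show "snd x \<in> S" using Q(1)[of "fst x"] by (auto simp: hpart_def)
qed

lemma const_coeffs_in_A: "f \<in> X \<rightarrow> kk \<Longrightarrow> f \<in> X \<rightarrow> A" using kA by blast

text \<open>Graded Nakayama: modulo the span of \<open>Q d\<close>, an element of degree \<open>d\<close> lies in \<open>I\<close>, so it is a sum of
products \<open>a * t\<close> where \<open>a\<close> has positive degree and \<open>t\<close> smaller degree; by induction the \<open>t\<close> are
in the span already.\<close>

lemma S_eq_C_span: "S \<subseteq> span_mod A {0} C snd"
proof -
  let ?T = "span_mod A {0} C snd"
  note T = span_zero_submodule[OF graded_subringD(1)[OF A], of C snd]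
  have part: "hpart S d \<subseteq> ?T" for d
  proof (induction d rule: less_induct)
    case (less d)
    show ?case
    proof
      fix s assume s: "s \<in> hpart S d"
      obtain f where f: "f \<in> Q d \<rightarrow> kk" "s - (\<Sum>c\<in>Q d. f c * c) \<in> I"
        using subsetD[OF Q_basis(3) s] by (elim span_modE)
      let ?u = "\<Sum>c\<in>Q d. f c * c"
      have QT: "c \<in> ?T" if "c \<in> Q d" for c
      proof -
        have "d \<le> D" using that Q_empty[of d] by (cases "d \<le> D") auto
        then have "(d, c) \<in> C" using that by auto
        then have "snd (d, c) \<in> ?T"
          by (rule span_base[OF graded_subringD(1)[OF A] submodule_zero C_finite])
        then show ?thesis by simp
      qed
      have uT: "?u \<in> ?T"
        using Pi_mem[OF const_coeffs_in_A[OF f(1)]] QT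
        by (intro submodule_sum[OF T] submoduleD(3)[OF T])
      have uM: "?u \<in> hpart S d"
        using Pi_mem[OF f(1)] Q(1)[of d] 
        by (intro submodule_sum[OF hpart_S(1)] submoduleD(3)[OF hpart_S(1)]) blast+
      have "s - ?u \<in> hpart S d" using submodule_diff[OF consts_subring hpart_S(1) s uM] .
      then have hom: "hcomp d (s - ?u) = s - ?u"
        using hcomp_of_homogeneous[of d "s - ?u" d] by (simp add: hpart_def)
      obtain a t where at: "a \<in> E \<rightarrow> aug A" "t \<in> E \<rightarrow> S" "s - ?u = (\<Sum>i\<in>E. a i * t i)"
        using S_inter_J_coords f(2) unfolding I_eq by blast
      have lower: "hcomp d (a * t) \<in> ?T" if a: "a \<in> aug A" and t: "t \<in> S" for a t
      proof -
        obtain N where N: "(\<Sum>j\<le>N. hcomp j t) = t" using sum_hcomp_eq by blast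
        have "hcomp d (a * t) = (\<Sum>j\<le>N. hcomp d (a * hcomp j t))"
          by (subst N[symmetric]) (simp add: sum_distrib_left hcomp_sum)
        also have "\<dots> = (\<Sum>j\<le>N. if j \<le> d then hcomp (d - j) a * hcomp j t else 0)"
          by (simp add: hcomp_mult_homogeneous[OF hcomp_homogeneous])
        also have "\<dots> \<in> ?T"
        proof (rule submodule_sum[OF T])
          fix j
          consider "j < d" | "j = d" | "d < j" by linarith
          then show "(if j \<le> d then hcomp (d - j) a * hcomp j t else 0) \<in> ?T"
          proof cases
            case 1
            have "hcomp j t \<in> ?T"
              using less[OF 1] graded_subringD(3)[OF S t, of j] by (auto simp: hpart_def)
            moreover have "hcomp (d - j) a \<in> A"
              using aug_hcomp[OF A a, of "d - j"] by (simp add: aug_def)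
            ultimately show ?thesis using 1 submoduleD(3)[OF T] by simp
          next
            case 2
            then show ?thesis using a submoduleD(1)[OF T] by (simp add: aug_def)
          next
            case 3
            then show ?thesis using submoduleD(1)[OF T] by simp
          qed
        qed
        finally show ?thesis .
      qed
      have "hcomp d (s - ?u) \<in> ?T"
        unfolding at(3) hcomp_sum using Pi_mem[OF at(1)] Pi_mem[OF at(2)]
        by (intro submodule_sum[OF T] lower)
      then have "s - ?u + ?u \<in> ?T" using uT unfolding hom by (intro submoduleD(2)[OF T])
      then show "s \<in> ?T" by simp
    qed
  qed
  show ?thesis
  proof
    fix s assume s: "s \<in> S"
    obtain N where N: "(\<Sum>j\<le>N. hcomp j s) = s" using sum_hcomp_eq by blast
    have "(\<Sum>j\<le>N. hcomp j s) \<in> ?T"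
    proof (rule submodule_sum[OF T])
      fix j show "hcomp j s \<in> ?T"
        using subsetD[OF part[of j], of "hcomp j s"] graded_subringD(3)[OF S s] by (simp add: hpart_def)
    qed
    then show "s \<in> ?T" by (simp only: N)
  qed
qed

abbreviation cb :: "(nat \<times> 'a mvpoly) \<times> 'f \<Rightarrow> 'a mvpoly" where "cb x \<equiv> snd (fst x) * b (snd x)"

lemma sum_cb: "(\<Sum>x\<in>C \<times> F. g x * cb x) = (\<Sum>f\<in>F. (\<Sum>c\<in>C. g (c, f) * snd c) * b f)"
proof -
  have "(\<Sum>x\<in>C \<times> F. g x * cb x) = (\<Sum>c\<in>C. \<Sum>f\<in>F. g (c, f) * snd c * b f)"
    by (subst sum.cartesian_product) (simp add: case_prod_beta mult.assoc)
  also have "\<dots> = (\<Sum>f\<in>F. \<Sum>c\<in>C. g (c, f) * snd c * b f)" by (rule sum.swap)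
  finally show ?thesis by (simp add: sum_distrib_right)
qed

lemma R_eq_cb_span: assumes "p \<in> R" shows "p \<in> span_mod A {0} (C \<times> F) cb"
proof -
  obtain t where t: "t \<in> F \<rightarrow> S" "p = (\<Sum>f\<in>F. t f * b f)" using assms by (elim S_coordsE)
  have "\<forall>f\<in>F. \<exists>g. g \<in> C \<rightarrow> A \<and> t f = (\<Sum>c\<in>C. g c * snd c)"
  proof
    fix f assume "f \<in> F"
    then have "t f \<in> span_mod A {0} C snd" using Pi_mem[OF t(1)] S_eq_C_span by blast
    then show "\<exists>g. g \<in> C \<rightarrow> A \<and> t f = (\<Sum>c\<in>C. g c * snd c)" by (elim span_zeroE) blast
  qed
  then obtain g where "\<forall>f\<in>F. g f \<in> C \<rightarrow> A \<and> t f = (\<Sum>c\<in>C. g f c * snd c)"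
    by (rule bchoice[THEN exE])
  then have g: "g f \<in> C \<rightarrow> A" "t f = (\<Sum>c\<in>C. g f c * snd c)" if "f \<in> F" for f
    using that by blast+
  show ?thesis
  proof (rule span_modI[of "\<lambda>x. g (snd x) (fst x)"])
    show "(\<lambda>x. g (snd x) (fst x)) \<in> C \<times> F \<rightarrow> A" using Pi_mem[OF g(1)] by auto
    have "(\<Sum>x\<in>C \<times> F. g (snd x) (fst x) * cb x) = (\<Sum>f\<in>F. t f * b f)"
      unfolding sum_cb by (intro sum.cong refl) (simp add: g(2))
    then show "p - (\<Sum>x\<in>C \<times> F. g (snd x) (fst x) * cb x) \<in> {0}" by (simp add: t(2))
  qed
qed

lemma cb_R: "cb \<in> C \<times> F \<rightarrow> R"
  using Pi_mem[OF C_S] Pi_mem[OF F_basis(2)] SR by (auto intro!: RD(4))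

text \<open>\<open>I\<close> is a homogeneous ideal, so a relation splits into relations between elements of one degree.\<close>

lemma C_indep_mod_I: "indep_mod kk I C snd"
  unfolding indep_mod_def
proof (intro ballI impI)
  fix g x assume g: "g \<in> C \<rightarrow> kk" "(\<Sum>c\<in>C. g c * snd c) \<in> I" and x: "x \<in> C"
  obtain d c where dc: "x = (d, c)" "d \<le> D" "c \<in> Q d" using x by auto
  have hom: "hcomp d (g (j, c) * c) = (if d = j then g (j, c) * c else 0)"
    if jc: "j \<le> D" "c \<in> Q j" for j c
  proof (rule hcomp_of_homogeneous)
    have "g (j, c) \<in> kk" using Pi_mem[OF g(1), of "(j, c)"] jc by simp
    then obtain r where r: "g (j, c) = mv_const r" by blast
    have "mv_homogeneous j c" using Q(1)[of j] jc(2) by (auto simp: hpart_def)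
    then show "mv_homogeneous j (g (j, c) * c)" unfolding r by (rule mv_homogeneous_const_mult)
  qed
  have "(\<Sum>c\<in>C. g c * snd c) = (\<Sum>j\<le>D. \<Sum>c\<in>Q j. g (j, c) * c)"
    using Q_basis(1) by (subst sum.Sigma) (auto simp: case_prod_beta)
  then have "hcomp d (\<Sum>c\<in>C. g c * snd c) = (\<Sum>j\<le>D. \<Sum>c\<in>Q j. hcomp d (g (j, c) * c))"
    by (simp add: hcomp_sum)
  also have "\<dots> = (\<Sum>j\<le>D. if d = j then \<Sum>c\<in>Q j. g (j, c) * c else 0)"
    by (intro sum.cong refl) (simp add: hom)
  also have "\<dots> = (\<Sum>c\<in>Q d. g (d, c) * c)" using dc(2) by (simp add: sum.delta')
  finally have "(\<Sum>c\<in>Q d. g (d, c) * c) \<in> I" using I_hcomp[OF g(2), of d] by simp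
  moreover have "(\<lambda>c. g (d, c)) \<in> Q d \<rightarrow> kk" using g(1) dc(2) by auto
  ultimately show "g x = 0"
    using indep_modD[OF Q_basis(2), of "\<lambda>c. g (d, c)" d c] dc by simp
qed

text \<open>\<open>R / J\<close> is the direct sum of the copies \<open>(S / I) * b f\<close>, so it has the products \<open>c * b f\<close> as a second
basis over the constants. Comparison with \<open>E_basis_mod_J\<close> counts the elements of \<open>C\<close>.\<close>

lemma cb_basis_mod_J: "basis_mod kk J (C \<times> F) cb R"
  unfolding basis_mod_def
proof (intro conjI cb_R)
  show "finite (C \<times> F)" using C_finite F_basis(1) by blast
  show "indep_mod kk J (C \<times> F) cb"
    unfolding indep_mod_def
  proof (intro ballI impI)
    fix g x assume g: "g \<in> C \<times> F \<rightarrow> kk" "(\<Sum>x\<in>C \<times> F. g x * cb x) \<in> J" and x: "x \<in> C \<times> F"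
    let ?t = "\<lambda>f. \<Sum>c\<in>C. g (c, f) * snd c"
    obtain c f where cf: "x = (c, f)" "c \<in> C" "f \<in> F" using x by auto
    have gk: "(\<lambda>c. g (c, f)) \<in> C \<rightarrow> kk" if "f \<in> F" for f using g(1) that by auto
    have t: "?t \<in> F \<rightarrow> S"
    proof (intro Pi_I subring_sum[OF graded_subringD(1)[OF S]] SD(4))
      fix f c assume "f \<in> F" "c \<in> C"
      then show "g (c, f) \<in> S" using g(1) kS by blast
      show "snd c \<in> S" using \<open>c \<in> C\<close> C_S by (rule Pi_mem[rotated])
    qed
    have "(\<Sum>f\<in>F. ?t f * b f) \<in> J" using g(2) unfolding sum_cb .
    then obtain a s where as: "a \<in> E \<rightarrow> aug A" "s \<in> E \<rightarrow> S" "?t f = (\<Sum>i\<in>E. a i * s i)"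
      using S_coords_of_J[OF t _ cf(3)] by blast
    have "?t f \<in> I" unfolding as(3) using Pi_mem[OF as(1)] Pi_mem[OF as(2)]
      by (intro submodule_sum[OF aug_ideal_submodule] aug_mult_I)
    then show "g x = 0"
      using indep_modD[OF C_indep_mod_I gk[OF cf(3)] _ cf(2)] cf(1) by simp
  qed
  show "R \<subseteq> span_mod kk J (C \<times> F) cb"
  proof
    fix p assume "p \<in> R"
    then have "p \<in> span_mod A {0} (C \<times> F) cb" by (rule R_eq_cb_span)
    then obtain g where g: "g \<in> C \<times> F \<rightarrow> A" "p = (\<Sum>x\<in>C \<times> F. g x * cb x)"
      by (rule span_zeroE)
    show "p \<in> span_mod kk J (C \<times> F) cb"
    proof (rule span_modI[of "\<lambda>x. hcomp 0 (g x)"])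
      show "(\<lambda>x. hcomp 0 (g x)) \<in> C \<times> F \<rightarrow> kk" by (simp add: hcomp_zero)
      have "p - (\<Sum>x\<in>C \<times> F. hcomp 0 (g x) * cb x) = (\<Sum>x\<in>C \<times> F. (g x - hcomp 0 (g x)) * cb x)"
        by (simp only: g(2) sum_subtractf left_diff_distrib)
      also have "\<dots> \<in> J"
        using Pi_mem[OF g(1)] Pi_mem[OF cb_R]
        by (intro submodule_sum[OF aug_ideal_submodule] aug_mult_J diff_hcomp_0_in_aug[OF A])
      finally show "p - (\<Sum>x\<in>C \<times> F. hcomp 0 (g x) * cb x) \<in> J" .
    qed
  qed
qed

text \<open>The products \<open>c * b f\<close> span \<open>R\<close> over \<open>A\<close> and are as many as the \<open>e i\<close>, hence independent over \<open>A\<close>;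
those with \<open>b f = 1\<close> are the elements of \<open>C\<close>.\<close>

lemma C_hbasis: "hbasis A C snd fst S"
  unfolding hbasis_def basis_mod_def
proof (intro conjI C_finite C_S S_eq_C_span)
  have CF: "finite (C \<times> F)" using C_finite F_basis(1) by blast
  have card: "card (C \<times> F) = card E"
    by (rule basis_card_unique[OF consts_subring aug_ideal_submodule[of R A, THEN submodule_subset] cb_basis_mod_J E_basis_mod_J])
      (use kA AR in blast)
  have eE: "e \<in> E \<rightarrow> span_mod A {0} (C \<times> F) cb"
    using Pi_mem[OF E_basis(3)] by (intro Pi_I R_eq_cb_span)
  have ind: "indep_mod A {0} (C \<times> F) cb"
    by (rule spanning_of_basis_size_indep[OF graded_subringD(1)[OF A] E_basis(2,4) CF eE]) (simp only: card)
  show "indep_mod A {0} C snd"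
    unfolding indep_mod_def
  proof (intro ballI impI)
    fix g c assume g: "g \<in> C \<rightarrow> A" "(\<Sum>c\<in>C. g c * snd c) \<in> {0}" and c: "c \<in> C"
    let ?h = "\<lambda>x. if snd x = o1 then g (fst x) else 0"
    have "(\<Sum>x\<in>C \<times> F. ?h x * cb x) = (\<Sum>f\<in>F. (if f = o1 then \<Sum>c\<in>C. g c * snd c else 0) * b f)"
      unfolding sum_cb by (intro sum.cong refl) simp
    also have "\<dots> = 0" using g(2) by simp
    finally have 1: "(\<Sum>x\<in>C \<times> F. ?h x * cb x) \<in> {0}" by simp
    have 2: "?h \<in> C \<times> F \<rightarrow> A" using Pi_mem[OF g(1)] AD(1) by auto
    have "(c, o1) \<in> C \<times> F" using c o1(1) by simp
    then show "g c = 0" using indep_modD[OF ind 2 1, of "(c, o1)"] by simp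
  qed
  show "\<forall>i\<in>C. mv_homogeneous (fst i) (snd i)"
  proof
    fix x assume "x \<in> C"
    then have "snd x \<in> Q (fst x)" by auto
    then show "mv_homogeneous (fst x) (snd x)" using Q(1)[of "fst x"] by (auto simp: hpart_def)
  qed
qed

end

section \<open>Monomial bases over rings of invariants\<close>

subsection \<open>Adjoining a root of a monic polynomial\<close>

text \<open>The relation for \<open>y ^ d\<close> makes the span of the lower powers stable under multiplication by \<open>y\<close>,
hence under all of its own elements.\<close>

lemma adjoin_monic_root:
  assumes T: "is_subring T" and d: "0 < d" and y: "y ^ d \<in> span_mod T {0} {..<d} (\<lambda>i. y ^ i)"
  defines "N \<equiv> span_mod T {0} {..<d} (\<lambda>i. y ^ i)"
  shows "is_subring N" "T \<subseteq> N" "y \<in> N"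
proof -
  note N = span_zero_submodule[OF T, of "{..<d}" "\<lambda>i. y ^ i", folded N_def]
  note ND = submoduleD[OF N]
  have base: "y ^ i \<in> N" if "i < d" for i
    unfolding N_def by (rule span_base[OF T submodule_zero]) (use that in simp_all)
  have one: "1 \<in> N" using base[OF d] by simp
  show TN: "T \<subseteq> N" using ND(3)[OF _ one] by auto
  have ymult: "y * m \<in> N" if m: "m \<in> N" for m
  proof -
    obtain g where g: "g \<in> {..<d} \<rightarrow> T" "m = (\<Sum>i<d. g i * y ^ i)"
      using m unfolding N_def by (rule span_zeroE)
    have "y ^ Suc i \<in> N" if "i < d" for i
    proof (cases "Suc i < d")
      case False
      then have "Suc i = d" using that by simp
      then show ?thesis using y unfolding N_def by simp
    qed (rule base)
    then have "(\<Sum>i<d. g i * y ^ Suc i) \<in> N"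
      using Pi_mem[OF g(1)] by (intro submodule_sum[OF N] ND(3)) simp_all
    then show ?thesis by (simp add: g(2) sum_distrib_left mult_ac)
  qed
  show "y \<in> N" using ymult[OF one] by simp
  have powmult: "y ^ i * m \<in> N" if "m \<in> N" for i m
    by (induction i) (use ymult that in \<open>simp_all add: mult.assoc\<close>)
  have "x * m \<in> N" if x: "x \<in> N" and m: "m \<in> N" for x m
  proof -
    obtain g where g: "g \<in> {..<d} \<rightarrow> T" "x = (\<Sum>i<d. g i * y ^ i)"
      using x unfolding N_def by (rule span_zeroE)
    have "(\<Sum>i<d. g i * (y ^ i * m)) \<in> N"
      using Pi_mem[OF g(1)] by (intro submodule_sum[OF N] ND(3)[OF _ powmult[OF m]])
    then show ?thesis by (simp add: g(2) sum_distrib_right mult.assoc)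
  qed
  moreover have "- x \<in> N" if "x \<in> N" for x
    using ND(3)[OF subringD(5)[OF T subringD(2)[OF T]] that] by simp
  ultimately show "is_subring N" unfolding is_subring_def using ND one by blast
qed

definition roots_poly :: "'r::idom set \<Rightarrow> 'r poly" where
  "roots_poly \<Omega> = (\<Prod>v\<in>\<Omega>. [:- v, 1:])"

lemma degree_roots_poly: "degree (roots_poly \<Omega>) = card \<Omega>"
  and lead_coeff_roots_poly: "lead_coeff (roots_poly \<Omega>) = 1"
proof -
  show "degree (roots_poly \<Omega>) = card \<Omega>"
    unfolding roots_poly_def by (cases "finite \<Omega>") (simp_all add: degree_prod_eq_sum_degree)
  show "lead_coeff (roots_poly \<Omega>) = 1"
    unfolding roots_poly_def by (simp add: lead_coeff_prod)
qed

lemma poly_roots_poly: "finite \<Omega> \<Longrightarrow> v \<in> \<Omega> \<Longrightarrow> poly (roots_poly \<Omega>) v = 0"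
  unfolding roots_poly_def poly_prod by (rule prod_zero) auto

text \<open>Synthetic division: the coefficients of the quotient are computed from the top, by ring operations
with \<open>v\<close> and the coefficients of the product.\<close>

lemma coeffs_linear_quotient:
  assumes T: "is_subring T" and v: "v \<in> T" and P: "\<And>i. coeff ([:- v, 1:] * q) i \<in> T"
  shows "coeff q i \<in> T"
proof -
  have rec: "coeff q i \<in> T" if "coeff q (Suc i) \<in> T" for i
  proof -
    have "coeff ([:- v, 1:] * q) (Suc i) + v * coeff q (Suc i) \<in> T"
      by (intro subringD(3)[OF T P] subringD(4)[OF T v that])
    then show ?thesis by simp
  qed
  have high: "coeff q i \<in> T" if "degree q < i" for i
    using that subringD(1)[OF T] by (simp add: coeff_eq_0)
  have "coeff q i \<in> T" if "i \<le> Suc (degree q)"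
    using that
  proof (induction rule: inc_induct)
    case base
    show ?case by (rule high) simp
  qed (rule rec)
  then show ?thesis using high[of i] by (cases "i \<le> Suc (degree q)") auto
qed

lemma coeffs_roots_poly_diff:
  assumes T: "is_subring T" and "finite \<Omega>" and P: "\<And>i. coeff (roots_poly \<Omega>) i \<in> T"
    and "finite \<Delta>" "\<Delta> \<subseteq> T" "\<Delta> \<subseteq> \<Omega>"
  shows "coeff (roots_poly (\<Omega> - \<Delta>)) i \<in> T"
  using assms(4-)
proof (induction \<Delta> arbitrary: i rule: finite_induct)
  case empty
  then show ?case using P by simp
next
  case (insert v \<Delta>)
  have "\<Omega> - \<Delta> = insert v (\<Omega> - insert v \<Delta>)" using insert by auto
  then have "roots_poly (\<Omega> - \<Delta>) = [:- v, 1:] * roots_poly (\<Omega> - insert v \<Delta>)"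
    unfolding roots_poly_def using assms(2) by (metis Diff_iff finite_Diff insertI1 prod.insert)
  then have P: "coeff ([:- v, 1:] * roots_poly (\<Omega> - insert v \<Delta>)) i \<in> T" for i
    using insert.IH[of i] insert.prems by simp
  have "v \<in> T" using insert.prems by simp
  then show ?case using P by (rule coeffs_linear_quotient[OF T])
qed

text \<open>A hom that permutes the roots fixes their elementary symmetric functions.\<close>

lemma coeffs_roots_poly_invariant:
  fixes \<Omega> :: "'a::idom mvpoly set"
  assumes hom: "\<And>\<phi>. \<phi> \<in> \<Phi> \<Longrightarrow> graded_hom \<phi>"
    and fin: "finite \<Omega>" and sub: "\<Omega> \<subseteq> polys n" and stable: "\<And>\<phi>. \<phi> \<in> \<Phi> \<Longrightarrow> \<phi> ` \<Omega> = \<Omega>"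
  shows "coeff (roots_poly \<Omega>) i \<in> invariants n \<Phi>"
proof -
  note R = subringD[OF graded_subringD(1)[OF polys_graded_subring[of n, where ?'a = 'a]]]
  have in_R: "coeff (roots_poly X) i \<in> polys n" if "finite X" "X \<subseteq> polys n" for X :: "'a mvpoly set" and i
    using that
  proof (induction X arbitrary: i rule: finite_induct)
    case empty
    then show ?case using R(1,2) by (simp add: roots_poly_def)
  next
    case (insert v X)
    have "coeff [:- v, 1:] j \<in> polys n" for j
      using R insert.prems by (simp add: coeff_pCons split: nat.split)
    moreover have "coeff (roots_poly X) j \<in> polys n" for j
      using insert.IH insert.prems by simp
    ultimately show ?case
      unfolding roots_poly_def prod.insert[OF insert.hyps] coeff_mult
      by (intro subring_sum[OF graded_subringD(1)[OF polys_graded_subring]] R(4))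
  qed
  have map: "\<phi> (coeff (\<Prod>v\<in>X. [:- v, 1:]) i) = coeff (\<Prod>v\<in>X. [:- \<phi> v, 1:]) i"
    if "graded_hom \<phi>" for \<phi> X i
  proof (induction X arbitrary: i rule: infinite_finite_induct)
    case (insert v X)
    have "\<phi> (coeff [:- v, 1:] j) = coeff [:- \<phi> v, 1:] j" for j
      using graded_homD[OF that] by (simp add: coeff_pCons split: nat.split)
    then show ?case
      unfolding prod.insert[OF insert.hyps] coeff_mult
      by (simp only: graded_homD[OF that] insert.IH)
  qed (use graded_homD[OF that] in simp_all)
  have "\<phi> (coeff (roots_poly \<Omega>) i) = coeff (roots_poly \<Omega>) i" if \<phi>: "\<phi> \<in> \<Phi>" for \<phi>
  proof -
    have "inj_on \<phi> \<Omega>" using stable[OF \<phi>] fin by (simp add: eq_card_imp_inj_on)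
    then have "(\<Prod>v\<in>\<Omega>. [:- \<phi> v, 1:]) = (\<Prod>v\<in>\<phi> ` \<Omega>. [:- v, 1:])"
      by (simp add: prod.reindex)
    then show ?thesis
      unfolding roots_poly_def map[OF hom[OF \<phi>]] stable[OF \<phi>] by simp
  qed
  then show ?thesis unfolding invariants_def using in_R[OF fin sub] by simp
qed

subsection \<open>The basis theorem\<close>

lemma sum_PiE_Suc:
  "(\<Sum>a\<in>PiE {..<Suc j} D. F a) = (\<Sum>i\<in>D j. \<Sum>g\<in>PiE {..<j} D. F (g(j := i)))"
proof -
  have "PiE {..<Suc j} D = (\<lambda>(i, g). g(j := i)) ` (D j \<times> PiE {..<j} D)"
    by (simp add: lessThan_Suc PiE_insert_eq)
  then have "(\<Sum>a\<in>PiE {..<Suc j} D. F a) = (\<Sum>(i, g)\<in>D j \<times> PiE {..<j} D. F (g(j := i)))"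
    by (simp only:) (subst sum.reindex, rule inj_combinator, simp_all add: case_prod_beta)
  then show ?thesis by (simp add: sum.cartesian_product)
qed

definition exponents :: "nat \<Rightarrow> (nat \<Rightarrow> nat) \<Rightarrow> (nat \<Rightarrow> nat) set" where
  "exponents j d = PiE {..<j} (\<lambda>i. {..<d i})"

definition pow_prod :: "nat \<Rightarrow> (nat \<Rightarrow> 'r::comm_monoid_mult) \<Rightarrow> (nat \<Rightarrow> nat) \<Rightarrow> 'r" where
  "pow_prod j y a = (\<Prod>i<j. y i ^ a i)"

lemma pow_prod_upd: "pow_prod (Suc j) y (a(j := i)) = pow_prod j y a * y j ^ i"
  unfolding pow_prod_def by simp

lemma pow_prod_cong: "(\<And>i. i < j \<Longrightarrow> v i = w i) \<Longrightarrow> pow_prod j v a = pow_prod j w a"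
  unfolding pow_prod_def by simp

lemma finite_exponents: "finite (exponents j d)"
  unfolding exponents_def by (intro finite_PiE) simp_all

text \<open>The set \<open>\<Theta> v j\<close> of admissible values at level \<open>j\<close> depends only on the values chosen before. Fixing all
but the last value leaves a polynomial in one unknown that has at least as many roots as its degree
bound, so its coefficients vanish at all admissible points with one level less.\<close>

lemma coeffs_zero_of_vanishing_on_tree:
  fixes f :: "(nat \<Rightarrow> nat) \<Rightarrow> 'r::idom"
  assumes fin: "\<And>v j. j < n \<Longrightarrow> finite (\<Theta> v j)"
    and card: "\<And>v j. j < n \<Longrightarrow> d j \<le> card (\<Theta> v j)"
    and dep: "\<And>v w j. (\<And>i. i < j \<Longrightarrow> v i = w i) \<Longrightarrow> \<Theta> v j = \<Theta> w j"
    and zero: "\<And>v. (\<And>j. j < n \<Longrightarrow> v j \<in> \<Theta> v j) \<Longrightarrow> (\<Sum>a\<in>exponents n d. f a * pow_prod n v a) = 0"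
    and a: "a \<in> exponents n d"
  shows "f a = 0"
  using fin card zero a
proof (induction n arbitrary: f a)
  case 0
  have "exponents 0 d = {\<lambda>_. undefined}" by (simp add: exponents_def)
  then show ?case using 0(3)[of "\<lambda>_. 0"] 0(4) by (simp add: pow_prod_def)
next
  case (Suc n)
  define c where "c v i = (\<Sum>g\<in>exponents n d. f (g(n := i)) * pow_prod n v g)" for v i
  have vanish: "c v i = 0" if v: "\<And>j. j < n \<Longrightarrow> v j \<in> \<Theta> v j" and i: "i < d n" for v i
  proof -
    define p where "p = (\<Sum>i<d n. monom (c v i) i)"
    have coeff_p: "coeff p i = (if i < d n then c v i else 0)" for i
      unfolding p_def by (simp add: coeff_sum)
    have root: "poly p w = 0" if w: "w \<in> \<Theta> v n" for w
    proof -
      let ?v = "v(n := w)"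
      have same: "\<Theta> ?v j = \<Theta> v j" if "j \<le> n" for j
        using that by (intro dep) simp
      have adm: "?v j \<in> \<Theta> ?v j" if "j < Suc n" for j
        using that same[of j] v w by (cases "j = n") simp_all
      have pp: "pow_prod n ?v g = pow_prod n v g" for g by (rule pow_prod_cong) simp
      have "0 = (\<Sum>a\<in>exponents (Suc n) d. f a * pow_prod (Suc n) ?v a)"
        by (rule Suc.prems(3)[of ?v, OF adm, symmetric])
      also have "\<dots> = (\<Sum>i<d n. \<Sum>g\<in>exponents n d. f (g(n := i)) * (pow_prod n v g * w ^ i))"
        unfolding exponents_def sum_PiE_Suc by (simp add: pow_prod_upd pp)
      also have "\<dots> = poly p w"
        unfolding p_def by (simp add: poly_sum poly_monom c_def sum_distrib_right mult.assoc)
      finally show ?thesis by simp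
    qed
    have "p = 0"
    proof (rule ccontr)
      assume p: "p \<noteq> 0"
      have "d n \<le> card (\<Theta> v n)" using Suc.prems(2) by simp
      also have "\<dots> \<le> card {w. poly p w = 0}"
        using root poly_roots_finite[OF p] by (intro card_mono) auto
      also have "\<dots> \<le> degree p" by (rule card_poly_roots_bound[OF p])
      also have "\<dots> < d n"
        using p coeff_p[of "degree p"] by (cases "degree p < d n") auto
      finally show False by simp
    qed
    then show ?thesis using coeff_p[of i] i by simp
  qed
  have aD: "a i < d i" if "i < Suc n" for i
    using PiE_mem[OF Suc.prems(4)[unfolded exponents_def], of i] that by simp
  have an: "a n < d n" by (rule aD) simp
  have eq: "(restrict a {..<n})(n := a n) = a"
  proof
    fix i
    show "((restrict a {..<n})(n := a n)) i = a i"
      using PiE_arb[OF Suc.prems(4)[unfolded exponents_def], of i] by (cases "i < n"; cases "i = n") simp_all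
  qed
  have "restrict a {..<n} \<in> exponents n d"
    using aD by (simp add: exponents_def)
  then have "f ((restrict a {..<n})(n := a n)) = 0"
    by (rule Suc.IH[of "\<lambda>g. f (g(n := a n))", rotated 3])
      (use Suc.prems(1,2) vanish[OF _ an] in \<open>simp_all add: c_def\<close>)
  then show ?case unfolding eq .
qed

text \<open>The basis theorem behind both halves of the result. The set \<open>\<Omega> j\<close> is stable under \<open>\<Phi>\<close> and contains \<open>y j\<close>.
Dividing the linear factors of \<open>\<Delta> y j\<close>, which lie in the ring generated by the earlier \<open>y i\<close>, out of the
invariant polynomial with root set \<open>\<Omega> j\<close> leaves a monic equation of degree \<open>d j\<close> for \<open>y j\<close>; so the monomials
span. For independence, \<open>\<Delta>\<close> takes an arbitrary tuple \<open>v\<close> in place of \<open>y\<close>: the tuples with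
\<open>v j \<in> \<Omega> j - \<Delta> v j\<close> form a tree as in the preceding lemma, and \<open>realise\<close> says that each of them
is the image of \<open>y\<close> under an element of \<open>\<Phi>\<close>, so every relation with invariant coefficients also holds for \<open>v\<close>.\<close>

theorem monomial_basis_over_invariants:
  fixes y :: "nat \<Rightarrow> 'a::idom mvpoly"
  assumes hom: "\<And>\<phi>. \<phi> \<in> \<Phi> \<Longrightarrow> graded_hom \<phi>"
    and y: "\<And>j. j < n \<Longrightarrow> y j \<in> polys n" "\<And>j. j < n \<Longrightarrow> mv_homogeneous 1 (y j)"
    and gen: "\<And>T. is_subring T \<Longrightarrow> range mv_const \<subseteq> T \<Longrightarrow> (\<And>j. j < n \<Longrightarrow> y j \<in> T) \<Longrightarrow> polys n \<subseteq> T"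
    and \<Omega>: "\<And>j. j < n \<Longrightarrow> finite (\<Omega> j)" "\<And>j. j < n \<Longrightarrow> \<Omega> j \<subseteq> polys n"
      "\<And>j \<phi>. j < n \<Longrightarrow> \<phi> \<in> \<Phi> \<Longrightarrow> \<phi> ` \<Omega> j = \<Omega> j"
    and dep: "\<And>v w j. (\<And>i. i < j \<Longrightarrow> v i = w i) \<Longrightarrow> \<Delta> v j = \<Delta> w j"
    and \<Delta>: "\<And>j. j < n \<Longrightarrow> \<Delta> y j \<subseteq> \<Omega> j"
      "\<And>T j. j < n \<Longrightarrow> is_subring T \<Longrightarrow> range mv_const \<subseteq> T \<Longrightarrow> (\<And>i. i < j \<Longrightarrow> y i \<in> T) \<Longrightarrow> \<Delta> y j \<subseteq> T"
    and y_new: "\<And>j. j < n \<Longrightarrow> y j \<in> \<Omega> j - \<Delta> y j"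
    and card: "\<And>j. j < n \<Longrightarrow> card (\<Omega> j - \<Delta> y j) = d j" "\<And>v j. j < n \<Longrightarrow> d j \<le> card (\<Omega> j - \<Delta> v j)"
    and realise: "\<And>v. (\<And>j. j < n \<Longrightarrow> v j \<in> \<Omega> j - \<Delta> v j) \<Longrightarrow> \<exists>\<phi>\<in>\<Phi>. \<forall>j<n. \<phi> (y j) = v j"
  shows "hbasis (invariants n \<Phi>) (exponents n d) (pow_prod n y) (\<lambda>a. \<Sum>j<n. a j) (polys n)"
proof -
  let ?A = "invariants n \<Phi>"
  note R = graded_subringD(1)[OF polys_graded_subring[of n, where ?'a = 'a]]
  note A = invariants_graded_subring[of \<Phi> n, OF hom]
  note As = graded_subringD(1)[OF A]
  have d_pos: "0 < d j" if "j < n" for j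
    using y_new[OF that] \<Omega>(1)[OF that] card(1)[OF that] by (metis card_gt_0_iff empty_iff finite_Diff)
  have kA: "range mv_const \<subseteq> ?A" using A by (simp add: graded_subring_def)
  \<comment> \<open>\<open>M j\<close> arises from the invariants by adjoining \<open>y 0, \<dots>, y (j - 1)\<close>.\<close>
  define M where "M = rec_nat ?A (\<lambda>j T. span_mod T {0} {..<d j} (\<lambda>i. y j ^ i))"
  have M0: "M 0 = ?A" and MS: "M (Suc j) = span_mod (M j) {0} {..<d j} (\<lambda>i. y j ^ i)" for j
    by (simp_all add: M_def)
  have M: "is_subring (M j) \<and> ?A \<subseteq> M j \<and> (\<forall>i<j. y i \<in> M j)" if "j \<le> n" for j
    using that
  proof (induction j)
    case 0
    then show ?case using As by (simp add: M0)
  next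
    case (Suc j)
    then have j: "j < n" and T: "is_subring (M j)" "?A \<subseteq> M j" "\<And>i. i < j \<Longrightarrow> y i \<in> M j" by auto
    let ?P = "roots_poly (\<Omega> j - \<Delta> y j)"
    have "coeff (roots_poly (\<Omega> j)) i \<in> M j" for i
      using coeffs_roots_poly_invariant[OF hom \<Omega>(1)[OF j] \<Omega>(2)[OF j] \<Omega>(3)[OF j]] T(2) by blast
    then have P: "coeff ?P i \<in> M j" for i
    proof (rule coeffs_roots_poly_diff[OF T(1) \<Omega>(1)[OF j]])
      show "finite (\<Delta> y j)" using \<Delta>(1)[OF j] \<Omega>(1)[OF j] by (rule finite_subset)
      show "\<Delta> y j \<subseteq> M j" using kA T by (intro \<Delta>(2)[OF j]) auto
    qed (rule \<Delta>(1)[OF j])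
    have deg: "degree ?P = d j" by (simp add: degree_roots_poly card(1)[OF j])
    have "0 = poly ?P (y j)" using poly_roots_poly[OF _ y_new[OF j]] \<Omega>(1)[OF j] by simp
    also have "\<dots> = (\<Sum>i\<le>d j. coeff ?P i * y j ^ i)" by (simp add: poly_altdef deg)
    also have "\<dots> = (\<Sum>i<d j. coeff ?P i * y j ^ i) + y j ^ d j"
      using lead_coeff_roots_poly[of "\<Omega> j - \<Delta> y j"] deg
      by (simp add: lessThan_Suc_atMost[symmetric])
    finally have rel: "y j ^ d j - (\<Sum>i<d j. (- coeff ?P i) * y j ^ i) = 0"
      by (simp add: sum_negf add.commute)
    have "y j ^ d j \<in> span_mod (M j) {0} {..<d j} (\<lambda>i. y j ^ i)"
      using P rel by (intro span_modI[of "\<lambda>i. - coeff ?P i"]) (simp_all add: subringD(5)[OF T(1)])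
    note adj = adjoin_monic_root[OF T(1) d_pos[OF j] this, folded MS]
    have "y i \<in> M (Suc j)" if "i < Suc j" for i
      using that adj(2,3) T(3)[of i] by (cases "i = j") auto
    then show ?case using adj(1,2) T(2) by blast
  qed
  have flat: "M j \<subseteq> span_mod ?A {0} (exponents j d) (pow_prod j y)" for j
  proof (induction j)
    case 0
    show ?case
    proof
      fix p assume "p \<in> M 0"
      then show "p \<in> span_mod ?A {0} (exponents 0 d) (pow_prod 0 y)"
        unfolding M0 by (intro span_modI[of "\<lambda>_. p"]) (simp_all add: exponents_def pow_prod_def)
    qed
  next
    case (Suc j)
    let ?N = "span_mod ?A {0} (exponents (Suc j) d) (pow_prod (Suc j) y)"
    note N = span_zero_submodule[OF As, of "exponents (Suc j) d" "pow_prod (Suc j) y"]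
    have base: "pow_prod j y a * y j ^ i \<in> ?N" if "a \<in> exponents j d" "i < d j" for a i
    proof -
      have "a(j := i) \<in> exponents (Suc j) d"
        using that unfolding exponents_def lessThan_Suc by (intro PiE_fun_upd) simp_all
      then have "pow_prod (Suc j) y (a(j := i)) \<in> ?N"
        using span_base[OF As submodule_zero finite_exponents, where e = "pow_prod (Suc j) y"] by blast
      then show ?thesis by (simp only: pow_prod_upd)
    qed
    show ?case
    proof
      fix p assume "p \<in> M (Suc j)"
      then obtain g where g: "g \<in> {..<d j} \<rightarrow> M j" "p = (\<Sum>i<d j. g i * y j ^ i)"
        unfolding MS by (rule span_zeroE)
      have "g i * y j ^ i \<in> ?N" if "i \<in> {..<d j}" for i
      proof -
        have i: "i < d j" using that by simp
        have "g i \<in> span_mod ?A {0} (exponents j d) (pow_prod j y)"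
          using Pi_mem[OF g(1)] i Suc.IH by blast
        then obtain f where f: "f \<in> exponents j d \<rightarrow> ?A" "g i = (\<Sum>a\<in>exponents j d. f a * pow_prod j y a)"
          by (rule span_zeroE)
        have "g i * y j ^ i = (\<Sum>a\<in>exponents j d. f a * (pow_prod j y a * y j ^ i))"
          by (simp add: f(2) sum_distrib_right mult.assoc)
        also have "\<dots> \<in> ?N"
          using Pi_mem[OF f(1)] by (intro submodule_sum[OF N] submoduleD(3)[OF N _ base[OF _ i]])
        finally show ?thesis .
      qed
      then show "p \<in> ?N" unfolding g(2) using submodule_sum[OF N, of "{..<d j}" "\<lambda>i. g i * y j ^ i"] by simp
    qed
  qed
  have span: "polys n \<subseteq> span_mod ?A {0} (exponents n d) (pow_prod n y)"
  proof -
    have "polys n \<subseteq> M n" using M[of n] kA by (intro gen) auto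
    then show ?thesis using flat[of n] by blast
  qed
  have indep: "indep_mod ?A {0} (exponents n d) (pow_prod n y)"
    unfolding indep_mod_def
  proof (intro ballI impI)
    fix f a assume f: "f \<in> exponents n d \<rightarrow> ?A" "(\<Sum>a\<in>exponents n d. f a * pow_prod n y a) \<in> {0}"
      and a: "a \<in> exponents n d"
    show "f a = 0"
    proof (rule coeffs_zero_of_vanishing_on_tree[where \<Theta> = "\<lambda>v j. \<Omega> j - \<Delta> v j" and d = d and n = n and f = f and a = a])
      show "finite (\<Omega> j - \<Delta> v j)" if "j < n" for v j using \<Omega>(1)[OF that] by simp
      show "\<Omega> j - \<Delta> v j = \<Omega> j - \<Delta> w j" if "\<And>i. i < j \<Longrightarrow> v i = w i" for v w j
        using dep[of j v w, OF that] by simp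
      show "(\<Sum>a\<in>exponents n d. f a * pow_prod n v a) = 0"
        if v: "\<And>j. j < n \<Longrightarrow> v j \<in> \<Omega> j - \<Delta> v j" for v
      proof -
        obtain \<phi> where \<phi>: "\<phi> \<in> \<Phi>" "\<And>j. j < n \<Longrightarrow> \<phi> (y j) = v j" using realise[OF v] by blast
        note H = graded_homD[OF hom[OF \<phi>(1)]]
        have "\<phi> (f a * pow_prod n y a) = f a * pow_prod n v a" if "a \<in> exponents n d" for a
        proof -
          have "\<phi> (f a) = f a" using Pi_mem[OF f(1) that] \<phi>(1) unfolding invariants_def by blast
          then show ?thesis using \<phi>(2) by (simp add: H pow_prod_def)
        qed
        then have "\<phi> (\<Sum>a\<in>exponents n d. f a * pow_prod n y a) = (\<Sum>a\<in>exponents n d. f a * pow_prod n v a)"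
          by (simp only: H(8)) (rule sum.cong, simp_all)
        then show ?thesis using f(2) H(5) by simp
      qed
    qed (use card(2) a in simp_all)
  qed
  have "pow_prod n y \<in> exponents n d \<rightarrow> polys n"
    unfolding pow_prod_def using y(1) by (intro Pi_I subring_prod[OF R] subring_power[OF R]) simp
  moreover have "mv_homogeneous (\<Sum>j<n. a j) (pow_prod n y a)" for a
    unfolding pow_prod_def using mv_homogeneous_power[OF y(2)] by (intro mv_homogeneous_prod) force
  ultimately show ?thesis
    unfolding hbasis_def basis_mod_def using span indep finite_exponents by blast
qed

text \<open>The factor \<open>(1 - fps_X) ^ n\<close> clears the denominators of the geometric sums; it cancels when two such
series are compared.\<close>

lemma exponents_series:
  "(\<Sum>a\<in>exponents n d. fps_X ^ (\<Sum>j<n. a j)) * (1 - fps_X) ^ n = (\<Prod>j<n. 1 - fps_X ^ d j :: rat fps)"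
proof -
  have "(\<Sum>a\<in>exponents n d. fps_X ^ (\<Sum>j<n. a j)) = (\<Prod>j<n. \<Sum>i<d j. fps_X ^ i :: rat fps)"
    unfolding exponents_def by (simp add: prod_sum_PiE power_sum)
  moreover have "(\<Prod>j<n. \<Sum>i<d j. fps_X ^ i) * (1 - fps_X) ^ n = (\<Prod>j<n. (1 - fps_X) * (\<Sum>i<d j. fps_X ^ i :: rat fps))"
    by (simp add: prod.distrib mult.commute)
  ultimately show ?thesis by (simp add: one_diff_power_eq)
qed

section \<open>Modules presented by polynomials\<close>

text \<open>A module \<open>M\<close> over a ring with carrier that is the image, under \<open>\<pi>\<close>, of a submodule \<open>X\<close> of a domain, the
kernel being cut out by \<open>K\<close>; scalars act through \<open>h\<close>. This translates bases in the sense of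
\<open>basis_mod\<close> into linear independence, spans and ranks of \<open>M\<close>. It serves for homogeneous components
of rings and of quotient rings, for a ring as a module over a subring, and for subspaces of a vector space.\<close>

locale presented_module =
  fixes Rr :: "('s, 'x) ring_scheme" and M :: "('s, 'm, 'y) module_scheme"
    and h :: "'s \<Rightarrow> 'p::idom" and \<pi> :: "'p \<Rightarrow> 'm" and X K :: "'p set"
  assumes Rr: "cring Rr"
    and h_add: "a \<in> carrier Rr \<Longrightarrow> b \<in> carrier Rr \<Longrightarrow> h (a \<oplus>\<^bsub>Rr\<^esub> b) = h a + h b"
    and h_mult: "a \<in> carrier Rr \<Longrightarrow> b \<in> carrier Rr \<Longrightarrow> h (a \<otimes>\<^bsub>Rr\<^esub> b) = h a * h b"
    and h_one: "h \<one>\<^bsub>Rr\<^esub> = 1" and h_zero_iff: "a \<in> carrier Rr \<Longrightarrow> h a = 0 \<longleftrightarrow> a = \<zero>\<^bsub>Rr\<^esub>"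
    and X: "is_submodule (h ` carrier Rr) X"
    and carrier_M: "carrier M = \<pi> ` X"
    and add_M: "x \<in> X \<Longrightarrow> y \<in> X \<Longrightarrow> \<pi> x \<oplus>\<^bsub>M\<^esub> \<pi> y = \<pi> (x + y)"
    and zero_M: "\<zero>\<^bsub>M\<^esub> = \<pi> 0"
    and smult_M: "a \<in> carrier Rr \<Longrightarrow> x \<in> X \<Longrightarrow> a \<odot>\<^bsub>M\<^esub> \<pi> x = \<pi> (h a * x)"
    and kernel: "x \<in> X \<Longrightarrow> \<pi> x = \<pi> 0 \<longleftrightarrow> x \<in> K"
    and K: "is_submodule (h ` carrier Rr) K"
begin

abbreviation ks :: "'p set" where "ks \<equiv> h ` carrier Rr"

lemma XD: "0 \<in> X" "x \<in> X \<Longrightarrow> y \<in> X \<Longrightarrow> x + y \<in> X" "a \<in> carrier Rr \<Longrightarrow> x \<in> X \<Longrightarrow> h a * x \<in> X"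
  using submoduleD[OF X] by auto

lemma h_zero: "h \<zero>\<^bsub>Rr\<^esub> = 0"
proof -
  interpret R: cring Rr by (rule Rr)
  show ?thesis using h_zero_iff[of "\<zero>\<^bsub>Rr\<^esub>"] by simp
qed

lemma h_neg: assumes "a \<in> carrier Rr" shows "h (\<ominus>\<^bsub>Rr\<^esub> a) = - h a"
proof -
  interpret R: cring Rr by (rule Rr)
  have "h a + h (\<ominus>\<^bsub>Rr\<^esub> a) = h (a \<oplus>\<^bsub>Rr\<^esub> \<ominus>\<^bsub>Rr\<^esub> a)" using assms by (intro h_add[symmetric]) simp_all
  also have "\<dots> = 0" using assms h_zero by (simp add: R.r_neg)
  finally show ?thesis by (simp add: add_eq_0_iff2 minus_equation_iff)
qed

lemma ks_subring: "is_subring ks"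
proof -
  interpret R: cring Rr by (rule Rr)
  show ?thesis
    unfolding is_subring_def
  proof (intro conjI ballI)
    show "0 \<in> ks" using h_zero by (intro image_eqI[of _ _ "\<zero>\<^bsub>Rr\<^esub>"]) simp_all
    show "1 \<in> ks" using h_one by (intro image_eqI[of _ _ "\<one>\<^bsub>Rr\<^esub>"]) simp_all
  next
    fix x y assume "x \<in> ks" "y \<in> ks"
    then obtain a b where ab: "a \<in> carrier Rr" "b \<in> carrier Rr" "x = h a" "y = h b" by blast
    show "x + y \<in> ks" using ab by (intro image_eqI[of _ _ "a \<oplus>\<^bsub>Rr\<^esub> b"]) (simp_all add: h_add)
    show "x * y \<in> ks" using ab by (intro image_eqI[of _ _ "a \<otimes>\<^bsub>Rr\<^esub> b"]) (simp_all add: h_mult)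
  next
    fix x assume "x \<in> ks"
    then obtain a where a: "a \<in> carrier Rr" "x = h a" by blast
    then show "- x \<in> ks" by (intro image_eqI[of _ _ "\<ominus>\<^bsub>Rr\<^esub> a"]) (simp_all add: h_neg)
  qed
qed

lemma X_diff: "x \<in> X \<Longrightarrow> y \<in> X \<Longrightarrow> x - y \<in> X"
  by (rule submodule_diff[OF ks_subring X])

lemma X_neg: "x \<in> X \<Longrightarrow> - x \<in> X"
  using X_diff[OF XD(1)] by simp

lemma module_axioms_M: "Module.module Rr M"
proof (rule module_criteria[OF Rr])
  interpret R: cring Rr by (rule Rr)
  show "\<zero>\<^bsub>M\<^esub> \<in> carrier M" using XD(1) by (simp add: carrier_M zero_M)
  show "\<forall>v w. v \<in> carrier M \<and> w \<in> carrier M \<longrightarrow> v \<oplus>\<^bsub>M\<^esub> w \<in> carrier M"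
    using XD(2) by (auto simp: carrier_M add_M)
  show "\<forall>v\<in>carrier M. \<exists>w\<in>carrier M. v \<oplus>\<^bsub>M\<^esub> w = \<zero>\<^bsub>M\<^esub>"
  proof
    fix v assume "v \<in> carrier M"
    then obtain x where x: "x \<in> X" "v = \<pi> x" by (auto simp: carrier_M)
    have "\<pi> (- x) \<in> carrier M" "v \<oplus>\<^bsub>M\<^esub> \<pi> (- x) = \<zero>\<^bsub>M\<^esub>"
      using x X_neg[OF x(1)] by (simp_all add: carrier_M add_M zero_M)
    then show "\<exists>w\<in>carrier M. v \<oplus>\<^bsub>M\<^esub> w = \<zero>\<^bsub>M\<^esub>" by blast
  qed
  show "\<forall>c v. c \<in> carrier Rr \<and> v \<in> carrier M \<longrightarrow> c \<odot>\<^bsub>M\<^esub> v \<in> carrier M"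
    using XD(3) by (auto simp: carrier_M smult_M)
  show "\<forall>v w. v \<in> carrier M \<and> w \<in> carrier M \<longrightarrow> v \<oplus>\<^bsub>M\<^esub> w = w \<oplus>\<^bsub>M\<^esub> v"
    by (auto simp: carrier_M add_M add.commute)
  show "\<forall>v w x. v \<in> carrier M \<and> w \<in> carrier M \<and> x \<in> carrier M \<longrightarrow>
      v \<oplus>\<^bsub>M\<^esub> w \<oplus>\<^bsub>M\<^esub> x = v \<oplus>\<^bsub>M\<^esub> (w \<oplus>\<^bsub>M\<^esub> x)"
    using XD(2) by (auto simp: carrier_M add_M add.assoc)
  show "\<forall>v\<in>carrier M. v \<oplus>\<^bsub>M\<^esub> \<zero>\<^bsub>M\<^esub> = v" using XD(1) by (auto simp: carrier_M zero_M add_M)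
  show "\<forall>a b v. a \<in> carrier Rr \<and> b \<in> carrier Rr \<and> v \<in> carrier M \<longrightarrow>
      (a \<otimes>\<^bsub>Rr\<^esub> b) \<odot>\<^bsub>M\<^esub> v = a \<odot>\<^bsub>M\<^esub> (b \<odot>\<^bsub>M\<^esub> v)"
    using XD(3) by (auto simp: carrier_M smult_M h_mult mult.assoc)
  show "\<forall>v\<in>carrier M. \<one>\<^bsub>Rr\<^esub> \<odot>\<^bsub>M\<^esub> v = v" by (auto simp: carrier_M smult_M h_one)
  show "\<forall>a b v. a \<in> carrier Rr \<and> b \<in> carrier Rr \<and> v \<in> carrier M \<longrightarrow>
      (a \<oplus>\<^bsub>Rr\<^esub> b) \<odot>\<^bsub>M\<^esub> v = a \<odot>\<^bsub>M\<^esub> v \<oplus>\<^bsub>M\<^esub> b \<odot>\<^bsub>M\<^esub> v"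
    using XD(3) by (auto simp: carrier_M smult_M h_add add_M distrib_right)
  show "\<forall>a v w. a \<in> carrier Rr \<and> v \<in> carrier M \<and> w \<in> carrier M \<longrightarrow>
      a \<odot>\<^bsub>M\<^esub> (v \<oplus>\<^bsub>M\<^esub> w) = a \<odot>\<^bsub>M\<^esub> v \<oplus>\<^bsub>M\<^esub> a \<odot>\<^bsub>M\<^esub> w"
    using XD by (auto simp: carrier_M smult_M add_M distrib_left)
qed

sublocale M: Module.module Rr M
  by (rule module_axioms_M)

lemma lincomb_eq:
  assumes "finite B" "\<sigma> \<in> B \<rightarrow> X" "\<And>v. v \<in> B \<Longrightarrow> \<pi> (\<sigma> v) = v" "a \<in> B \<rightarrow> carrier Rr"
  shows "M.lincomb a B = \<pi> (\<Sum>v\<in>B. h (a v) * \<sigma> v)" and "(\<Sum>v\<in>B. h (a v) * \<sigma> v) \<in> X"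
proof -
  have "finsum M (\<lambda>v. a v \<odot>\<^bsub>M\<^esub> v) B = \<pi> (\<Sum>v\<in>B. h (a v) * \<sigma> v) \<and> (\<Sum>v\<in>B. h (a v) * \<sigma> v) \<in> X"
    using assms
  proof (induction B rule: finite_induct)
    case empty
    then show ?case using XD(1) zero_M by simp
  next
    case (insert v B)
    have v: "\<sigma> v \<in> X" "\<pi> (\<sigma> v) = v" "a v \<in> carrier Rr" using insert.prems by auto
    have hv: "h (a v) * \<sigma> v \<in> X" and av: "a v \<odot>\<^bsub>M\<^esub> v = \<pi> (h (a v) * \<sigma> v)"
      using XD(3)[OF v(3,1)] smult_M[OF v(3,1)] v(2) by simp_all
    have B: "finsum M (\<lambda>v. a v \<odot>\<^bsub>M\<^esub> v) B = \<pi> (\<Sum>v\<in>B. h (a v) * \<sigma> v)" "(\<Sum>v\<in>B. h (a v) * \<sigma> v) \<in> X"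
      using insert.IH insert.prems by simp_all
    have sub: "w \<in> carrier M" if "w \<in> insert v B" for w
    proof -
      have "\<sigma> w \<in> X" using insert.prems(1) that by (rule Pi_mem)
      then show ?thesis using insert.prems(2)[OF that] unfolding carrier_M by (intro image_eqI[of _ _ "\<sigma> w"]) simp_all
    qed
    have cl: "(\<lambda>v. a v \<odot>\<^bsub>M\<^esub> v) \<in> B \<rightarrow> carrier M" "a v \<odot>\<^bsub>M\<^esub> v \<in> carrier M"
      using sub insert.prems(3) by (auto intro!: M.smult_closed)
    have "finsum M (\<lambda>v. a v \<odot>\<^bsub>M\<^esub> v) (insert v B) = a v \<odot>\<^bsub>M\<^esub> v \<oplus>\<^bsub>M\<^esub> finsum M (\<lambda>v. a v \<odot>\<^bsub>M\<^esub> v) B"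
      by (rule M.finsum_insert[OF insert.hyps cl])
    then show ?case using insert.hyps by (simp add: B av add_M hv XD(2))
  qed
  then show "M.lincomb a B = \<pi> (\<Sum>v\<in>B. h (a v) * \<sigma> v)" "(\<Sum>v\<in>B. h (a v) * \<sigma> v) \<in> X"
    unfolding M.lincomb_def by blast+
qed

lemma section_exists:
  assumes "B \<subseteq> carrier M" obtains \<sigma> where "\<sigma> \<in> B \<rightarrow> X" "\<And>v. v \<in> B \<Longrightarrow> \<pi> (\<sigma> v) = v"
proof -
  have "\<forall>v\<in>B. \<exists>x. x \<in> X \<and> \<pi> x = v" using assms by (auto simp: carrier_M)
  then obtain \<sigma> where "\<forall>v\<in>B. \<sigma> v \<in> X \<and> \<pi> (\<sigma> v) = v" by (rule bchoice[THEN exE])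
  then show thesis by (intro that[of \<sigma>]) auto
qed

lemma indep_modI_of_lin_indpt:
  assumes B: "finite B" "\<not> M.lin_dep B" and \<sigma>: "\<sigma> \<in> B \<rightarrow> X" "\<And>v. v \<in> B \<Longrightarrow> \<pi> (\<sigma> v) = v"
  shows "indep_mod ks K B \<sigma>"
  unfolding indep_mod_def
proof (intro ballI impI)
  fix f v assume f: "f \<in> B \<rightarrow> ks" "(\<Sum>v\<in>B. f v * \<sigma> v) \<in> K" and v: "v \<in> B"
  have "\<forall>v\<in>B. \<exists>a. a \<in> carrier Rr \<and> f v = h a" using f(1) by blast
  then obtain a where "\<forall>v\<in>B. a v \<in> carrier Rr \<and> f v = h (a v)" by (rule bchoice[THEN exE])
  then have a: "a \<in> B \<rightarrow> carrier Rr" "\<And>v. v \<in> B \<Longrightarrow> f v = h (a v)" by auto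
  have "(\<Sum>v\<in>B. h (a v) * \<sigma> v) \<in> K" using f(2) by (simp add: a(2))
  then have "M.lincomb a B = \<zero>\<^bsub>M\<^esub>"
    using lincomb_eq[OF B(1) \<sigma> a(1)] kernel zero_M by simp
  then have "a v = \<zero>\<^bsub>Rr\<^esub>" using B v a(1) unfolding M.lin_dep_def by blast
  then show "f v = 0" using a(2)[OF v] h_zero by simp
qed

lemma basis_image:
  assumes I: "basis_mod ks K I e X"
  shows "inj_on (\<lambda>i. \<pi> (e i)) I" "\<not> M.lin_dep ((\<lambda>i. \<pi> (e i)) ` I)"
    "M.span ((\<lambda>i. \<pi> (e i)) ` I) = carrier M"
proof -
  have fin: "finite I" and eX: "e \<in> I \<rightarrow> X" and ind: "indep_mod ks K I e" and span: "X \<subseteq> span_mod ks K I e"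
    using I by (simp_all add: basis_mod_def)
  let ?g = "\<lambda>i. \<pi> (e i)"
  let ?B = "?g ` I"
  have ks01: "0 \<in> ks" "1 \<in> ks" "- 1 \<in> ks" using subringD[OF ks_subring] by simp_all
  show inj: "inj_on ?g I"
  proof (rule inj_onI, rule ccontr)
    fix i j assume ij: "i \<in> I" "j \<in> I" "\<pi> (e i) = \<pi> (e j)" "i \<noteq> j"
    have eij: "e i \<in> X" "e j \<in> X" using eX ij by auto
    have "\<pi> (e i + - e j) = \<pi> (e i) \<oplus>\<^bsub>M\<^esub> \<pi> (- e j)" using add_M[OF eij(1) X_neg[OF eij(2)]] by simp
    also have "\<dots> = \<pi> 0" using add_M[OF eij(2) X_neg[OF eij(2)]] by (simp add: ij(3))
    finally have "e i - e j \<in> K" using kernel[OF X_diff[OF eij]] by simp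
    moreover have "(\<Sum>l\<in>I. (if l = i then 1 else if l = j then - 1 else 0) * e l)
        = (\<Sum>l\<in>I. (if l = i then e l else 0) - (if l = j then e l else 0))"
      using ij(4) by (intro sum.cong) auto
    moreover have "\<dots> = e i - e j" using fin ij by (simp add: sum_subtractf sum.delta)
    moreover have "(\<lambda>l. if l = i then 1 else if l = j then - 1 else 0) \<in> I \<rightarrow> ks"
      using ks01 by simp
    ultimately have "(if i = i then 1 else if i = j then - 1 else (0::'p)) = 0"
      using indep_modD[OF ind, of "\<lambda>l. if l = i then 1 else if l = j then - 1 else 0" i] ij(1) by simp
    then show False by simp
  qed
  define \<sigma> where "\<sigma> v = e (inv_into I ?g v)" for v
  have \<sigma>g: "\<sigma> (?g i) = e i" if "i \<in> I" for i using inv_into_f_f[OF inj that] by (simp add: \<sigma>_def)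
  have \<sigma>: "\<sigma> \<in> ?B \<rightarrow> X" "\<And>v. v \<in> ?B \<Longrightarrow> \<pi> (\<sigma> v) = v" using \<sigma>g eX by auto
  have finB: "finite ?B" using fin by simp
  have BM: "?B \<subseteq> carrier M" using eX by (auto simp: carrier_M)
  have sum_eq: "(\<Sum>v\<in>?B. h (a v) * \<sigma> v) = (\<Sum>i\<in>I. h (a (?g i)) * e i)" for a
    using \<sigma>g by (simp add: sum.reindex[OF inj])
  show "\<not> M.lin_dep ?B"
  proof
    assume "M.lin_dep ?B"
    then obtain a v where a: "a \<in> ?B \<rightarrow> carrier Rr" "M.lincomb a ?B = \<zero>\<^bsub>M\<^esub>" "v \<in> ?B" "a v \<noteq> \<zero>\<^bsub>Rr\<^esub>"
      using M.finite_lin_dep[OF finB _ BM] by blast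
    note lc = lincomb_eq[OF finB \<sigma> a(1)]
    have "\<pi> (\<Sum>v\<in>?B. h (a v) * \<sigma> v) = \<pi> 0" using lc(1) a(2) zero_M by (simp only:)
    then have "(\<Sum>v\<in>?B. h (a v) * \<sigma> v) \<in> K" by (simp only: kernel[OF lc(2)])
    then have K0: "(\<Sum>i\<in>I. h (a (?g i)) * e i) \<in> K" unfolding sum_eq .
    have ag: "(\<lambda>i. h (a (?g i))) \<in> I \<rightarrow> ks" using a(1) by auto
    obtain i where i: "i \<in> I" "v = ?g i" using a(3) by blast
    have "h (a v) = 0" using indep_modD[OF ind ag K0 i(1)] i(2) by simp
    moreover have "a v \<in> carrier Rr" using a(1,3) by (rule Pi_mem)
    ultimately show False using h_zero_iff a(4) by simp
  qed
  show "M.span ?B = carrier M"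
  proof
    show "M.span ?B \<subseteq> carrier M" using BM by (rule M.span_is_subset2)
    show "carrier M \<subseteq> M.span ?B"
    proof
      fix m assume "m \<in> carrier M"
      then obtain x where x: "x \<in> X" "m = \<pi> x" by (auto simp: carrier_M)
      obtain f where f: "f \<in> I \<rightarrow> ks" "x - (\<Sum>i\<in>I. f i * e i) \<in> K"
        using subsetD[OF span x(1)] by (rule span_modE)
      have "\<forall>i\<in>I. \<exists>c. c \<in> carrier Rr \<and> f i = h c" using f(1) by blast
      then obtain c where "\<forall>i\<in>I. c i \<in> carrier Rr \<and> f i = h (c i)" by (rule bchoice[THEN exE])
      then have c: "\<And>i. i \<in> I \<Longrightarrow> c i \<in> carrier Rr" "\<And>i. i \<in> I \<Longrightarrow> f i = h (c i)" by auto
      define a where "a v = c (inv_into I ?g v)" for v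
      have ag: "a (?g i) = c i" if "i \<in> I" for i using inv_into_f_f[OF inj that] by (simp add: a_def)
      have a: "a \<in> ?B \<rightarrow> carrier Rr" using ag c(1) by auto
      let ?s = "\<Sum>v\<in>?B. h (a v) * \<sigma> v"
      note lc = lincomb_eq[OF finB \<sigma> a]
      have "?s = (\<Sum>i\<in>I. f i * e i)" unfolding sum_eq using ag c(2) by (intro sum.cong) simp_all
      then have "x - ?s \<in> K" using f(2) by simp
      then have "\<pi> (x - ?s) = \<pi> 0" using kernel[OF X_diff[OF x(1) lc(2)]] by simp
      then have "\<pi> (x - ?s) \<oplus>\<^bsub>M\<^esub> \<pi> ?s = \<pi> 0 \<oplus>\<^bsub>M\<^esub> \<pi> ?s" by simp
      then have "\<pi> x = \<pi> ?s"
        using add_M[OF X_diff[OF x(1) lc(2)] lc(2)] add_M[OF XD(1) lc(2)] by simp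
      then have "m = M.lincomb a ?B" using x(2) lc(1) by simp
      then show "m \<in> M.span ?B" using finB a unfolding M.span_def by blast
    qed
  qed
qed

text \<open>The image of the basis attains the supremum, and liftings of independent sets are bounded by it.\<close>

lemma module_rank_eq:
  assumes I: "basis_mod ks K I e X" shows "module_rank Rr M = card I"
proof -
  note bas = basis_image[OF I]
  have fin: "finite I" and eX: "e \<in> I \<rightarrow> X" and span: "X \<subseteq> span_mod ks K I e"
    using I by (simp_all add: basis_mod_def)
  let ?B = "(\<lambda>i. \<pi> (e i)) ` I"
  let ?C = "{card B |B. finite B \<and> B \<subseteq> carrier M \<and> \<not> M.lin_dep B}"
  have "?B \<subseteq> carrier M" using eX by (auto simp: carrier_M)
  then have "finite ?B \<and> ?B \<subseteq> carrier M \<and> \<not> M.lin_dep ?B" using fin bas(2) by simp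
  moreover have "card I = card ?B" using card_image[OF bas(1)] by simp
  ultimately have mem: "card I \<in> ?C" by blast
  have le: "c \<le> card I" if "c \<in> ?C" for c
  proof -
    obtain B where B: "c = card B" "finite B" "B \<subseteq> carrier M" "\<not> M.lin_dep B" using \<open>c \<in> ?C\<close> by blast
    obtain \<sigma> where \<sigma>: "\<sigma> \<in> B \<rightarrow> X" "\<And>v. v \<in> B \<Longrightarrow> \<pi> (\<sigma> v) = v" using section_exists[OF B(3)] by blast
    have "\<sigma> \<in> B \<rightarrow> span_mod ks K I e" using \<sigma>(1) span by auto
    then show ?thesis
      unfolding B(1) using indep_modI_of_lin_indpt[OF B(2,4) \<sigma>]
      by (rule indep_card_le_span_card[OF ks_subring K fin B(2)])
  qed
  show ?thesis unfolding module_rank_def using cSup_eq_maximum[OF mem le] .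
qed

end

section \<open>Hilbert series and freeness of rings of invariants\<close>

lemma invariant_ring_sel [simp]:
  "carrier (invariant_ring n \<Phi>) = invariants n \<Phi>" "mult (invariant_ring n \<Phi>) = (*)"
  "one (invariant_ring n \<Phi>) = 1" "zero (invariant_ring n \<Phi>) = 0" "add (invariant_ring n \<Phi>) = (+)"
  by (simp_all add: invariant_ring_def mv_ring_def invariants_def polys_def)

lemma cring_invariant_ring:
  assumes "graded_subring (invariants n \<Phi>)" shows "cring (invariant_ring n \<Phi>)"
proof (rule cringI)
  note D = subringD[OF graded_subringD(1)[OF assms]]
  show "abelian_group (invariant_ring n \<Phi>)"
  proof (rule abelian_groupI)
    fix x assume "x \<in> carrier (invariant_ring n \<Phi>)"
    then show "\<exists>y\<in>carrier (invariant_ring n \<Phi>). y \<oplus>\<^bsub>invariant_ring n \<Phi>\<^esub> x = \<zero>\<^bsub>invariant_ring n \<Phi>\<^esub>"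
      using D(5)[of x] by (intro bexI[of _ "- x"]) simp_all
  qed (simp_all add: D(1,3) add.assoc add.commute)
  show "comm_monoid (invariant_ring n \<Phi>)"
    by (rule comm_monoidI) (simp_all add: D(2,4) mult.assoc mult.commute)
qed (simp add: distrib_right)

lemma a_inv_invariant_ring:
  assumes "graded_subring (invariants n \<Phi>)" "x \<in> invariants n \<Phi>"
  shows "\<ominus>\<^bsub>invariant_ring n \<Phi>\<^esub> x = - x"
proof -
  interpret cring "invariant_ring n \<Phi>" by (rule cring_invariant_ring[OF assms(1)])
  show ?thesis
    using minus_equality[of "- x" x] assms subringD(5)[OF graded_subringD(1)[OF assms(1)]] by simp
qed

lemma homogeneous_part_invariant_ring: "homogeneous_part (invariant_ring n \<Phi>) d = hpart (invariants n \<Phi>) d"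
  by (simp add: homogeneous_part_def hpart_def)

lemma consts_scalars:
  shows "cring (class_ring :: 'a::idom ring)"
    "\<lbrakk>a \<in> carrier class_ring; b \<in> carrier class_ring\<rbrakk> \<Longrightarrow> mv_const (a \<oplus>\<^bsub>class_ring\<^esub> b) = mv_const a + mv_const (b::'a)"
    "\<lbrakk>a \<in> carrier class_ring; b \<in> carrier class_ring\<rbrakk> \<Longrightarrow> mv_const (a \<otimes>\<^bsub>class_ring\<^esub> b) = mv_const a * mv_const (b::'a)"
    "mv_const (\<one>\<^bsub>class_ring\<^esub> :: 'a) = 1"
    "(mv_const a = 0) = (a = (\<zero>\<^bsub>class_ring\<^esub> :: 'a))"
  using class_cring.cring_axioms by (simp_all add: mv_const_add mv_const_mult)

lemma Hilb_ring_invariant_ring: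
  fixes \<Phi> :: "('a::idom mvpoly \<Rightarrow> 'a mvpoly) set"
  assumes k: "principal_subring (range (mv_const :: 'a \<Rightarrow> 'a mvpoly))"
    and A: "graded_subring (invariants n \<Phi>)"
  shows "Hilb_ring (invariant_ring n \<Phi>) = hseries (invariants n \<Phi>)"
proof (rule fps_ext)
  fix d
  let ?A = "invariants n \<Phi>"
  let ?M = "(module_via mv_const (invariant_ring n \<Phi>))\<lparr>carrier := homogeneous_part (invariant_ring n \<Phi>) d\<rparr>"
  have An: "?A \<subseteq> polys n" by (auto simp: invariants_def)
  obtain B where B: "basis_mod (range mv_const) {0} B (\<lambda>b. b) (hpart ?A d)" "card B = hdim ?A d"
    using hpart_basis_exists[OF k A An, of d] by blast
  interpret presented_module "class_ring :: 'a ring" ?M mv_const "\<lambda>p. p" "hpart ?A d" "{0}"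
  proof (rule presented_module.intro)
    show "is_submodule (mv_const ` carrier (class_ring :: 'a ring)) (hpart ?A d)"
      using hpart_submodule[OF A] by simp
  qed (use consts_scalars[where ?'a = 'a] in
      \<open>simp_all add: module_via_def homogeneous_part_invariant_ring submodule_zero\<close>)
  have "module_rank (class_ring :: 'a ring) ?M = hdim ?A d"
    using module_rank_eq[of B "\<lambda>b. b"] B by simp
  then show "fps_nth (Hilb_ring (invariant_ring n \<Phi>)) d = fps_nth (hseries ?A) d"
    by (simp add: Hilb_ring_def Hilb_def hseries_def)
qed

lemma free_module_invariant_ring:
  fixes \<Phi> \<Psi> :: "('a::idom mvpoly \<Rightarrow> 'a mvpoly) set"
  assumes A: "graded_subring (invariants n \<Phi>)" and S: "graded_subring (invariants n \<Psi>)"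
    and AS: "invariants n \<Phi> \<subseteq> invariants n \<Psi>"
    and bas: "basis_mod (invariants n \<Phi>) {0} I e (invariants n \<Psi>)"
  shows "free_module (invariant_ring n \<Phi>) (module_via (\<lambda>r. r) (invariant_ring n \<Psi>))"
proof -
  let ?M = "module_via (\<lambda>r. r) (invariant_ring n \<Psi>)"
  interpret presented_module "invariant_ring n \<Phi>" ?M "\<lambda>r. r" "\<lambda>p. p" "invariants n \<Psi>" "{0}"
  proof (rule presented_module.intro)
    show "cring (invariant_ring n \<Phi>)" by (rule cring_invariant_ring[OF A])
    show "is_submodule ((\<lambda>r. r) ` carrier (invariant_ring n \<Phi>)) (invariants n \<Psi>)"
      using subring_submodule[OF graded_subringD(1)[OF S] AS] by simp
  qed (simp_all add: module_via_def submodule_zero)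
  have bas': "basis_mod ((\<lambda>r. r) ` carrier (invariant_ring n \<Phi>)) {0} I e (invariants n \<Psi>)"
    using bas by simp
  have "(\<lambda>i. e i) ` I \<subseteq> carrier ?M" using bas by (auto simp: basis_mod_def module_via_def)
  then show ?thesis
    unfolding free_module_def using module_axioms_M basis_image(2,3)[OF bas'] by blast
qed

lemma positive_part_eq_aug: "positive_part (invariant_ring n \<Phi>) = aug (invariants n \<Phi>)"
  by (simp add: positive_part_def aug_def hcomp_zero)

lemma genideal_eq_aug_ideal:
  fixes \<Phi> \<Psi> :: "('a::idom mvpoly \<Rightarrow> 'a mvpoly) set"
  assumes A: "graded_subring (invariants n \<Phi>)" and S: "graded_subring (invariants n \<Psi>)"
    and AS: "invariants n \<Phi> \<subseteq> invariants n \<Psi>"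
  defines "I \<equiv> aug_ideal (invariants n \<Phi>) (invariants n \<Psi>)"
  shows "ideal I (invariant_ring n \<Psi>)"
    "genideal (invariant_ring n \<Psi>) (positive_part (invariant_ring n \<Phi>)) = I"
proof -
  let ?S = "invariants n \<Psi>" and ?R = "invariant_ring n \<Psi>"
  note SD = subringD[OF graded_subringD(1)[OF S]]
  note Isub = aug_ideal_submodule[of ?S "invariants n \<Phi>", folded I_def]
  note ID = submoduleD[OF Isub]
  interpret R: cring ?R by (rule cring_invariant_ring[OF S])
  have IS: "I \<subseteq> ?S"
    unfolding I_def using AS SD
    by (intro aug_ideal_subset) (auto simp: is_submodule_def aug_def)
  show ideal: "ideal I ?R"
  proof (rule idealI[OF R.ring_axioms])
    show "subgroup I (add_monoid ?R)"
    proof (rule subgroup.intro)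
      fix x assume x: "x \<in> I"
      have "inv\<^bsub>add_monoid ?R\<^esub> x = - x"
        using a_inv_invariant_ring[OF S] x IS unfolding a_inv_def by auto
      moreover have "- x \<in> I" using ID(3)[OF SD(5)[OF SD(2)] x] by simp
      ultimately show "inv\<^bsub>add_monoid ?R\<^esub> x \<in> I" by simp
    qed (use IS ID in auto)
    show "x \<otimes>\<^bsub>?R\<^esub> a \<in> I" "a \<otimes>\<^bsub>?R\<^esub> x \<in> I" if "a \<in> I" "x \<in> carrier ?R" for a x
      using ID(3)[of x a] that by (simp_all add: mult.commute)
  qed
  show "genideal ?R (positive_part (invariant_ring n \<Phi>)) = I"
  proof
    show "genideal ?R (positive_part (invariant_ring n \<Phi>)) \<subseteq> I"
      unfolding genideal_def positive_part_eq_aug using ideal aug_subset_aug_ideal[of "invariants n \<Phi>" ?S]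
      by (intro Inter_lower) (simp add: I_def)
    show "I \<subseteq> genideal ?R (positive_part (invariant_ring n \<Phi>))"
      unfolding genideal_def positive_part_eq_aug
    proof (rule Inter_greatest)
      fix J assume "J \<in> {I. ideal I ?R \<and> aug (invariants n \<Phi>) \<subseteq> I}"
      then have J: "ideal J ?R" "aug (invariants n \<Phi>) \<subseteq> J" by auto
      interpret J: ideal J ?R by (rule J(1))
      have "is_submodule ?S J"
        unfolding is_submodule_def
        using J.zero_closed J.a_closed J.I_l_closed by simp
      then show "I \<subseteq> J" unfolding I_def using J(2) by (rule aug_ideal_subset)
    qed
  qed
qed

lemma Hilb_quotient_invariant_ring:
  fixes \<Phi> \<Psi> :: "('a::idom mvpoly \<Rightarrow> 'a mvpoly) set"
  assumes A: "graded_subring (invariants n \<Phi>)" and S: "graded_subring (invariants n \<Psi>)"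
    and AS: "invariants n \<Phi> \<subseteq> invariants n \<Psi>"
    and Q: "\<And>d. basis_mod (range mv_const) (aug_ideal (invariants n \<Phi>) (invariants n \<Psi>)) (Q d) (\<lambda>b. b)
      (hpart (invariants n \<Psi>) d)"
  shows "Hilb_quotient (invariant_ring n \<Psi>) (invariant_ring n \<Phi>) = Abs_fps (\<lambda>d. of_nat (card (Q d)))"
proof (rule fps_ext)
  fix d
  let ?S = "invariants n \<Psi>" and ?R = "invariant_ring n \<Psi>"
  define I where "I = aug_ideal (invariants n \<Phi>) ?S"
  define \<pi> where "\<pi> p = I +>\<^bsub>?R\<^esub> p" for p
  let ?M = "(module_via (\<lambda>c. \<pi> (mv_const c)) (?R Quot I))\<lparr>carrier := \<pi> ` homogeneous_part ?R d\<rparr>"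
  note SD = subringD[OF graded_subringD(1)[OF S]]
  note gen = genideal_eq_aug_ideal[OF A S AS, folded I_def]
  interpret R: cring ?R by (rule cring_invariant_ring[OF S])
  interpret I: ideal I ?R by (rule gen(1))
  have hom: "\<pi> \<in> Ring.ring_hom ?R (?R Quot I)"
    using I.rcos_ring_hom unfolding \<pi>_def .
  have hS: "x \<in> ?S" if "x \<in> hpart ?S d" for x using that by (simp add: hpart_def)
  have kS: "mv_const c \<in> ?S" for c by (rule graded_subringD(2)[OF S])
  have \<pi>0: "\<pi> 0 = I" unfolding \<pi>_def using R.a_coset_add_zero[of I] I.a_subset by simp
  have kernel: "\<pi> x = \<pi> 0 \<longleftrightarrow> x \<in> I" if "x \<in> hpart ?S d" for x
    unfolding \<pi>0 unfolding \<pi>_def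
    using R.a_coset_join1[of I x] R.a_coset_join2[of x I] hS[OF that] I.a_subgroup by auto
  interpret presented_module "class_ring :: 'a ring" ?M mv_const \<pi> "hpart ?S d" I
  proof (rule presented_module.intro)
    show "is_submodule (mv_const ` carrier (class_ring :: 'a ring)) (hpart ?S d)"
      using hpart_submodule[OF S] by simp
    have "range mv_const \<subseteq> ?S" using kS by blast
    then show "is_submodule (mv_const ` carrier (class_ring :: 'a ring)) I"
      using submodule_subset[OF aug_ideal_submodule, of "range mv_const" ?S "invariants n \<Phi>"]
      by (simp add: I_def)
    show "\<pi> x \<oplus>\<^bsub>?M\<^esub> \<pi> y = \<pi> (x + y)" if "x \<in> hpart ?S d" "y \<in> hpart ?S d" for x y
      using ring_hom_add[OF hom, of x y] hS[OF that(1)] hS[OF that(2)] by (simp add: module_via_def)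
    show "a \<odot>\<^bsub>?M\<^esub> \<pi> x = \<pi> (mv_const a * x)" if "x \<in> hpart ?S d" for a x
      using ring_hom_mult[OF hom, of "mv_const a" x] hS[OF that] kS by (simp add: module_via_def)
    show "\<zero>\<^bsub>?M\<^esub> = \<pi> 0" by (simp add: module_via_def \<pi>0 FactRing_def)
    show "carrier ?M = \<pi> ` hpart ?S d" by (simp add: homogeneous_part_invariant_ring)
  qed (use consts_scalars[where ?'a = 'a] kernel in simp_all)
  have "module_rank (class_ring :: 'a ring) ?M = card (Q d)"
    using module_rank_eq[of "Q d" "\<lambda>b. b"] Q[of d] by (simp add: I_def)
  then show "fps_nth (Hilb_quotient ?R (invariant_ring n \<Phi>)) d = fps_nth (Abs_fps (\<lambda>d. of_nat (card (Q d)))) d"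
    unfolding Hilb_quotient_def Let_def gen(2) by (simp add: Hilb_def \<pi>_def)
qed

lemma hdim_zero:
  fixes A :: "'a::idom mvpoly set"
  assumes k: "principal_subring (range (mv_const :: 'a \<Rightarrow> 'a mvpoly))"
    and A: "graded_subring A" "A \<subseteq> polys n"
  shows "hdim A 0 = 1"
proof -
  have "p \<in> range mv_const" if "p \<in> hpart A 0" for p
  proof -
    have "p = mv_const (Poly_Mapping.lookup p 0)"
      using that hcomp_of_homogeneous[of 0 p 0] by (simp add: hpart_def hcomp_zero)
    then show ?thesis by (rule range_eqI)
  qed
  then have "basis_mod (range mv_const) {0} {()} (\<lambda>_. 1) (hpart A 0)"
    using subringD(2)[OF graded_subringD(1)[OF A(1)]]
    by (auto simp: basis_mod_def indep_mod_def span_mod_def hpart_def)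
  then show ?thesis using hdim_eq[OF k A] by fastforce
qed

text \<open>The outcome for both kinds of groups, given monomial bases for the group and its subgroup. All three
claims concern the family \<open>C\<close> of \<open>free_tower\<close>: counted by degrees it gives the series \<open>c\<close> below.\<close>

theorem multinomial_quotient:
  fixes \<Phi> \<Psi> :: "('a::idom mvpoly \<Rightarrow> 'a mvpoly) set"
  assumes k: "principal_subring (range (mv_const :: 'a \<Rightarrow> 'a mvpoly))"
    and \<Phi>: "\<And>\<phi>. \<phi> \<in> \<Phi> \<Longrightarrow> graded_hom \<phi>" and sub: "\<Psi> \<subseteq> \<Phi>"
    and E: "hbasis (invariants n \<Phi>) (exponents n d) (pow_prod n y) (\<lambda>a. \<Sum>j<n. a j) (polys n)"
    and F: "hbasis (invariants n \<Psi>) (exponents n d') (pow_prod n y') (\<lambda>a. \<Sum>j<n. a j) (polys n)"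
    and d': "\<And>j. j < n \<Longrightarrow> 0 < d' j"
  defines "m \<equiv> (\<Prod>j<n. 1 - fps_X ^ d j) / (\<Prod>j<n. 1 - fps_X ^ d' j) :: rat fps"
  shows "m = Hilb_ring (invariant_ring n \<Psi>) / Hilb_ring (invariant_ring n \<Phi>)"
    "free_module (invariant_ring n \<Phi>) (module_via (\<lambda>r. r) (invariant_ring n \<Psi>))"
    "m = Hilb_quotient (invariant_ring n \<Psi>) (invariant_ring n \<Phi>)"
proof -
  let ?A = "invariants n \<Phi>" and ?S = "invariants n \<Psi>"
  have A: "graded_subring ?A" and S: "graded_subring ?S"
    using \<Phi> sub by (auto intro!: invariants_graded_subring)
  have AS: "?A \<subseteq> ?S" and SR: "?S \<subseteq> polys n" and AR: "?A \<subseteq> polys n"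
    using sub by (auto simp: invariants_def)
  \<comment> \<open>The exponent tuple of the monomial \<open>1\<close>; it is admissible because all \<open>d' j\<close> are positive.\<close>
  define z where "z = (\<lambda>j\<in>{..<n}. 0 :: nat)"
  have z: "z \<in> exponents n d'" "pow_prod n y' z = 1"
    using d' by (auto simp: z_def exponents_def pow_prod_def)
  interpret T: free_tower n ?A ?S "exponents n d" "pow_prod n y" "\<lambda>a. \<Sum>j<n. a j"
    "exponents n d'" "pow_prod n y'" "\<lambda>a. \<Sum>j<n. a j" z
    by (rule free_tower.intro) (fact k A S AS SR E F z)+
  define c where "c = (\<Sum>x\<in>T.C. fps_X ^ fst x :: rat fps)"
  define sE where "sE = (\<Sum>a\<in>exponents n d. fps_X ^ (\<Sum>j<n. a j) :: rat fps)"
  define sF where "sF = (\<Sum>a\<in>exponents n d'. fps_X ^ (\<Sum>j<n. a j) :: rat fps)"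
  have polys: "graded_subring (polys n :: 'a mvpoly set)" by (rule polys_graded_subring)
  have hA: "fps_nth (hseries ?A) 0 = 1" by (simp add: hseries_def hdim_zero[OF k A AR])
  have hS: "hseries ?S = hseries ?A * c"
    unfolding c_def by (rule hseries_free_extension[OF k A AS S SR T.C_hbasis])
  have "hseries ?A * sE = hseries (polys n :: 'a mvpoly set)" "hseries ?S * sF = hseries (polys n :: 'a mvpoly set)"
    unfolding sE_def sF_def
    using hseries_free_extension[OF k A AR polys order.refl E]
      hseries_free_extension[OF k S SR polys order.refl F] by simp_all
  then have "hseries ?A * sE = hseries ?A * (c * sF)" unfolding hS by (simp add: mult.assoc)
  moreover have "hseries ?A \<noteq> 0" using hA by auto
  ultimately have "sE = c * sF" by simp
  \<comment> \<open>The Hilbert series of the polynomial ring cancels.\<close>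
  then have "sE * (1 - fps_X) ^ n = c * (sF * (1 - fps_X) ^ n)" by (simp add: mult.assoc)
  then have prods: "(\<Prod>j<n. 1 - fps_X ^ d j) = c * (\<Prod>j<n. 1 - fps_X ^ d' j)"
    unfolding sE_def sF_def exponents_series .
  have "1 - fps_X ^ d' j \<noteq> (0 :: rat fps)" if "j < n" for j
  proof
    assume "1 - fps_X ^ d' j = (0 :: rat fps)"
    then have "fps_nth (1 - fps_X ^ d' j :: rat fps) 0 = 0" by simp
    then show False using d'[OF that] by (simp add: fps_X_power_nth)
  qed
  then have "(\<Prod>j<n. 1 - fps_X ^ d' j :: rat fps) \<noteq> 0" by simp
  then have m: "m = c" unfolding m_def prods by simp
  show "m = Hilb_ring (invariant_ring n \<Psi>) / Hilb_ring (invariant_ring n \<Phi>)"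
    unfolding Hilb_ring_invariant_ring[OF k A] Hilb_ring_invariant_ring[OF k S] hS m
    using \<open>hseries ?A \<noteq> 0\<close> by simp
  show "free_module (invariant_ring n \<Phi>) (module_via (\<lambda>r. r) (invariant_ring n \<Psi>))"
    using T.C_hbasis unfolding hbasis_def by (intro free_module_invariant_ring[OF A S AS]) blast
  have "fps_nth c i = of_nat (card (T.Q i))" for i
  proof -
    have "fps_nth c i = (\<Sum>x\<in>T.C. if i = fst x then 1 else 0)"
      unfolding c_def by (simp add: fps_sum_nth fps_X_power_nth)
    also have "\<dots> = (\<Sum>j\<le>T.D. \<Sum>x\<in>T.Q j. if i = j then 1 else 0)"
      by (subst sum.Sigma) (simp_all add: T.Q_basis(1) case_prod_beta)
    also have "\<dots> = (\<Sum>j\<le>T.D. if i = j then of_nat (card (T.Q j)) else 0)"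
      by (intro sum.cong) auto
    also have "\<dots> = of_nat (card (T.Q i))"
      using T.Q_empty[of i] by (auto simp: sum.delta')
    finally show ?thesis .
  qed
  then have "c = Abs_fps (\<lambda>i. of_nat (card (T.Q i)))" by (intro fps_ext) simp
  then show "m = Hilb_quotient (invariant_ring n \<Psi>) (invariant_ring n \<Phi>)"
    unfolding m using Hilb_quotient_invariant_ring[OF A S AS T.Q(2)] by simp
qed

section \<open>Blocks of a composition\<close>

text \<open>The number, counted from 1, of the part of \<open>\<alpha>\<close> that contains the position \<open>j\<close>, where positions
are counted from 0.\<close>

definition block :: "nat list \<Rightarrow> nat \<Rightarrow> nat" where
  "block \<alpha> j = (LEAST s. j < part_sum \<alpha> s)"

lemma part_sum_0 [simp]: "part_sum \<alpha> 0 = 0"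
  by (simp add: part_sum_def)

lemma part_sum_length [simp]: "part_sum \<alpha> (length \<alpha>) = sum_list \<alpha>"
  by (simp add: part_sum_def)

lemma part_sum_Suc: "s < length \<alpha> \<Longrightarrow> part_sum \<alpha> (Suc s) = part_sum \<alpha> s + \<alpha> ! s"
  by (simp add: part_sum_def take_Suc_conv_app_nth)

lemma part_sum_mono: assumes "s \<le> t" shows "part_sum \<alpha> s \<le> part_sum \<alpha> t"
proof -
  have "take t \<alpha> = take s \<alpha> @ take (t - s) (drop s \<alpha>)"
    using assms by (metis le_add_diff_inverse take_add)
  then show ?thesis by (simp add: part_sum_def)
qed

lemma block_eqI:
  assumes "0 < s" "part_sum \<alpha> (s - 1) \<le> j" "j < part_sum \<alpha> s" shows "block \<alpha> j = s"
  unfolding block_def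
proof (rule Least_equality)
  fix t assume "j < part_sum \<alpha> t"
  then have "\<not> part_sum \<alpha> t \<le> part_sum \<alpha> (s - 1)" using assms(2) by simp
  then have "\<not> t \<le> s - 1" using part_sum_mono by blast
  then show "s \<le> t" by simp
qed (rule assms(3))

lemma block:
  assumes "j < sum_list \<alpha>"
  shows "0 < block \<alpha> j" "block \<alpha> j \<le> length \<alpha>" "j < part_sum \<alpha> (block \<alpha> j)"
    "part_sum \<alpha> (block \<alpha> j - 1) \<le> j"
proof -
  have ex: "j < part_sum \<alpha> (length \<alpha>)" using assms by simp
  show lt: "j < part_sum \<alpha> (block \<alpha> j)" unfolding block_def by (rule LeastI[where P = "\<lambda>s. j < part_sum \<alpha> s", OF ex])
  show "block \<alpha> j \<le> length \<alpha>" unfolding block_def by (rule Least_le[where P = "\<lambda>s. j < part_sum \<alpha> s", OF ex])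
  show pos: "0 < block \<alpha> j" using lt by (cases "block \<alpha> j") simp_all
  have "\<not> j < part_sum \<alpha> (block \<alpha> j - 1)"
    unfolding block_def by (rule not_less_Least) (use pos in \<open>simp add: block_def\<close>)
  then show "part_sum \<alpha> (block \<alpha> j - 1) \<le> j" by simp
qed

lemma block_le_iff:
  assumes "j < sum_list \<alpha>" shows "block \<alpha> j \<le> s \<longleftrightarrow> j < part_sum \<alpha> s"
proof
  assume "block \<alpha> j \<le> s"
  then show "j < part_sum \<alpha> s" using block(3)[OF assms] part_sum_mono by (meson less_le_trans)
next
  assume "j < part_sum \<alpha> s"
  then show "block \<alpha> j \<le> s" unfolding block_def by (rule Least_le)
qed

text \<open>The \<open>i\<close>-th position from the end of part \<open>s\<close> is \<open>part_sum \<alpha> s - i\<close>, which turns a product over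
positions into the shape of the denominators of the multinomials.\<close>

lemma prod_blocks:
  fixes F :: "nat \<Rightarrow> nat \<Rightarrow> 'b::comm_monoid_mult"
  shows "(\<Prod>j<sum_list \<alpha>. F (block \<alpha> j) j)
    = (\<Prod>s=1..length \<alpha>. \<Prod>i=1..\<alpha> ! (s - 1). F s (part_sum \<alpha> s - i))"
proof -
  have "(\<Prod>j<part_sum \<alpha> L. F (block \<alpha> j) j)
      = (\<Prod>s=1..L. \<Prod>i=1..\<alpha> ! (s - 1). F s (part_sum \<alpha> s - i))" if "L \<le> length \<alpha>" for L
    using that
  proof (induction L)
    case 0
    then show ?case by simp
  next
    case (Suc L)
    then have ps: "part_sum \<alpha> (Suc L) = part_sum \<alpha> L + \<alpha> ! L" by (intro part_sum_Suc) simp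
    have split: "{..<part_sum \<alpha> (Suc L)} = {..<part_sum \<alpha> L} \<union> {part_sum \<alpha> L..<part_sum \<alpha> (Suc L)}"
      by (auto simp: ps)
    have "(\<Prod>j<part_sum \<alpha> (Suc L). F (block \<alpha> j) j) = (\<Prod>j<part_sum \<alpha> L. F (block \<alpha> j) j) *
        (\<Prod>j=part_sum \<alpha> L..<part_sum \<alpha> (Suc L). F (block \<alpha> j) j)"
      by (subst split) (rule prod.union_disjoint, auto)
    also have "(\<Prod>j=part_sum \<alpha> L..<part_sum \<alpha> (Suc L). F (block \<alpha> j) j)
        = (\<Prod>j=part_sum \<alpha> L..<part_sum \<alpha> (Suc L). F (Suc L) j)"
      by (intro prod.cong refl arg_cong2[of _ _ _ _ F] block_eqI) simp_all
    also have "\<dots> = (\<Prod>i=1..\<alpha> ! L. F (Suc L) (part_sum \<alpha> (Suc L) - i))"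
      by (rule prod.reindex_bij_witness[of _ "\<lambda>i. part_sum \<alpha> (Suc L) - i" "\<lambda>j. part_sum \<alpha> (Suc L) - j"])
        (auto simp: ps)
    finally show ?case using Suc by simp
  qed
  from this[OF order.refl] show ?thesis by simp
qed

lemma prod_single_block:
  fixes F :: "nat \<Rightarrow> 'b::comm_monoid_mult"
  shows "(\<Prod>j<n. F j) = (\<Prod>i=1..n. F (n - i))"
  by (rule prod.reindex_bij_witness[of _ "\<lambda>i. n - i" "\<lambda>j. n - j"]) auto

section \<open>Young subgroups\<close>

lemma perm_action_graded_hom: "graded_hom (perm_action w)"
  unfolding perm_action_def by (rule mv_subst_graded_hom) simp

lemma perm_action_var [simp]: "perm_action w (mv_var i) = mv_var (w i)"
  by (simp add: perm_action_def)

lemma mv_var_eq_iff: "(mv_var i :: 'a::comm_ring_1 mvpoly) = mv_var j \<longleftrightarrow> i = j"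
proof
  assume "(mv_var i :: 'a mvpoly) = mv_var j"
  then have "Poly_Mapping.keys (mv_var i :: 'a mvpoly) = Poly_Mapping.keys (mv_var j :: 'a mvpoly)" by simp
  then have "Poly_Mapping.keys (Poly_Mapping.single i (Suc 0)) = Poly_Mapping.keys (Poly_Mapping.single j (Suc 0))"
    by (simp add: mv_var_def)
  then show "i = j" by simp
qed simp

text \<open>\<open>B j\<close> is the block of the position \<open>j\<close>. The roots are the variables of the block, and those already
used are the values at the earlier positions of the block; a choice of distinct values within each block is a
permutation that preserves the blocks.\<close>

lemma young_basis:
  fixes B :: "nat \<Rightarrow> nat set"
  assumes B: "\<And>j. j < n \<Longrightarrow> j \<in> B j" "\<And>j. j < n \<Longrightarrow> B j \<subseteq> {..<n}" "\<And>i j. j < n \<Longrightarrow> i \<in> B j \<Longrightarrow> B i = B j"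
  defines "H \<equiv> {w. w permutes {..<n} \<and> (\<forall>j<n. w ` B j = B j)}"
  shows "hbasis (invariants n (perm_action ` H)) (exponents n (\<lambda>j. card (B j - {..<j})))
    (pow_prod n (mv_var :: nat \<Rightarrow> 'a::idom mvpoly)) (\<lambda>a. \<Sum>j<n. a j) (polys n)"
proof -
  let ?x = "mv_var :: nat \<Rightarrow> 'a mvpoly"
  let ?\<Omega> = "\<lambda>j. ?x ` B j" and ?\<Delta> = "\<lambda>v j. v ` (B j \<inter> {..<j}) :: 'a mvpoly set"
  have inj: "inj ?x" by (rule injI) (simp add: mv_var_eq_iff)
  have fin: "finite (B j)" if "j < n" for j using B(2)[OF that] by (rule finite_subset) simp
  have diff: "?\<Omega> j - ?\<Delta> ?x j = ?x ` (B j - {..<j})" for j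
    using image_set_diff[OF inj, of "B j" "B j \<inter> {..<j}"] by (simp add: Diff_Int)
  show ?thesis
  proof (rule monomial_basis_over_invariants[where \<Omega> = ?\<Omega> and \<Delta> = ?\<Delta>])
    show "graded_hom \<phi>" if "\<phi> \<in> perm_action ` H" for \<phi> :: "'a mvpoly \<Rightarrow> 'a mvpoly"
      using that perm_action_graded_hom by blast
    show "?x j \<in> polys n" if "j < n" for j using that by (rule mv_var_in_polys)
    show "polys n \<subseteq> T" if "is_subring T" "range mv_const \<subseteq> T" "\<And>j. j < n \<Longrightarrow> ?x j \<in> T" for T
      using that by (rule polys_generated)
    show "finite (?\<Omega> j)" if "j < n" for j using fin[OF that] by simp
    show "?\<Omega> j \<subseteq> polys n" if "j < n" for j
      using B(2)[OF that] mv_var_in_polys by (auto simp: subset_iff)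
    show "\<phi> ` ?\<Omega> j = ?\<Omega> j" if j: "j < n" and \<phi>: "\<phi> \<in> perm_action ` H" for j \<phi>
    proof -
      obtain w where w: "w \<in> H" "\<phi> = perm_action w" using \<phi> by blast
      have "\<phi> ` ?\<Omega> j = ?x ` (w ` B j)" by (simp add: w(2) image_image)
      then show ?thesis using w(1) j by (simp add: H_def)
    qed
    show "?\<Delta> v j = ?\<Delta> w j" if "\<And>i. i < j \<Longrightarrow> v i = w i" for v w j
      using that by (intro image_cong) simp_all
    show "?\<Delta> ?x j \<subseteq> T" if "\<And>i. i < j \<Longrightarrow> ?x i \<in> T" for T j using that by auto
    show "?\<Delta> ?x j \<subseteq> ?\<Omega> j" for j by blast
    show "?x j \<in> ?\<Omega> j - ?\<Delta> ?x j" if "j < n" for j unfolding diff using B(1)[OF that] by simp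
    show "card (?\<Omega> j - ?\<Delta> ?x j) = card (B j - {..<j})" for j
      unfolding diff by (rule card_image) (rule inj_on_subset[OF inj], simp)
    show "card (B j - {..<j}) \<le> card (?\<Omega> j - ?\<Delta> v j)" if j: "j < n" for v j
    proof -
      have "card (B j - {..<j}) = card (B j) - card (B j \<inter> {..<j})"
        using fin[OF j] by (simp add: card_Diff_subset_Int)
      also have "\<dots> \<le> card (?\<Omega> j) - card (?\<Delta> v j)"
        using card_image_le[of "B j \<inter> {..<j}" v] fin[OF j] card_image[OF inj_on_subset[OF inj], of "B j"]
        by simp
      also have "\<dots> \<le> card (?\<Omega> j - ?\<Delta> v j)"
        using fin[OF j] by (intro diff_card_le_card_Diff) simp
      finally show ?thesis .
    qed
    show "\<exists>\<phi>\<in>perm_action ` H. \<forall>j<n. \<phi> (?x j) = v j"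
      if v: "\<And>j. j < n \<Longrightarrow> v j \<in> ?\<Omega> j - ?\<Delta> v j" for v
    proof -
      have "\<forall>j. \<exists>g. j < n \<longrightarrow> g \<in> B j \<and> v j = ?x g" using v by blast
      then obtain g where g: "\<And>j. j < n \<Longrightarrow> g j \<in> B j" "\<And>j. j < n \<Longrightarrow> v j = ?x (g j)" by metis
      \<comment> \<open>The tuple \<open>g\<close>, extended by the identity, is the required permutation.\<close>
      define w where "w j = (if j < n then g j else j)" for j
      have ne: "g i \<noteq> g j" if ij: "i < j" "j < n" for i j
      proof
        assume eq: "g i = g j"
        have "B i = B j" using B(3)[of i "g i"] B(3)[of j "g j"] g(1)[of i] g(1)[of j] ij eq by simp
        then have "i \<in> B j \<inter> {..<j}" using B(1)[of i] ij by simp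
        then have "v i \<in> ?\<Delta> v j" by (rule imageI)
        moreover have "v j = v i" using g(2) ij eq by simp
        ultimately show False using v[OF ij(2)] by simp
      qed
      have inj_g: "inj_on w {..<n}"
      proof (rule inj_onI)
        fix i j assume "i \<in> {..<n}" "j \<in> {..<n}" "w i = w j"
        then show "i = j" using ne[of i j] ne[of j i] by (cases i j rule: linorder_cases) (simp_all add: w_def)
      qed
      have wB: "w ` B j \<subseteq> B j" if j: "j < n" for j
      proof
        fix x assume "x \<in> w ` B j"
        then obtain i where i: "i \<in> B j" "x = w i" by blast
        then have "i < n" using B(2)[OF j] by auto
        then show "x \<in> B j" using g(1)[of i] B(3)[OF j i(1)] i(2) by (simp add: w_def)
      qed
      have wB_eq: "w ` B j = B j" if j: "j < n" for j
        using fin[OF j] wB[OF j] inj_on_subset[OF inj_g B(2)[OF j]] by (rule endo_inj_surj)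
      have "w ` {..<n} \<subseteq> {..<n}"
      proof
        fix x assume "x \<in> w ` {..<n}"
        then obtain j where "j < n" "x = g j" by (auto simp: w_def)
        then show "x \<in> {..<n}" using g(1) B(2) by blast
      qed
      then have "w ` {..<n} = {..<n}" using inj_g by (intro endo_inj_surj) simp_all
      then have "w permutes {..<n}"
        using inj_g by (intro bij_imp_permutes) (simp_all add: bij_betw_def w_def)
      then have "w \<in> H" using wB_eq by (simp add: H_def)
      then show ?thesis using g(2) by (intro bexI[of _ "perm_action w"]) (simp_all add: w_def)
    qed
  qed simp
qed

lemma symmetric_group_basis:
  "hbasis (invariants n (perm_action ` symmetric_group n)) (exponents n (\<lambda>j. n - j))
    (pow_prod n (mv_var :: nat \<Rightarrow> 'a::idom mvpoly)) (\<lambda>a. \<Sum>j<n. a j) (polys n)"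
proof -
  have "symmetric_group n = {w. w permutes {..<n} \<and> (\<forall>j<n. w ` {..<n} = {..<n})}"
    using permutes_image[of _ "{..<n}"] by (auto simp: symmetric_group_def simp del: image_subset_iff)
  moreover have "card ({..<n} - {..<j}) = n - j" for j
    by (simp add: card_Diff_subset_Int lessThan_Int_lessThan min_def)
  ultimately show ?thesis using young_basis[of n "\<lambda>_. {..<n}", where ?'a = 'a] by simp
qed

lemma young_subgroup_basis:
  assumes \<alpha>: "is_composition \<alpha> n"
  shows "hbasis (invariants n (perm_action ` young_subgroup n \<alpha>))
    (exponents n (\<lambda>j. part_sum \<alpha> (block \<alpha> j) - j))
    (pow_prod n (mv_var :: nat \<Rightarrow> 'a::idom mvpoly)) (\<lambda>a. \<Sum>j<n. a j) (polys n)"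
proof -
  define P where "P s = {part_sum \<alpha> s..<part_sum \<alpha> (Suc s)}" for s
  define B where "B j = P (block \<alpha> j - 1)" for j
  have n: "n = sum_list \<alpha>" using \<alpha> by (simp add: is_composition_def)
  have B_eq: "B j = {part_sum \<alpha> (block \<alpha> j - 1)..<part_sum \<alpha> (block \<alpha> j)}" if "j < n" for j
    using block(1)[of j \<alpha>] that by (simp add: B_def P_def n)
  have B1: "j \<in> B j" if "j < n" for j
    using block(3,4)[of j \<alpha>] that unfolding B_eq[OF that] by (simp add: n)
  have B2: "B j \<subseteq> {..<n}" if "j < n" for j
    using part_sum_mono[OF block(2)[of j \<alpha>], of \<alpha>] that unfolding B_eq[OF that] by (auto simp: n)
  have B3: "B i = B j" if "j < n" "i \<in> B j" for i j
  proof -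
    have "block \<alpha> i = block \<alpha> j"
      using that(2) block(1)[of j \<alpha>] that(1) unfolding B_eq[OF that(1)]
      by (intro block_eqI) (simp_all add: n)
    then show ?thesis by (simp add: B_def)
  qed
  have range: "{s. s < length \<alpha>} = {block \<alpha> j - 1 |j. j < n}"
  proof (intro equalityI subsetI)
    fix s assume "s \<in> {s. s < length \<alpha>}"
    then have s: "s < length \<alpha>" by simp
    have "0 < \<alpha> ! s" using \<alpha> s by (simp add: is_composition_def)
    then have lt: "part_sum \<alpha> s < part_sum \<alpha> (Suc s)" using part_sum_Suc[OF s] by simp
    also have "\<dots> \<le> n" using part_sum_mono[of "Suc s" "length \<alpha>" \<alpha>] s by (simp add: n)
    finally have "part_sum \<alpha> s < n" .
    moreover have "block \<alpha> (part_sum \<alpha> s) = Suc s" using lt by (intro block_eqI) simp_all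
    ultimately show "s \<in> {block \<alpha> j - 1 |j. j < n}" by force
  next
    fix s assume "s \<in> {block \<alpha> j - 1 |j. j < n}"
    then obtain j where "j < n" "s = block \<alpha> j - 1" by blast
    then show "s \<in> {s. s < length \<alpha>}" using block(1,2)[of j \<alpha>] by (simp add: n)
  qed
  have "(\<forall>s<length \<alpha>. w ` P s = P s) \<longleftrightarrow> (\<forall>j<n. w ` B j = B j)" for w
  proof -
    have "(\<forall>s<length \<alpha>. w ` P s = P s) \<longleftrightarrow> (\<forall>s\<in>{s. s < length \<alpha>}. w ` P s = P s)" by simp
    also have "\<dots> \<longleftrightarrow> (\<forall>j<n. w ` B j = B j)" unfolding range B_def by auto
    finally show ?thesis .
  qed
  then have H: "young_subgroup n \<alpha> = {w. w permutes {..<n} \<and> (\<forall>j<n. w ` B j = B j)}"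
    by (simp add: young_subgroup_def symmetric_group_def P_def)
  have card: "card (B j - {..<j}) = part_sum \<alpha> (block \<alpha> j) - j" if "j < n" for j
  proof -
    have "B j - {..<j} = {j..<part_sum \<alpha> (block \<alpha> j)}"
      using B1[OF that] unfolding B_eq[OF that] by auto
    then show ?thesis by simp
  qed
  have "exponents n (\<lambda>j. card (B j - {..<j})) = exponents n (\<lambda>j. part_sum \<alpha> (block \<alpha> j) - j)"
    unfolding exponents_def by (intro PiE_cong) (simp add: card)
  then show ?thesis
    using young_basis[of n B, OF B1 B2 B3, where ?'a = 'a] unfolding H by simp
qed

section \<open>Linear forms over a finite field\<close>

text \<open>The space spanned by \<open>v 0, \<dots>, v (j - 1)\<close>. Over a finite field, dimensions can be compared by counting:
such a space has at most \<open>q ^ j\<close> elements, with equality if no \<open>v i\<close> lies in the span of its predecessors.\<close>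

definition lin :: "(nat \<Rightarrow> 'k::field mvpoly) \<Rightarrow> nat \<Rightarrow> 'k mvpoly set" where
  "lin v j = span_mod (range mv_const) {0} {..<j} v"

lemma span_consts_eq:
  fixes e :: "'i \<Rightarrow> 'k::field mvpoly"
  shows "span_mod (range mv_const) {0} I e = (\<lambda>c. \<Sum>i\<in>I. mv_const (c i) * e i) ` (I \<rightarrow>\<^sub>E UNIV)"
proof (intro equalityI subsetI)
  fix p assume "p \<in> span_mod (range mv_const) {0} I e"
  then obtain f where f: "f \<in> I \<rightarrow> range mv_const" "p = (\<Sum>i\<in>I. f i * e i)" by (rule span_zeroE)
  have "\<forall>i\<in>I. \<exists>c. f i = mv_const c" using f(1) by blast
  then obtain c where "\<forall>i\<in>I. f i = mv_const (c i)" by (rule bchoice[THEN exE])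
  then have "p = (\<Sum>i\<in>I. mv_const (restrict c I i) * e i)" unfolding f(2) by (intro sum.cong) simp_all
  then show "p \<in> (\<lambda>c. \<Sum>i\<in>I. mv_const (c i) * e i) ` (I \<rightarrow>\<^sub>E UNIV)"
    by (intro image_eqI[of _ _ "restrict c I"]) simp_all
next
  fix p assume "p \<in> (\<lambda>c. \<Sum>i\<in>I. mv_const (c i) * e i) ` (I \<rightarrow>\<^sub>E UNIV)"
  then obtain c where "p = (\<Sum>i\<in>I. mv_const (c i) * e i)" by blast
  then show "p \<in> span_mod (range mv_const) {0} I e" by (intro span_modI[of "\<lambda>i. mv_const (c i)"]) simp_all
qed

lemma span_consts_finite_card:
  fixes e :: "'i \<Rightarrow> 'k::{field,finite} mvpoly"
  assumes "finite I"
  shows "finite (span_mod (range mv_const) {0} I e)"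
    "card (span_mod (range mv_const) {0} I e) \<le> CARD('k) ^ card I"
    "indep_mod (range mv_const) {0} I e \<Longrightarrow> card (span_mod (range mv_const) {0} I e) = CARD('k) ^ card I"
proof -
  have fin: "finite (I \<rightarrow>\<^sub>E (UNIV :: 'k set))" using assms by (intro finite_PiE) simp_all
  have card: "card (I \<rightarrow>\<^sub>E (UNIV :: 'k set)) = CARD('k) ^ card I"
    using assms by (simp add: card_PiE)
  show "finite (span_mod (range mv_const) {0} I e)" unfolding span_consts_eq using fin by (rule finite_imageI)
  show "card (span_mod (range mv_const) {0} I e) \<le> CARD('k) ^ card I"
    unfolding span_consts_eq card[symmetric] using fin by (rule card_image_le)
  assume ind: "indep_mod (range mv_const) {0} I e"
  have "inj_on (\<lambda>c. \<Sum>i\<in>I. mv_const (c i) * e i) (I \<rightarrow>\<^sub>E (UNIV :: 'k set))"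
  proof (rule inj_onI)
    fix c c' :: "'i \<Rightarrow> 'k"
    assume c: "c \<in> I \<rightarrow>\<^sub>E UNIV" "c' \<in> I \<rightarrow>\<^sub>E UNIV"
      and eq: "(\<Sum>i\<in>I. mv_const (c i) * e i) = (\<Sum>i\<in>I. mv_const (c' i) * e i)"
    show "c = c'"
    proof (rule PiE_ext[OF c])
      fix i assume "i \<in> I"
      then have "mv_const (c i) = (mv_const (c' i) :: 'k mvpoly)"
        using indep_coeffs_unique[OF consts_subring ind _ _ eq] by simp
      then show "c i = c' i" by simp
    qed
  qed
  then show "card (span_mod (range mv_const) {0} I e) = CARD('k) ^ card I"
    unfolding span_consts_eq card[symmetric] by (rule card_image)
qed

lemma lin_submodule: "is_submodule (range mv_const) (lin v j)"
  unfolding lin_def by (rule span_zero_submodule[OF consts_subring])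

lemma lin_elem:
  assumes "p \<in> lin v j" obtains c where "p = (\<Sum>i<j. mv_const (c i) * v i)"
  using assms unfolding lin_def span_consts_eq by blast

lemma lin_sum: "(\<Sum>i<j. mv_const (c i) * v i) \<in> lin v j"
  unfolding lin_def by (rule span_modI[of "\<lambda>i. mv_const (c i)"]) simp_all

lemma lin_base: "i < j \<Longrightarrow> v i \<in> lin v j"
  unfolding lin_def by (rule span_base[OF consts_subring submodule_zero]) simp_all

lemma lin_cong: assumes "\<And>i. i < j \<Longrightarrow> v i = w i" shows "lin v j = lin w j"
  unfolding lin_def span_consts_eq using assms by (intro image_cong sum.cong refl) simp_all

lemma lin_subset:
  assumes "is_submodule (range mv_const) W" "\<And>i. i < j \<Longrightarrow> v i \<in> W" shows "lin v j \<subseteq> W"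
proof
  fix p assume "p \<in> lin v j"
  then obtain c where "p = (\<Sum>i<j. mv_const (c i) * v i)" by (rule lin_elem)
  then show "p \<in> W" using assms(2)
    by (simp only:) (intro submodule_sum[OF assms(1)] submoduleD(3)[OF assms(1)], simp_all)
qed

lemma lin_finite: "finite (lin (v :: nat \<Rightarrow> 'k::{field,finite} mvpoly) j)"
  unfolding lin_def by (rule span_consts_finite_card(1)) simp

lemma lin_card_le: "card (lin (v :: nat \<Rightarrow> 'k::{field,finite} mvpoly) j) \<le> CARD('k) ^ j"
  unfolding lin_def using span_consts_finite_card(2)[of "{..<j}" v] by simp

lemma lin_indep:
  fixes v :: "nat \<Rightarrow> 'k::field mvpoly"
  assumes "\<And>i. i < j \<Longrightarrow> v i \<notin> lin v i"
  shows "indep_mod (range mv_const) {0} {..<j} v"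
  using assms
proof (induction j)
  case 0
  then show ?case by (simp add: indep_mod_def)
next
  case (Suc j)
  show ?case
    unfolding indep_mod_def
  proof (intro ballI impI)
    fix f i assume f: "f \<in> {..<Suc j} \<rightarrow> range mv_const" "(\<Sum>i<Suc j. f i * v i) \<in> {0}" "i \<in> {..<Suc j}"
    obtain c where c: "f j = mv_const c" using Pi_mem[OF f(1), of j] by auto
    have f': "f \<in> {..<j} \<rightarrow> range mv_const" using f(1) by auto
    have rel: "(\<Sum>i<j. f i * v i) + f j * v j = 0" using f(2) by simp
    have "c = 0"
    proof (rule ccontr)
      assume "c \<noteq> 0"
      have S: "(\<Sum>i<j. f i * v i) \<in> lin v j"
        unfolding lin_def by (rule span_modI[OF f']) simp
      have "v j = mv_const (inverse c * c) * v j" using \<open>c \<noteq> 0\<close> by simp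
      also have "\<dots> = mv_const (inverse c) * (f j * v j)" by (simp add: mv_const_mult c mult.assoc)
      also have "f j * v j = mv_const (- 1) * (\<Sum>i<j. f i * v i)"
        using rel by (simp add: mv_const_uminus add_eq_0_iff)
      also have "mv_const (inverse c) * (mv_const (- 1) * (\<Sum>i<j. f i * v i)) \<in> lin v j"
        by (intro submoduleD(3)[OF lin_submodule] S rangeI)
      finally show False using Suc.prems[of j] by simp
    qed
    then have fj: "f j = 0" using c by simp
    then have "(\<Sum>i<j. f i * v i) \<in> {0}" using rel by simp
    moreover have "indep_mod (range mv_const) {0} {..<j} v" using Suc by simp
    ultimately have "f i = 0" if "i < j" using indep_modD[OF _ f', of "{0}" v i] that by simp
    then show "f i = 0" using fj f(3) by (cases "i = j") simp_all
  qed
qed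

lemma lin_card:
  fixes v :: "nat \<Rightarrow> 'k::{field,finite} mvpoly"
  assumes "\<And>i. i < j \<Longrightarrow> v i \<notin> lin v i"
  shows "card (lin v j) = CARD('k) ^ j"
  unfolding lin_def using span_consts_finite_card(3)[OF _ lin_indep[OF assms], of j] by simp

definition forms :: "nat \<Rightarrow> 'k::field mvpoly set" where
  "forms n = lin mv_var n"

lemma lin_eq_of_card:
  fixes v :: "nat \<Rightarrow> 'k::{field,finite} mvpoly"
  assumes W: "is_submodule (range mv_const) W" "finite W" "card W \<le> CARD('k) ^ j"
    and v: "\<And>i. i < j \<Longrightarrow> v i \<notin> lin v i" "\<And>i. i < j \<Longrightarrow> v i \<in> W"
  shows "lin v j = W"
proof (rule card_seteq[OF W(2)])
  show "lin v j \<subseteq> W" using W(1) v(2) by (rule lin_subset)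
  have "card (lin v j) = CARD('k) ^ j" using v(1) by (rule lin_card)
  then show "card W \<le> card (lin v j)" using W(3) by simp
qed

lemma forms_eq_lin:
  fixes v :: "nat \<Rightarrow> 'k::{field,finite} mvpoly"
  assumes "\<And>i. i < n \<Longrightarrow> v i \<notin> lin v i" "\<And>i. i < n \<Longrightarrow> v i \<in> forms n"
  shows "lin v n = forms n"
  unfolding forms_def
  by (rule lin_eq_of_card[OF lin_submodule lin_finite lin_card_le assms(1)]) (use assms(2) in \<open>simp_all add: forms_def\<close>)

lemma mv_var_in_forms: "i < n \<Longrightarrow> mv_var i \<in> forms n"
  unfolding forms_def by (rule lin_base)

lemma forms_polys: "forms n \<subseteq> polys n"
proof -
  have "is_submodule (range mv_const) (polys n :: 'a mvpoly set)"
    using polys_graded_subring[of n, where ?'a = 'a]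
    by (intro subring_submodule) (simp_all add: graded_subring_def)
  then show ?thesis unfolding forms_def by (rule lin_subset) (rule mv_var_in_polys)
qed

lemma forms_homogeneous: assumes "p \<in> forms n" shows "mv_homogeneous 1 p"
proof -
  obtain c where "p = (\<Sum>i<n. mv_const (c i) * mv_var i)" using assms unfolding forms_def by (rule lin_elem)
  then show ?thesis by (simp only:) (intro mv_homogeneous_sum mv_homogeneous_const_mult, simp)
qed

lemma linear_action_graded_hom: "graded_hom (linear_action n A)"
  unfolding linear_action_def
  by (rule mv_subst_graded_hom) (intro mv_homogeneous_sum mv_homogeneous_const_mult, simp)

lemma linear_action_var: "linear_action n A (mv_var j) = (\<Sum>i<n. mv_const (A $$ (i, j)) * mv_var i)"
  by (simp add: linear_action_def)

lemma lookup_form: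
  assumes "r < n"
  shows "Poly_Mapping.lookup (\<Sum>i<n. mv_const (c i) * mv_var i) (Poly_Mapping.single r 1) = (c r :: 'a::comm_ring_1)"
proof -
  have "Poly_Mapping.lookup (\<Sum>i<n. mv_const (c i) * mv_var i) (Poly_Mapping.single r 1)
      = (\<Sum>i<n. if i = r then c i else 0)"
    unfolding lookup_sum
    by (intro sum.cong) (auto simp: lookup_mv_const_mult mv_var_def lookup_single when_def dest: arg_cong[of _ _ Poly_Mapping.keys])
  then show ?thesis using assms by (simp add: sum.delta')
qed

text \<open>The coordinates \<open>c l\<close> of the variables in the basis \<open>y\<close> determine the images of the variables,
which form the columns of the matrix.\<close>

lemma matrix_with_values:
  fixes y :: "nat \<Rightarrow> 'k::{field,finite} mvpoly"
  assumes y: "\<And>i. i < n \<Longrightarrow> y i \<notin> lin y i" "\<And>i. i < n \<Longrightarrow> y i \<in> forms n"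
    and v: "\<And>i. i < n \<Longrightarrow> v i \<in> forms n"
  shows "\<exists>A\<in>carrier_mat n n. \<forall>i<n. linear_action n A (y i) = v i"
proof -
  have all: "lin y n = forms n" using y by (rule forms_eq_lin)
  have "\<forall>l\<in>{..<n}. \<exists>c. (mv_var l :: 'k mvpoly) = (\<Sum>i<n. mv_const (c i) * y i)"
  proof
    fix l assume "l \<in> {..<n}"
    then have "mv_var l \<in> lin y n" unfolding all by (intro mv_var_in_forms) simp
    then show "\<exists>c. (mv_var l :: 'k mvpoly) = (\<Sum>i<n. mv_const (c i) * y i)" by (elim lin_elem) blast
  qed
  then obtain c where "\<forall>l\<in>{..<n}. (mv_var l :: 'k mvpoly) = (\<Sum>i<n. mv_const (c l i) * y i)"
    by (rule bchoice[THEN exE])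
  then have c: "(mv_var l :: 'k mvpoly) = (\<Sum>i<n. mv_const (c l i) * y i)" if "l < n" for l
    using that by blast
  have "\<forall>l\<in>{..<n}. \<exists>a. (\<Sum>i<n. mv_const (c l i) * v i) = (\<Sum>r<n. mv_const (a r) * mv_var r)"
  proof
    fix l
    have "(\<Sum>i<n. mv_const (c l i) * v i) \<in> forms n"
      unfolding forms_def
      by (intro submodule_sum[OF lin_submodule] submoduleD(3)[OF lin_submodule] rangeI)
        (use v in \<open>simp add: forms_def\<close>)
    then show "\<exists>a. (\<Sum>i<n. mv_const (c l i) * v i) = (\<Sum>r<n. mv_const (a r) * mv_var r)"
      unfolding forms_def by (elim lin_elem) blast
  qed
  then obtain a where "\<forall>l\<in>{..<n}. (\<Sum>i<n. mv_const (c l i) * v i) = (\<Sum>r<n. mv_const (a l r) * mv_var r)"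
    by (rule bchoice[THEN exE])
  then have a: "(\<Sum>r<n. mv_const (a l r) * mv_var r) = (\<Sum>i<n. mv_const (c l i) * v i)" if "l < n" for l
    using that by simp
  define A where "A = mat n n (\<lambda>(r, l). a l r)"
  let ?\<psi> = "linear_action n A"
  note H = graded_homD[OF linear_action_graded_hom[of n A]]
  have var: "?\<psi> (mv_var l) = (\<Sum>i<n. mv_const (c l i) * v i)" if "l < n" for l
    using a[OF that] that by (simp add: linear_action_var A_def)
  have "?\<psi> (y j) = v j" if j: "j < n" for j
  proof -
    obtain b where b: "y j = (\<Sum>l<n. mv_const (b l) * mv_var l)"
      using y(2)[OF j] unfolding forms_def by (rule lin_elem)
    define g where "g i = (\<Sum>l<n. b l * c l i)" for i
    have swap: "(\<Sum>l<n. mv_const (b l) * (\<Sum>i<n. mv_const (c l i) * w i)) = (\<Sum>i<n. mv_const (g i) * w i)"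
      for w :: "nat \<Rightarrow> 'k mvpoly"
    proof -
      have "(\<Sum>l<n. mv_const (b l) * (\<Sum>i<n. mv_const (c l i) * w i))
          = (\<Sum>l<n. \<Sum>i<n. mv_const (b l * c l i) * w i)"
        by (simp add: sum_distrib_left mv_const_mult mult.assoc)
      also have "\<dots> = (\<Sum>i<n. \<Sum>l<n. mv_const (b l * c l i) * w i)" by (rule sum.swap)
      finally show ?thesis by (simp add: g_def mv_const_sum sum_distrib_right)
    qed
    have "y j = (\<Sum>l<n. mv_const (b l) * (\<Sum>i<n. mv_const (c l i) * y i))"
      by (subst b) (intro sum.cong refl arg_cong2[of _ _ _ _ "(*)"] c, simp)
    then have gy: "(\<Sum>i<n. mv_const (g i) * y i) = y j" unfolding swap by simp
    have delta: "(\<Sum>i<n. mv_const (if i = j then 1 else 0) * w i) = w j" for w :: "nat \<Rightarrow> 'k mvpoly"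
    proof -
      have "(\<Sum>i<n. mv_const (if i = j then 1 else 0) * w i) = (\<Sum>i<n. if i = j then w i else 0)"
        by (intro sum.cong) simp_all
      then show ?thesis using j by (simp add: sum.delta')
    qed
    have "mv_const (g i) = (mv_const (if i = j then 1 else 0) :: 'k mvpoly)" if "i < n" for i
      by (rule indep_coeffs_unique[OF consts_subring lin_indep[of n y, OF y(1)], of "\<lambda>i. mv_const (g i)"])
        (use that in \<open>simp_all only: gy delta, simp_all\<close>)
    then have g: "g i = (if i = j then 1 else 0)" if "i < n" for i using that by simp
    have "?\<psi> (y j) = (\<Sum>l<n. mv_const (b l) * ?\<psi> (mv_var l))" by (subst b) (simp add: H)
    also have "\<dots> = (\<Sum>l<n. mv_const (b l) * (\<Sum>i<n. mv_const (c l i) * v i))"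
      by (intro sum.cong refl arg_cong2[of _ _ _ _ "(*)"] var) simp
    also have "\<dots> = (\<Sum>i<n. mv_const (if i = j then 1 else 0) * v i)"
      unfolding swap by (intro sum.cong) (simp_all add: g)
    also have "\<dots> = v j" by (rule delta)
    finally show ?thesis .
  qed
  moreover have "A \<in> carrier_mat n n" by (simp add: A_def)
  ultimately show ?thesis by blast
qed

lemma linear_action_mult_var:
  assumes A: "A \<in> carrier_mat n n" and B: "B \<in> carrier_mat n n" and j: "j < n"
  shows "linear_action n (B * A) (mv_var j) = linear_action n B (linear_action n A (mv_var j))"
proof -
  note H = graded_homD[OF linear_action_graded_hom[of n B]]
  have "linear_action n B (linear_action n A (mv_var j))
      = (\<Sum>i<n. mv_const (A $$ (i, j)) * (\<Sum>r<n. mv_const (B $$ (r, i)) * mv_var r))"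
    by (simp add: linear_action_var H)
  also have "\<dots> = (\<Sum>i<n. \<Sum>r<n. mv_const (B $$ (r, i) * A $$ (i, j)) * mv_var r)"
    by (simp add: sum_distrib_left mv_const_mult mult_ac)
  also have "\<dots> = (\<Sum>r<n. mv_const (\<Sum>i<n. B $$ (r, i) * A $$ (i, j)) * mv_var r)"
    by (subst sum.swap) (simp add: mv_const_sum sum_distrib_right)
  also have "\<dots> = linear_action n (B * A) (mv_var j)"
    unfolding linear_action_var using A B j
    by (intro sum.cong refl arg_cong2[of _ _ _ _ "(*)"] arg_cong[of _ _ mv_const])
      (simp add: scalar_prod_def atLeast0LessThan)
  finally show ?thesis by simp
qed

lemma linear_action_var_inj:
  assumes C: "C \<in> carrier_mat n n" and "\<And>j. j < n \<Longrightarrow> linear_action n C (mv_var j) = mv_var j"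
  shows "C = 1\<^sub>m n"
proof (rule eq_matI)
  fix r j assume rj: "r < dim_row (1\<^sub>m n)" "j < dim_col (1\<^sub>m n)"
  then have r: "r < n" and j: "j < n" by simp_all
  have "C $$ (r, j) = Poly_Mapping.lookup (linear_action n C (mv_var j)) (Poly_Mapping.single r 1)"
    unfolding linear_action_var by (simp only: lookup_form[OF r])
  also have "\<dots> = Poly_Mapping.lookup (mv_var j) (Poly_Mapping.single r 1)" by (simp only: assms(2)[OF j])
  also have "\<dots> = 1\<^sub>m n $$ (r, j)"
    using r j by (auto simp: mv_var_def lookup_single when_def dest: arg_cong[of _ _ Poly_Mapping.keys])
  finally show "C $$ (r, j) = 1\<^sub>m n $$ (r, j)" .
qed (use C in simp_all)

lemma GL_with_values:
  fixes y :: "nat \<Rightarrow> 'k::{field,finite} mvpoly"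
  assumes y: "\<And>i. i < n \<Longrightarrow> y i \<notin> lin y i" "\<And>i. i < n \<Longrightarrow> y i \<in> forms n"
    and v: "\<And>i. i < n \<Longrightarrow> v i \<notin> lin v i" "\<And>i. i < n \<Longrightarrow> v i \<in> forms n"
  shows "\<exists>A\<in>GL n. \<forall>i<n. linear_action n A (y i) = v i"
proof -
  obtain A where A: "A \<in> carrier_mat n n" "\<forall>i<n. linear_action n A (y i) = v i"
    using matrix_with_values[of n y v, OF y v(2)] by blast
  obtain B where B: "B \<in> carrier_mat n n" "\<forall>i<n. linear_action n B (v i) = y i"
    using matrix_with_values[of n v y, OF v y(2)] by blast
  note HA = graded_homD[OF linear_action_graded_hom[of n A]]
  note HB = graded_homD[OF linear_action_graded_hom[of n B]]
  have "B * A = 1\<^sub>m n"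
  proof (rule linear_action_var_inj)
    fix j assume j: "j < n"
    have all: "lin y n = forms n" using y by (rule forms_eq_lin)
    have "mv_var j \<in> lin y n" unfolding all using j by (rule mv_var_in_forms)
    then obtain c where c: "mv_var j = (\<Sum>i<n. mv_const (c i) * y i)" by (rule lin_elem)
    have "linear_action n B (linear_action n A (mv_var j)) = mv_var j"
      unfolding c using A(2) B(2) by (simp add: HA HB)
    then show "linear_action n (B * A) (mv_var j) = mv_var j"
      using linear_action_mult_var[OF A(1) B(1) j] by simp
  qed (use A B in simp)
  moreover have "A * B = 1\<^sub>m n" by (rule mat_mult_left_right_inverse[OF B(1) A(1) calculation])
  ultimately have "invertible_mat A"
    using A(1) B(1) unfolding invertible_mat_def inverts_mat_def by auto
  then show ?thesis using A unfolding GL_def by blast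
qed

text \<open>\<open>U j\<close> is the space of forms in which the image of \<open>y j\<close> may lie. Of its elements, the span of the \<open>j\<close>
preceding images is excluded, which leaves at least \<open>q ^ m j - q ^ j\<close> values.\<close>

lemma linear_group_basis:
  fixes y :: "nat \<Rightarrow> 'k::{field,finite} mvpoly"
  assumes U: "\<And>j. j < n \<Longrightarrow> is_submodule (range mv_const) (U j)" "\<And>j. j < n \<Longrightarrow> U j \<subseteq> forms n"
      "\<And>j. j < n \<Longrightarrow> card (U j) = CARD('k) ^ m j"
    and y: "\<And>j. j < n \<Longrightarrow> y j \<in> U j - lin y j" "\<And>j. j < n \<Longrightarrow> lin y j \<subseteq> U j"
    and stable: "\<And>A j. A \<in> H \<Longrightarrow> j < n \<Longrightarrow> linear_action n A ` U j = U j"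
    and realise: "\<And>v. (\<And>j. j < n \<Longrightarrow> v j \<in> U j - lin v j) \<Longrightarrow> \<exists>A\<in>H. \<forall>j<n. linear_action n A (y j) = v j"
  shows "hbasis (invariants n (linear_action n ` H)) (exponents n (\<lambda>j. CARD('k) ^ m j - CARD('k) ^ j))
    (pow_prod n y) (\<lambda>a. \<Sum>j<n. a j) (polys n)"
proof -
  have y_forms: "y j \<in> forms n" if "j < n" for j using y(1)[OF that] U(2)[OF that] by blast
  have y_new: "y j \<notin> lin y j" if "j < n" for j using y(1)[OF that] by blast
  have U_fin: "finite (U j)" if "j < n" for j
    using U(2)[OF that] lin_finite unfolding forms_def by (rule finite_subset)
  show ?thesis
  proof (rule monomial_basis_over_invariants[where \<Omega> = U and \<Delta> = lin])
    show "graded_hom \<phi>" if "\<phi> \<in> linear_action n ` H" for \<phi> :: "'k mvpoly \<Rightarrow> 'k mvpoly"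
      using that linear_action_graded_hom by blast
    show "y j \<in> polys n" if "j < n" for j using y_forms[OF that] forms_polys by blast
    show "mv_homogeneous 1 (y j)" if "j < n" for j using y_forms[OF that] by (rule forms_homogeneous)
    show lin_T: "lin y j \<subseteq> T"
      if "is_subring T" "range mv_const \<subseteq> T" "\<And>i. i < j \<Longrightarrow> y i \<in> T" for T j
      by (rule lin_subset[OF subring_submodule[OF that(1,2)] that(3)])
    show "polys n \<subseteq> T" if T: "is_subring T" "range mv_const \<subseteq> T" "\<And>j. j < n \<Longrightarrow> y j \<in> T" for T
    proof (rule polys_generated[OF T(1,2)])
      fix i assume "i < n"
      moreover have "lin y n = forms n" using y_new y_forms by (rule forms_eq_lin)
      ultimately have "mv_var i \<in> lin y n" by (simp add: mv_var_in_forms)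
      then show "mv_var i \<in> T" using lin_T[OF T] by blast
    qed
    show "U j \<subseteq> polys n" if "j < n" for j using U(2)[OF that] forms_polys by blast
    show "\<phi> ` U j = U j" if "j < n" "\<phi> \<in> linear_action n ` H" for j \<phi> using stable that by blast
    show "lin v j = lin w j" if "\<And>i. i < j \<Longrightarrow> v i = w i" for v w :: "nat \<Rightarrow> 'k mvpoly" and j
      using that by (rule lin_cong)
    show "card (U j - lin y j) = CARD('k) ^ m j - CARD('k) ^ j" if "j < n" for j
      using card_Diff_subset[OF lin_finite y(2)[OF that]] lin_card[of j y] y_new U(3) that by simp
    show "CARD('k) ^ m j - CARD('k) ^ j \<le> card (U j - lin v j)" if "j < n" for v :: "nat \<Rightarrow> 'k mvpoly" and j
      using diff_card_le_card_Diff[OF lin_finite[of v j], of "U j"] lin_card_le[of v j] U(3)[OF that] by simp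
    show "\<exists>\<phi>\<in>linear_action n ` H. \<forall>j<n. \<phi> (y j) = v j" if "\<And>j. j < n \<Longrightarrow> v j \<in> U j - lin v j" for v
      using realise[of v, OF that] by blast
  qed (use U_fin y in simp_all)
qed

section \<open>Flags and parabolic subgroups\<close>

definition form :: "nat \<Rightarrow> 'k::field vec \<Rightarrow> 'k mvpoly" where
  "form n v = (\<Sum>i<n. mv_const (v $ i) * mv_var i)"

definition form_vec :: "nat \<Rightarrow> 'k::field mvpoly \<Rightarrow> 'k vec" where
  "form_vec n p = vec n (\<lambda>i. Poly_Mapping.lookup p (Poly_Mapping.single i 1))"

lemma form_vec_form: assumes "v \<in> carrier_vec n" shows "form_vec n (form n v) = v"
proof (rule eq_vecI)
  fix i assume "i < dim_vec v"
  then have "i < n" using assms by simp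
  then show "form_vec n (form n v) $ i = v $ i" unfolding form_vec_def form_def by (simp add: lookup_form[simplified])
qed (use assms in \<open>simp add: form_vec_def\<close>)

lemma form_inj: "inj_on (form n) (carrier_vec n)"
  by (rule inj_on_inverseI[of _ "form_vec n"]) (rule form_vec_form)

lemma form_add: "u \<in> carrier_vec n \<Longrightarrow> v \<in> carrier_vec n \<Longrightarrow> form n (u + v) = form n u + form n v"
  unfolding form_def by (simp add: mv_const_add distrib_right sum.distrib)

lemma form_smult: "v \<in> carrier_vec n \<Longrightarrow> form n (c \<cdot>\<^sub>v v) = mv_const c * form n v"
  unfolding form_def by (simp add: mv_const_mult sum_distrib_left mult.assoc)

lemma form_zero: "form n (0\<^sub>v n) = 0"
  unfolding form_def by simp

lemma form_image_carrier: "form n ` carrier_vec n = forms n"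
proof (intro equalityI subsetI)
  fix p assume "p \<in> form n ` carrier_vec n"
  then obtain v where "p = form n v" by blast
  then show "p \<in> forms n" unfolding form_def forms_def by (simp only: lin_sum)
next
  fix p :: "'a mvpoly" assume "p \<in> forms n"
  then obtain c where "p = (\<Sum>i<n. mv_const (c i) * mv_var i)" unfolding forms_def by (rule lin_elem)
  then have "p = form n (vec n c)" unfolding form_def by simp
  then show "p \<in> form n ` carrier_vec n" by simp
qed

lemma linear_action_form:
  assumes A: "A \<in> carrier_mat n n" and v: "v \<in> carrier_vec n"
  shows "linear_action n A (form n v) = form n (A *\<^sub>v v)"
proof -
  note H = graded_homD[OF linear_action_graded_hom[of n A]]
  have "linear_action n A (form n v) = (\<Sum>j<n. mv_const (v $ j) * (\<Sum>i<n. mv_const (A $$ (i, j)) * mv_var i))"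
    by (simp add: form_def H linear_action_var)
  also have "\<dots> = (\<Sum>j<n. \<Sum>i<n. mv_const (A $$ (i, j) * v $ j) * mv_var i)"
    by (simp add: sum_distrib_left mv_const_mult mult_ac)
  also have "\<dots> = (\<Sum>i<n. mv_const (\<Sum>j<n. A $$ (i, j) * v $ j) * mv_var i)"
    by (subst sum.swap) (simp add: mv_const_sum sum_distrib_right)
  also have "\<dots> = form n (A *\<^sub>v v)"
    unfolding form_def using A v
    by (intro sum.cong refl arg_cong2[of _ _ _ _ "(*)"] arg_cong[of _ _ mv_const])
      (simp add: scalar_prod_def atLeast0LessThan)
  finally show ?thesis .
qed

lemma form_image_linear_action:
  assumes "A \<in> carrier_mat n n" "X \<subseteq> carrier_vec n"
  shows "linear_action n A ` form n ` X = form n ` (\<lambda>v. A *\<^sub>v v) ` X"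
  unfolding image_image using assms by (intro image_cong refl linear_action_form) auto

text \<open>Subspaces of column vectors, with their dimension, are turned into sets of linear forms with their
cardinality.\<close>

lemma subspace_form_image:
  fixes X :: "'k::{field,finite} vec set"
  assumes X: "VectorSpace.subspace class_ring X (module_vec TYPE('k) n)"
  shows "is_submodule (range mv_const) (form n ` X)" "X \<subseteq> carrier_vec n"
    "card (form n ` X) = CARD('k) ^ vectorspace.dim class_ring ((module_vec TYPE('k) n)\<lparr>carrier := X\<rparr>)"
proof -
  let ?M = "(module_vec TYPE('k) n)\<lparr>carrier := X\<rparr>"
  have "LinearCombinations.submodule class_ring X (module_vec TYPE('k) n)"
    using X by (rule VectorSpace.subspace.submod)
  then have sub: "X \<subseteq> carrier_vec n" "\<And>u v. u \<in> X \<Longrightarrow> v \<in> X \<Longrightarrow> u + v \<in> X" "0\<^sub>v n \<in> X"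
      "\<And>c v. v \<in> X \<Longrightarrow> c \<cdot>\<^sub>v v \<in> X"
    unfolding LinearCombinations.submodule_def by (simp_all add: module_vec_simps)
  show "X \<subseteq> carrier_vec n" by (rule sub(1))
  have Xc: "v \<in> carrier_vec n" if "v \<in> X" for v using that sub(1) by blast
  show W: "is_submodule (range mv_const) (form n ` X)"
    unfolding is_submodule_def
  proof (intro conjI ballI)
    show "0 \<in> form n ` X" using sub(3) form_zero by (intro image_eqI[of _ _ "0\<^sub>v n"]) simp_all
  next
    fix x y assume "x \<in> form n ` X" "y \<in> form n ` X"
    then obtain u v where uv: "u \<in> X" "v \<in> X" "x = form n u" "y = form n v" by blast
    then show "x + y \<in> form n ` X"
      using sub(2) Xc by (intro image_eqI[of _ _ "u + v"]) (simp_all add: form_add)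
  next
    fix a x assume "a \<in> range (mv_const :: 'k \<Rightarrow> _)" "x \<in> form n ` X"
    then obtain c v where cv: "v \<in> X" "a = mv_const c" "x = form n v" by blast
    then show "a * x \<in> form n ` X"
      using sub(4) Xc by (intro image_eqI[of _ _ "c \<cdot>\<^sub>v v"]) (simp_all add: form_smult)
  qed
  have forms: "form n ` X \<subseteq> forms n" using sub(1) form_image_carrier by blast
  obtain B where B: "basis_mod (range mv_const) {0} B (\<lambda>b. b) (form n ` X)"
    using homogeneous_basis_exists[OF principal_consts_field W, where n = n and d = 1]
      forms forms_polys forms_homogeneous by blast
  have B': "finite B" "B \<subseteq> form n ` X" "indep_mod (range mv_const) {0} B (\<lambda>b. b)"
      "form n ` X \<subseteq> span_mod (range mv_const) {0} B (\<lambda>b. b)"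
    using B by (auto simp: basis_mod_def)
  interpret P: presented_module "class_ring :: 'k ring" ?M mv_const "form_vec n" "form n ` X" "{0}"
  proof (rule presented_module.intro)
    show "is_submodule (mv_const ` carrier (class_ring :: 'k ring)) (form n ` X)" using W by simp
    have "form_vec n ` form n ` X = X"
    proof -
      have "(\<lambda>v. form_vec n (form n v)) ` X = (\<lambda>v. v) ` X"
        by (intro image_cong refl form_vec_form Xc)
      then show ?thesis by (simp add: image_image)
    qed
    then show "carrier ?M = form_vec n ` form n ` X" by simp
    have "form_vec n (form n (0\<^sub>v n :: 'k vec)) = 0\<^sub>v n" by (rule form_vec_form) simp
    then show "\<zero>\<^bsub>?M\<^esub> = form_vec n 0" by (simp add: form_zero module_vec_simps)
  next
    fix x y assume "x \<in> form n ` X" "y \<in> form n ` X"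
    then obtain u v where uv: "u \<in> X" "v \<in> X" "x = form n u" "y = form n v" by blast
    then show "form_vec n x \<oplus>\<^bsub>?M\<^esub> form_vec n y = form_vec n (x + y)"
      using form_vec_form[of "u + v" n] Xc sub(2)
      by (simp add: form_vec_form form_add module_vec_simps)
  next
    fix c :: 'k and x assume "x \<in> form n ` X"
    then obtain v where v: "v \<in> X" "x = form n v" by blast
    then show "c \<odot>\<^bsub>?M\<^esub> form_vec n x = form_vec n (mv_const c * x)"
      using form_vec_form[of "c \<cdot>\<^sub>v v" n] Xc sub(4)
      by (simp add: form_vec_form form_smult module_vec_simps)
  next
    fix x assume "x \<in> form n ` X"
    then obtain v where v: "v \<in> X" "x = form n v" by blast
    have "form_vec n x = form_vec n 0 \<longleftrightarrow> v = 0\<^sub>v n"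
      using form_vec_form[of "0\<^sub>v n :: 'k vec" n] v Xc by (simp add: form_vec_form form_zero)
    also have "\<dots> \<longleftrightarrow> x = 0"
      using inj_on_eq_iff[OF form_inj Xc[OF v(1)], of "0\<^sub>v n"] v(2) by (simp add: form_zero)
    finally show "form_vec n x = form_vec n 0 \<longleftrightarrow> x \<in> {0}" by simp
  qed (use consts_scalars[where ?'a = 'k] in \<open>simp_all add: submodule_zero\<close>)
  have bas: "basis_mod (mv_const ` carrier (class_ring :: 'k ring)) {0} B (\<lambda>b. b) (form n ` X)"
    using B by simp
  note img = P.basis_image[OF bas]
  interpret V: vectorspace "class_ring :: 'k ring" ?M
    by (intro vectorspace.intro P.module_axioms_M class_field)
  have "form_vec n ` B \<subseteq> carrier ?M" using B'(2) P.carrier_M by blast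
  then have "V.basis (form_vec n ` B)" unfolding V.basis_def using img(2,3) by simp
  then have "V.dim = card (form_vec n ` B)" using B'(1) by (intro V.dim_basis) simp_all
  then have dim: "V.dim = card B" using card_image[OF img(1)] by simp
  have "span_mod (range mv_const) {0} B (\<lambda>b. b) \<subseteq> form n ` X"
  proof
    fix p assume "p \<in> span_mod (range mv_const) {0} B (\<lambda>b. b)"
    then obtain f where f: "f \<in> B \<rightarrow> range mv_const" "p = (\<Sum>b\<in>B. f b * b)" by (rule span_zeroE)
    show "p \<in> form n ` X"
      unfolding f(2)
    proof (intro submodule_sum[OF W] submoduleD(3)[OF W])
      fix b assume b: "b \<in> B"
      show "f b \<in> range mv_const" using f(1) b by (rule Pi_mem)
      show "b \<in> form n ` X" using B'(2) b by blast
    qed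
  qed
  then have "form n ` X = span_mod (range mv_const) {0} B (\<lambda>b. b)" using B'(4) by blast
  then show "card (form n ` X) = CARD('k) ^ V.dim"
    unfolding dim using span_consts_finite_card(3)[OF B'(1,3)] by simp
qed

text \<open>Greedy choice: the span of the vectors chosen so far is too small to contain \<open>U j\<close>.\<close>

lemma adapted_basis_exists:
  fixes U :: "nat \<Rightarrow> 'k::{field,finite} mvpoly set"
  assumes "\<And>j. j < n \<Longrightarrow> CARD('k) ^ j < card (U j)"
  shows "\<exists>y. \<forall>j<n. y j \<in> U j - lin y j"
  using assms
proof (induction n)
  case 0
  then show ?case by simp
next
  case (Suc n)
  then obtain y where y: "\<forall>j<n. y j \<in> U j - lin y j" by auto
  have "card (lin y n) < card (U n)" using lin_card_le[of y n] Suc.prems[of n] by simp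
  then have "\<not> U n \<subseteq> lin y n" using card_mono[OF lin_finite[of y n], of "U n"] by auto
  then obtain w where w: "w \<in> U n" "w \<notin> lin y n" by blast
  have same: "lin (y(n := w)) j = lin y j" if "j \<le> n" for j using that by (intro lin_cong) simp
  have "(y(n := w)) j \<in> U j - lin (y(n := w)) j" if "j < Suc n" for j
    using that y w same[of j] by (cases "j = n") simp_all
  then show ?case by blast
qed

lemma card_field_gt_1: "1 < CARD('k::{field,finite})"
proof -
  have "card {0, 1 :: 'k} \<le> CARD('k)" by (rule card_mono) simp_all
  then show ?thesis by simp
qed

lemma GL_inverse:
  assumes "A \<in> GL n"
  obtains B where "B \<in> carrier_mat n n" "A * B = 1\<^sub>m n" "B * A = 1\<^sub>m n" "A \<in> carrier_mat n n"
proof -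
  have A: "A \<in> carrier_mat n n" using assms by (simp add: GL_def)
  obtain B where B: "inverts_mat A B" "inverts_mat B A"
    using assms unfolding GL_def invertible_mat_def by blast
  have AB: "A * B = 1\<^sub>m n" using B(1) A by (simp add: inverts_mat_def)
  have "dim_col (A * B) = n" unfolding AB by simp
  then have "dim_col B = n" by simp
  moreover have BA: "B * A = 1\<^sub>m (dim_row B)" using B(2) by (simp add: inverts_mat_def)
  moreover have "dim_col (B * A) = dim_row B" unfolding BA by simp
  then have "dim_row B = n" using A by simp
  ultimately show thesis using A AB by (intro that[of B]) auto
qed

lemma GL_mult_vec_inj: assumes "A \<in> GL n" shows "inj_on (\<lambda>v. A *\<^sub>v v) (carrier_vec n)"
proof -
  obtain B where B: "B \<in> carrier_mat n n" "B * A = 1\<^sub>m n" "A \<in> carrier_mat n n"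
    using GL_inverse[OF assms] by metis
  show ?thesis
  proof (rule inj_on_inverseI[of _ "\<lambda>v. B *\<^sub>v v"])
    fix v :: "'a vec" assume v: "v \<in> carrier_vec n"
    have "B *\<^sub>v (A *\<^sub>v v) = (B * A) *\<^sub>v v" by (rule assoc_mult_mat_vec[OF B(1,3) v, symmetric])
    then show "B *\<^sub>v (A *\<^sub>v v) = v" using B(2) v by simp
  qed
qed

lemma finite_carrier_vec: "finite (carrier_vec n :: 'k::{field,finite} vec set)"
proof (rule finite_imageD)
  show "finite (form n ` (carrier_vec n :: 'k vec set))"
    unfolding form_image_carrier forms_def by (rule lin_finite)
qed (rule form_inj)

lemma GL_image_eqI:
  fixes A :: "'k::{field,finite} mat"
  assumes A: "A \<in> GL n" and X: "X \<subseteq> carrier_vec n" "(\<lambda>v. A *\<^sub>v v) ` X \<subseteq> X"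
  shows "(\<lambda>v. A *\<^sub>v v) ` X = X"
  using finite_subset[OF X(1) finite_carrier_vec] X(2) inj_on_subset[OF GL_mult_vec_inj[OF A] X(1)]
  by (rule endo_inj_surj)

lemma card_forms: "card (forms n :: 'k::{field,finite} mvpoly set) = CARD('k) ^ n"
proof -
  have "indep_mod (range mv_const) {0} {..<n} (mv_var :: nat \<Rightarrow> 'k mvpoly)"
    unfolding indep_mod_def
  proof (intro ballI impI)
    fix f i assume f: "f \<in> {..<n} \<rightarrow> range (mv_const :: 'k \<Rightarrow> _)" "(\<Sum>i<n. f i * mv_var i) \<in> {0}"
      and i: "i \<in> {..<n}"
    have "\<forall>i\<in>{..<n}. \<exists>c. f i = mv_const c" using f(1) by blast
    then obtain c where "\<forall>i\<in>{..<n}. f i = mv_const (c i)" by (rule bchoice[THEN exE])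
    then have c: "f i = mv_const (c i)" if "i < n" for i using that by simp
    have "(\<Sum>i<n. mv_const (c i) * mv_var i) = 0" using f(2) c by simp
    then have "c i = 0" using lookup_form[of i n c] i by simp
    then show "f i = 0" using c i by simp
  qed
  then show ?thesis
    unfolding forms_def lin_def using span_consts_finite_card(3)[of "{..<n}" "mv_var :: nat \<Rightarrow> 'k mvpoly"] by simp
qed

text \<open>One basis \<open>y\<close> of the forms, adapted to the flag, serves both groups. For the parabolic subgroup \<open>y j\<close>
ranges over the step of the flag that belongs to the block of \<open>j\<close>, for the full group over all forms. A matrix that
sends \<open>y\<close> to an admissible tuple maps each step of the flag into itself, because that step is spanned by an initial
segment of \<open>y\<close>; being injective, it preserves the flag.\<close>

theorem parabolic_and_GL_bases:
  fixes V :: "nat \<Rightarrow> 'k::{field,finite} vec set"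
  assumes \<alpha>: "is_composition \<alpha> n" and V: "is_flag n \<alpha> V"
  shows "\<exists>y.
    hbasis (invariants n (linear_action n ` parabolic_subgroup n \<alpha> V))
      (exponents n (\<lambda>j. CARD('k) ^ part_sum \<alpha> (block \<alpha> j) - CARD('k) ^ j))
      (pow_prod n y) (\<lambda>a. \<Sum>j<n. a j) (polys n) \<and>
    hbasis (invariants n (linear_action n ` (GL n :: 'k mat set)))
      (exponents n (\<lambda>j. CARD('k) ^ n - CARD('k) ^ j)) (pow_prod n y) (\<lambda>a. \<Sum>j<n. a j) (polys n)"
proof -
  let ?L = "length \<alpha>" and ?P = "parabolic_subgroup n \<alpha> V"
  have n: "n = sum_list \<alpha>" using \<alpha> by (simp add: is_composition_def)
  have sp: "VectorSpace.subspace class_ring (V i) (module_vec TYPE('k) n)"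
    "vectorspace.dim class_ring ((module_vec TYPE('k) n)\<lparr>carrier := V i\<rparr>) = part_sum \<alpha> i"
    if "i \<le> ?L" for i
    using V that unfolding is_flag_def by blast+
  define W where "W i = form n ` V i" for i
  have W: "is_submodule (range mv_const) (W i)" and Vc: "V i \<subseteq> carrier_vec n"
    and W_card: "card (W i) = CARD('k) ^ part_sum \<alpha> i" if "i \<le> ?L" for i
    using subspace_form_image[OF sp(1)[OF that]] sp(2)[OF that] by (simp_all add: W_def)
  have W_forms: "W i \<subseteq> forms n" if "i \<le> ?L" for i
    using Vc[OF that] form_image_carrier[of n, where ?'a = 'k] unfolding W_def by blast
  have W_fin: "finite (W i)" if "i \<le> ?L" for i
    using W_forms[OF that] lin_finite unfolding forms_def by (rule finite_subset)
  have V_mono: "V i \<subseteq> V j" if "i \<le> j" "j \<le> ?L" for i j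
    using that
  proof (induction rule: dec_induct)
    case (step j)
    then have "j < ?L" by simp
    then have "V j \<subset> V (Suc j)" using V unfolding is_flag_def by blast
    moreover have "V i \<subseteq> V j" using step by simp
    ultimately show ?case by blast
  qed simp
  have W_mono: "W i \<subseteq> W j" if "i \<le> j" "j \<le> ?L" for i j
    unfolding W_def using V_mono[OF that] by (rule image_mono)
  \<comment> \<open>The step of the flag from which \<open>y j\<close> is chosen.\<close>
  define U where "U j = W (block \<alpha> j)" for j
  have blk: "block \<alpha> j \<le> ?L" "j < part_sum \<alpha> (block \<alpha> j)" if "j < n" for j
    using block(2,3)[of j \<alpha>] that by (simp_all add: n)
  have U_big: "CARD('k) ^ j < card (U j)" if "j < n" for j
    unfolding U_def W_card[OF blk(1)[OF that]] using card_field_gt_1 blk(2)[OF that]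
    by (rule power_strict_increasing[rotated])
  obtain y where y: "\<forall>j<n. y j \<in> U j - lin y j"
    using adapted_basis_exists[of n U, OF U_big] by (rule exE)
  have y_new: "y j \<notin> lin y j" and y_U: "y j \<in> U j" if "j < n" for j using y that by simp_all
  have y_forms: "y j \<in> forms n" if "j < n" for j
    using y_U[OF that] W_forms[OF blk(1)[OF that]] unfolding U_def by blast
  have y_W: "y j \<in> W i" if "j < part_sum \<alpha> i" "i \<le> ?L" for i j
  proof -
    have "part_sum \<alpha> i \<le> n" using part_sum_mono[OF that(2), of \<alpha>] by (simp add: n)
    then have jn: "j < n" using that(1) by simp
    then have "block \<alpha> j \<le> i" using that(1) block_le_iff[of j \<alpha> i] by (simp add: n)
    then show ?thesis using y_U[OF jn] W_mono[of "block \<alpha> j" i] that(2) unfolding U_def by blast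
  qed
  have ps_le: "part_sum \<alpha> i \<le> n" if "i \<le> ?L" for i
    using part_sum_mono[OF that, of \<alpha>] by (simp add: n)
  \<comment> \<open>Each step of the flag is spanned by an initial segment of \<open>y\<close>, because both have equally many elements.\<close>
  have W_lin: "lin y (part_sum \<alpha> i) = W i" if i: "i \<le> ?L" for i
  proof (rule lin_eq_of_card[OF W[OF i] W_fin[OF i]])
    show "card (W i) \<le> CARD('k) ^ part_sum \<alpha> i" by (simp add: W_card[OF i])
    show "y j \<notin> lin y j" if "j < part_sum \<alpha> i" for j using y_new that ps_le[OF i] by simp
    show "y j \<in> W i" if "j < part_sum \<alpha> i" for j using y_W[OF that i] .
  qed
  have GLc: "A \<in> carrier_mat n n" if "A \<in> GL n" for A :: "'k mat" using that by (simp add: GL_def)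
  have GL_ex: "\<exists>A\<in>GL n. \<forall>j<n. linear_action n A (y j) = v j"
    if "\<And>j. j < n \<Longrightarrow> v j \<notin> lin v j" "\<And>j. j < n \<Longrightarrow> v j \<in> forms n" for v
    using y_new y_forms that by (rule GL_with_values)
  have P: "hbasis (invariants n (linear_action n ` ?P))
      (exponents n (\<lambda>j. CARD('k) ^ part_sum \<alpha> (block \<alpha> j) - CARD('k) ^ j))
      (pow_prod n y) (\<lambda>a. \<Sum>j<n. a j) (polys n)"
  proof (rule linear_group_basis[where U = U])
    fix j assume j: "j < n"
    show "is_submodule (range mv_const) (U j)" "U j \<subseteq> forms n"
      "card (U j) = CARD('k) ^ part_sum \<alpha> (block \<alpha> j)" "y j \<in> U j - lin y j"
      using W W_forms W_card blk(1)[OF j] y j by (simp_all add: U_def)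
    show "lin y j \<subseteq> U j"
      unfolding U_def
    proof (rule lin_subset[OF W[OF blk(1)[OF j]]])
      fix i assume "i < j"
      then show "y i \<in> W (block \<alpha> j)" using y_W[OF _ blk(1)[OF j], of i] blk(2)[OF j] by simp
    qed
    show "linear_action n A ` U j = U j" if "A \<in> ?P" for A
    proof -
      have A: "A \<in> carrier_mat n n" "(\<lambda>v. A *\<^sub>v v) ` V (block \<alpha> j) = V (block \<alpha> j)"
        using that blk(1)[OF j] GLc unfolding parabolic_subgroup_def by auto
      show ?thesis
        unfolding U_def W_def form_image_linear_action[OF A(1) Vc[OF blk(1)[OF j]]] A(2) ..
    qed
  next
    fix v assume v: "\<And>j. j < n \<Longrightarrow> v j \<in> U j - lin v j"
    have v_new: "v j \<notin> lin v j" if "j < n" for j using v[OF that] by blast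
    have v_forms: "v j \<in> forms n" if "j < n" for j
      using v[OF that] W_forms[OF blk(1)[OF that]] unfolding U_def by blast
    obtain A where A: "A \<in> GL n" "\<And>j. j < n \<Longrightarrow> linear_action n A (y j) = v j"
      using GL_ex[of v, OF v_new v_forms] by blast
    note Ac = GLc[OF A(1)] and H = graded_homD[OF linear_action_graded_hom[of n A]]
    have "(\<lambda>v. A *\<^sub>v v) ` V i = V i" if i: "i \<le> ?L" for i
    proof (rule GL_image_eqI[OF A(1) Vc[OF i]])
      have "linear_action n A p \<in> W i" if p: "p \<in> W i" for p
      proof -
        obtain c where c: "p = (\<Sum>j<part_sum \<alpha> i. mv_const (c j) * y j)"
          using p unfolding W_lin[OF i, symmetric] by (rule lin_elem)
        have "linear_action n A p = (\<Sum>j<part_sum \<alpha> i. mv_const (c j) * v j)"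
          unfolding c using A(2) ps_le[OF i] by (simp add: H)
        also have "\<dots> \<in> W i"
        proof (intro submodule_sum[OF W[OF i]] submoduleD(3)[OF W[OF i]] rangeI)
          fix j assume "j \<in> {..<part_sum \<alpha> i}"
          then have "j < n" "block \<alpha> j \<le> i" using ps_le[OF i] block_le_iff[of j \<alpha> i] by (simp_all add: n)
          then show "v j \<in> W i" using v W_mono[of "block \<alpha> j" i] i unfolding U_def by blast
        qed
        finally show ?thesis .
      qed
      then have sub: "form n ` (\<lambda>v. A *\<^sub>v v) ` V i \<subseteq> form n ` V i"
        unfolding form_image_linear_action[OF Ac Vc[OF i], symmetric] W_def by blast
      show "(\<lambda>v. A *\<^sub>v v) ` V i \<subseteq> V i"
      proof
        fix u assume "u \<in> (\<lambda>v. A *\<^sub>v v) ` V i"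
        then have "form n u \<in> form n ` V i" "u \<in> carrier_vec n"
          using sub Vc[OF i] mult_mat_vec_carrier[OF Ac] by blast+
        then show "u \<in> V i" using inj_on_image_mem_iff[OF form_inj _ Vc[OF i]] by blast
      qed
    qed
    then have "A \<in> ?P" using A(1) unfolding parabolic_subgroup_def by blast
    then show "\<exists>A\<in>?P. \<forall>j<n. linear_action n A (y j) = v j" using A(2) by blast
  qed
  have G: "hbasis (invariants n (linear_action n ` (GL n :: 'k mat set)))
      (exponents n (\<lambda>j. CARD('k) ^ n - CARD('k) ^ j)) (pow_prod n y) (\<lambda>a. \<Sum>j<n. a j) (polys n)"
  proof (rule linear_group_basis[where U = "\<lambda>_. forms n"])
    fix j assume j: "j < n"
    show "is_submodule (range mv_const) (forms n :: 'k mvpoly set)" unfolding forms_def by (rule lin_submodule)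
    show "card (forms n :: 'k mvpoly set) = CARD('k) ^ n" by (rule card_forms)
    show "y j \<in> forms n - lin y j" using y_forms y_new j by simp
    show "lin y j \<subseteq> forms n"
      unfolding forms_def by (rule lin_subset[OF lin_submodule]) (use y_forms j in \<open>simp add: forms_def\<close>)
    show "linear_action n A ` forms n = forms n" if A: "A \<in> GL n" for A :: "'k mat"
    proof -
      have "(\<lambda>v. A *\<^sub>v v) ` carrier_vec n = carrier_vec n"
        by (rule GL_image_eqI[OF A order.refl]) (use GLc[OF A] in auto)
      then show ?thesis
        unfolding form_image_carrier[symmetric] form_image_linear_action[OF GLc[OF A] order.refl] by simp
    qed
  next
    fix v :: "nat \<Rightarrow> 'k mvpoly" assume "\<And>j. j < n \<Longrightarrow> v j \<in> forms n - lin v j"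
    then show "\<exists>A\<in>GL n. \<forall>j<n. linear_action n A (y j) = v j" by (intro GL_ex) blast+
  qed simp
  show ?thesis using P G by blast
qed

section \<open>The multinomials as quotients of Hilbert series\<close>

lemma t_multinomial_eq:
  assumes "is_composition \<alpha> n"
  shows "t_multinomial n \<alpha>
    = (\<Prod>j<n. 1 - fps_X ^ (n - j)) / (\<Prod>j<n. 1 - fps_X ^ (part_sum \<alpha> (block \<alpha> j) - j))"
proof -
  have n: "n = sum_list \<alpha>" using assms by (simp add: is_composition_def)
  have "(\<Prod>j<n. 1 - fps_X ^ (n - j) :: rat fps) = (\<Prod>i=1..n. 1 - fps_X ^ i)"
    unfolding prod_single_block by (intro prod.cong) simp_all
  moreover have "(\<Prod>j<n. 1 - fps_X ^ (part_sum \<alpha> (block \<alpha> j) - j) :: rat fps)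
      = (\<Prod>s=1..length \<alpha>. \<Prod>i=1..\<alpha> ! (s - 1). 1 - fps_X ^ i)"
    unfolding n prod_blocks[of "\<lambda>s j. 1 - fps_X ^ (part_sum \<alpha> s - j)"]
  proof (intro prod.cong refl)
    fix s i assume s: "s \<in> {1..length \<alpha>}" and i: "i \<in> {1..\<alpha> ! (s - 1)}"
    have "part_sum \<alpha> s = part_sum \<alpha> (s - 1) + \<alpha> ! (s - 1)"
      using part_sum_Suc[of "s - 1" \<alpha>] s by (cases s) simp_all
    then have "part_sum \<alpha> s - (part_sum \<alpha> s - i) = i" using i by simp
    then show "(1 - fps_X ^ (part_sum \<alpha> s - (part_sum \<alpha> s - i)) :: rat fps) = 1 - fps_X ^ i" by simp
  qed
  ultimately show ?thesis unfolding t_multinomial_def by simp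
qed

lemma qt_multinomial_eq:
  assumes "is_composition \<alpha> n"
  shows "qt_multinomial q n \<alpha>
    = (\<Prod>j<n. 1 - fps_X ^ (q ^ n - q ^ j)) / (\<Prod>j<n. 1 - fps_X ^ (q ^ part_sum \<alpha> (block \<alpha> j) - q ^ j))"
proof -
  have n: "n = sum_list \<alpha>" using assms by (simp add: is_composition_def)
  show ?thesis
    unfolding qt_multinomial_def prod_single_block[of "\<lambda>j. 1 - fps_X ^ (q ^ n - q ^ j)"]
    unfolding n prod_blocks[of "\<lambda>s j. 1 - fps_X ^ (q ^ part_sum \<alpha> s - q ^ j)"] ..
qed

theorem corollary7p2:
  fixes \<alpha> :: "nat list" and n q :: nat
    and V :: "nat \<Rightarrow> 'k::{field,finite} vec set"
  assumes "is_composition \<alpha> n"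
    and "q = CARD('k)"
    and "is_flag n \<alpha> V"
  shows
    "(t_multinomial n \<alpha> =
       Hilb_ring (Z_inv n (young_subgroup n \<alpha>)) / Hilb_ring (Z_inv n (symmetric_group n))) \<and>
     (qt_multinomial q n \<alpha> =
       Hilb_ring (F_inv n (parabolic_subgroup n \<alpha> V)) / Hilb_ring (F_inv n (GL n :: 'k mat set))) \<and>
     (free_module (Z_inv n (symmetric_group n))
       (module_via (\<lambda>r. r) (Z_inv n (young_subgroup n \<alpha>)))) \<and>
     (free_module (F_inv n (GL n :: 'k mat set))
       (module_via (\<lambda>r. r) (F_inv n (parabolic_subgroup n \<alpha> V)))) \<and>
     (t_multinomial n \<alpha> =
       Hilb_quotient (Z_inv n (young_subgroup n \<alpha>)) (Z_inv n (symmetric_group n))) \<and>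
     (qt_multinomial q n \<alpha> =
       Hilb_quotient (F_inv n (parabolic_subgroup n \<alpha> V)) (F_inv n (GL n :: 'k mat set)))"
proof -
  have lt: "j < part_sum \<alpha> (block \<alpha> j)" if "j < n" for j
    using block(3)[of j \<alpha>] that assms(1) by (simp add: is_composition_def)
  have young: "perm_action ` young_subgroup n \<alpha> \<subseteq> perm_action ` symmetric_group n"
    by (rule image_mono) (simp add: young_subgroup_def)
  have perm_hom: "graded_hom \<phi>" if "\<phi> \<in> perm_action ` symmetric_group n" for \<phi> :: "int mvpoly \<Rightarrow> int mvpoly"
    using that perm_action_graded_hom by blast
  have pos: "0 < part_sum \<alpha> (block \<alpha> j) - j" if "j < n" for j using lt[OF that] by simp
  note Z = multinomial_quotient[OF principal_consts_int perm_hom young symmetric_group_basis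
      young_subgroup_basis[OF assms(1)] pos, folded t_multinomial_eq[OF assms(1)]]
  obtain y where y:
    "hbasis (invariants n (linear_action n ` parabolic_subgroup n \<alpha> V))
      (exponents n (\<lambda>j. q ^ part_sum \<alpha> (block \<alpha> j) - q ^ j))
      (pow_prod n y) (\<lambda>a. \<Sum>j<n. a j) (polys n)"
    "hbasis (invariants n (linear_action n ` (GL n :: 'k mat set)))
      (exponents n (\<lambda>j. q ^ n - q ^ j)) (pow_prod n y) (\<lambda>a. \<Sum>j<n. a j) (polys n)"
    using parabolic_and_GL_bases[OF assms(1,3)] unfolding assms(2) by blast
  have parabolic: "linear_action n ` parabolic_subgroup n \<alpha> V \<subseteq> linear_action n ` GL n"
    by (rule image_mono) (auto simp: parabolic_subgroup_def)
  have linear_hom: "graded_hom \<phi>" if "\<phi> \<in> linear_action n ` GL n" for \<phi> :: "'k mvpoly \<Rightarrow> 'k mvpoly"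
    using that linear_action_graded_hom by blast
  have qpos: "0 < q ^ part_sum \<alpha> (block \<alpha> j) - q ^ j" if "j < n" for j
    using power_strict_increasing[OF lt[OF that], of q] card_field_gt_1[where ?'k = 'k] assms(2) by simp
  note F = multinomial_quotient[OF principal_consts_field linear_hom parabolic y(2,1) qpos,
      folded qt_multinomial_eq[OF assms(1)]]
  show ?thesis using Z F by blast
qed

end
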